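(* Over $\mathsf{RCA_0}$ the following are equivalent: (1) $\mathsf{WKL_0}$; (2) for every set $S$ and every relation $R\subseteq S^2$, $R$ has a bound if and only if $R$ has a weight function.
   Context: $\mathsf{WKL_0}$ is $\mathsf{RCA_0}$ plus Weak König's Lemma (every infinite binary tree has an infinite path). For $R\subseteq S^2$ with $S\subseteq\mathbb{N}$: a weight function for $R$ is $f:S\to\mathbb{N}$ with $xRy\Rightarrow f(x)<f(y)$; a bound for $R$ is $f:S\to\mathbb{N}$ such that every finite $R$-decreasing sequence $\langle a_0,\dots,a_{l-1}\rangle$ (with $a_{i+1}\,R\,a_i$) satisfies $l\le f(a_0)$. *)

theory Defs
  imports Main
begin

text \<open>
  The language of second-order arithmetic has number variables and set variables. Both are named
  by strings, in separate name spaces. Equality is primitive between numbers only.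
\<close>

type_synonym vname = string

datatype tm =
    V vname
  | Zero  ("\<^bold>0")
  | One  ("\<^bold>1")
  | Plus tm tm  (infixl "\<^bold>+" 70)
  | Times tm tm  (infixl "\<^bold>*" 75)

datatype fm =
    Eq tm tm  (infix "\<^bold>=" 60)
  | Less tm tm  (infix "\<^bold><" 60)
  | In tm vname  (infix "\<^bold>\<in>" 60)
  | Neg fm  ("\<^bold>\<not> _" [55] 55)
  | And fm fm  (infixr "\<^bold>\<and>" 50)
  | Or fm fm  (infixr "\<^bold>\<or>" 45)
  | Imp fm fm  (infixr "\<^bold>\<longrightarrow>" 40)
  | Iff fm fm  (infixr "\<^bold>\<longleftrightarrow>" 40)
  | All vname fm  ("(3\<^bold>\<forall>_\<^bold>./ _)" [100, 35] 35)
  | Ex vname fm  ("(3\<^bold>\<exists>_\<^bold>./ _)" [100, 35] 35)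
  | AllS vname fm  ("(3\<^bold>\<forall>\<^sub>S_\<^bold>./ _)" [100, 35] 35)
  | ExS vname fm  ("(3\<^bold>\<exists>\<^sub>S_\<^bold>./ _)" [100, 35] 35)


section \<open>Structures and satisfaction\<close>

text \<open>
  Semantics is that of general (Henkin) models: the number domain is an arbitrary type, so it may be
  nonstandard, and set quantifiers range over a given collection of subsets of it.
\<close>

record 'a l2_structure =
  Sets :: "'a set set"
  zeroM :: 'a
  oneM :: 'a
  plusM :: "'a \<Rightarrow> 'a \<Rightarrow> 'a"
  timesM :: "'a \<Rightarrow> 'a \<Rightarrow> 'a"
  lessM :: "'a \<Rightarrow> 'a \<Rightarrow> bool"

definition l2_structure :: "'a l2_structure \<Rightarrow> bool" where
  "l2_structure M \<longleftrightarrow> Sets M \<noteq> {}"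

primrec tm_val :: "'a l2_structure \<Rightarrow> (vname \<Rightarrow> 'a) \<Rightarrow> tm \<Rightarrow> 'a" where
  "tm_val M e (V x) = e x"
| "tm_val M e \<^bold>0 = zeroM M"
| "tm_val M e \<^bold>1 = oneM M"
| "tm_val M e (s \<^bold>+ t) = plusM M (tm_val M e s) (tm_val M e t)"
| "tm_val M e (s \<^bold>* t) = timesM M (tm_val M e s) (tm_val M e t)"

primrec sat :: "'a l2_structure \<Rightarrow> (vname \<Rightarrow> 'a) \<Rightarrow> (vname \<Rightarrow> 'a set) \<Rightarrow> fm \<Rightarrow> bool" where
  "sat M e E (s \<^bold>= t) \<longleftrightarrow> tm_val M e s = tm_val M e t"
| "sat M e E (s \<^bold>< t) \<longleftrightarrow> lessM M (tm_val M e s) (tm_val M e t)"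
| "sat M e E (t \<^bold>\<in> X) \<longleftrightarrow> tm_val M e t \<in> E X"
| "sat M e E (\<^bold>\<not> \<phi>) \<longleftrightarrow> \<not> sat M e E \<phi>"
| "sat M e E (\<phi> \<^bold>\<and> \<psi>) \<longleftrightarrow> sat M e E \<phi> \<and> sat M e E \<psi>"
| "sat M e E (\<phi> \<^bold>\<or> \<psi>) \<longleftrightarrow> sat M e E \<phi> \<or> sat M e E \<psi>"
| "sat M e E (\<phi> \<^bold>\<longrightarrow> \<psi>) \<longleftrightarrow> (sat M e E \<phi> \<longrightarrow> sat M e E \<psi>)"
| "sat M e E (\<phi> \<^bold>\<longleftrightarrow> \<psi>) \<longleftrightarrow> (sat M e E \<phi> \<longleftrightarrow> sat M e E \<psi>)"
| "sat M e E (\<^bold>\<forall>x\<^bold>. \<phi>) \<longleftrightarrow> (\<forall>a. sat M (e(x := a)) E \<phi>)"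
| "sat M e E (\<^bold>\<exists>x\<^bold>. \<phi>) \<longleftrightarrow> (\<exists>a. sat M (e(x := a)) E \<phi>)"
| "sat M e E (\<^bold>\<forall>\<^sub>SX\<^bold>. \<phi>) \<longleftrightarrow> (\<forall>A\<in>Sets M. sat M e (E(X := A)) \<phi>)"
| "sat M e E (\<^bold>\<exists>\<^sub>SX\<^bold>. \<phi>) \<longleftrightarrow> (\<exists>A\<in>Sets M. sat M e (E(X := A)) \<phi>)"

text \<open>Formulas with free variables (parameters) are read as their universal closures.\<close>

definition models :: "'a l2_structure \<Rightarrow> fm set \<Rightarrow> bool"  (infix "\<Turnstile>" 50) where
  "M \<Turnstile> T \<longleftrightarrow> (\<forall>\<phi>\<in>T. \<forall>e E. (\<forall>X. E X \<in> Sets M) \<longrightarrow> sat M e E \<phi>)"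


section \<open>The axioms of RCA_0\<close>

primrec tm_vars :: "tm \<Rightarrow> vname set" where
  "tm_vars (V x) = {x}"
| "tm_vars \<^bold>0 = {}"
| "tm_vars \<^bold>1 = {}"
| "tm_vars (s \<^bold>+ t) = tm_vars s \<union> tm_vars t"
| "tm_vars (s \<^bold>* t) = tm_vars s \<union> tm_vars t"

primrec set_fv :: "fm \<Rightarrow> vname set" where
  "set_fv (s \<^bold>= t) = {}"
| "set_fv (s \<^bold>< t) = {}"
| "set_fv (t \<^bold>\<in> X) = {X}"
| "set_fv (\<^bold>\<not> \<phi>) = set_fv \<phi>"
| "set_fv (\<phi> \<^bold>\<and> \<psi>) = set_fv \<phi> \<union> set_fv \<psi>"
| "set_fv (\<phi> \<^bold>\<or> \<psi>) = set_fv \<phi> \<union> set_fv \<psi>"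
| "set_fv (\<phi> \<^bold>\<longrightarrow> \<psi>) = set_fv \<phi> \<union> set_fv \<psi>"
| "set_fv (\<phi> \<^bold>\<longleftrightarrow> \<psi>) = set_fv \<phi> \<union> set_fv \<psi>"
| "set_fv (\<^bold>\<forall>x\<^bold>. \<phi>) = set_fv \<phi>"
| "set_fv (\<^bold>\<exists>x\<^bold>. \<phi>) = set_fv \<phi>"
| "set_fv (\<^bold>\<forall>\<^sub>SX\<^bold>. \<phi>) = set_fv \<phi> - {X}"
| "set_fv (\<^bold>\<exists>\<^sub>SX\<^bold>. \<phi>) = set_fv \<phi> - {X}"

primrec tm_subst :: "vname \<Rightarrow> tm \<Rightarrow> tm \<Rightarrow> tm" where
  "tm_subst x r (V y) = (if y = x then r else V y)"
| "tm_subst x r \<^bold>0 = \<^bold>0"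
| "tm_subst x r \<^bold>1 = \<^bold>1"
| "tm_subst x r (s \<^bold>+ t) = tm_subst x r s \<^bold>+ tm_subst x r t"
| "tm_subst x r (s \<^bold>* t) = tm_subst x r s \<^bold>* tm_subst x r t"

text \<open>
  Substitution of the term \<open>r\<close> for the free occurrences of \<open>x\<close>. It is used only for \<open>r\<close> without
  variables other than \<open>x\<close> itself (namely 0 and x + 1), for which no capture can occur.
\<close>

primrec subst :: "vname \<Rightarrow> tm \<Rightarrow> fm \<Rightarrow> fm" where
  "subst x r (s \<^bold>= t) = (tm_subst x r s \<^bold>= tm_subst x r t)"
| "subst x r (s \<^bold>< t) = (tm_subst x r s \<^bold>< tm_subst x r t)"
| "subst x r (t \<^bold>\<in> X) = (tm_subst x r t \<^bold>\<in> X)"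
| "subst x r (\<^bold>\<not> \<phi>) = (\<^bold>\<not> subst x r \<phi>)"
| "subst x r (\<phi> \<^bold>\<and> \<psi>) = (subst x r \<phi> \<^bold>\<and> subst x r \<psi>)"
| "subst x r (\<phi> \<^bold>\<or> \<psi>) = (subst x r \<phi> \<^bold>\<or> subst x r \<psi>)"
| "subst x r (\<phi> \<^bold>\<longrightarrow> \<psi>) = (subst x r \<phi> \<^bold>\<longrightarrow> subst x r \<psi>)"
| "subst x r (\<phi> \<^bold>\<longleftrightarrow> \<psi>) = (subst x r \<phi> \<^bold>\<longleftrightarrow> subst x r \<psi>)"
| "subst x r (\<^bold>\<forall>y\<^bold>. \<phi>) = (\<^bold>\<forall>y\<^bold>. (if y = x then \<phi> else subst x r \<phi>))"
| "subst x r (\<^bold>\<exists>y\<^bold>. \<phi>) = (\<^bold>\<exists>y\<^bold>. (if y = x then \<phi> else subst x r \<phi>))"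
| "subst x r (\<^bold>\<forall>\<^sub>SX\<^bold>. \<phi>) = (\<^bold>\<forall>\<^sub>SX\<^bold>. subst x r \<phi>)"
| "subst x r (\<^bold>\<exists>\<^sub>SX\<^bold>. \<phi>) = (\<^bold>\<exists>\<^sub>SX\<^bold>. subst x r \<phi>)"

inductive bounded_fm :: "fm \<Rightarrow> bool" where
  "bounded_fm (s \<^bold>= t)"
| "bounded_fm (s \<^bold>< t)"
| "bounded_fm (t \<^bold>\<in> X)"
| "bounded_fm \<phi> \<Longrightarrow> bounded_fm (\<^bold>\<not> \<phi>)"
| "bounded_fm \<phi> \<Longrightarrow> bounded_fm \<psi> \<Longrightarrow> bounded_fm (\<phi> \<^bold>\<and> \<psi>)"
| "bounded_fm \<phi> \<Longrightarrow> bounded_fm \<psi> \<Longrightarrow> bounded_fm (\<phi> \<^bold>\<or> \<psi>)"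
| "bounded_fm \<phi> \<Longrightarrow> bounded_fm \<psi> \<Longrightarrow> bounded_fm (\<phi> \<^bold>\<longrightarrow> \<psi>)"
| "bounded_fm \<phi> \<Longrightarrow> bounded_fm \<psi> \<Longrightarrow> bounded_fm (\<phi> \<^bold>\<longleftrightarrow> \<psi>)"
| "bounded_fm \<phi> \<Longrightarrow> x \<notin> tm_vars t \<Longrightarrow> bounded_fm (\<^bold>\<forall>x\<^bold>. V x \<^bold>< t \<^bold>\<longrightarrow> \<phi>)"
| "bounded_fm \<phi> \<Longrightarrow> x \<notin> tm_vars t \<Longrightarrow> bounded_fm (\<^bold>\<exists>x\<^bold>. V x \<^bold>< t \<^bold>\<and> \<phi>)"

definition Sigma01 :: "fm set" where
  "Sigma01 = {\<^bold>\<exists>x\<^bold>. \<theta> | x \<theta>. bounded_fm \<theta>}"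

definition Pi01 :: "fm set" where
  "Pi01 = {\<^bold>\<forall>x\<^bold>. \<theta> | x \<theta>. bounded_fm \<theta>}"

definition basic_axioms :: "fm set" where
  "basic_axioms =
    (let m = V ''m''; n = V ''n'' in
     { \<^bold>\<not> n \<^bold>+ \<^bold>1 \<^bold>= \<^bold>0,
       m \<^bold>+ \<^bold>1 \<^bold>= n \<^bold>+ \<^bold>1 \<^bold>\<longrightarrow> m \<^bold>= n,
       m \<^bold>+ \<^bold>0 \<^bold>= m,
       m \<^bold>+ (n \<^bold>+ \<^bold>1) \<^bold>= (m \<^bold>+ n) \<^bold>+ \<^bold>1,
       m \<^bold>* \<^bold>0 \<^bold>= \<^bold>0,
       m \<^bold>* (n \<^bold>+ \<^bold>1) \<^bold>= (m \<^bold>* n) \<^bold>+ m,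
       \<^bold>\<not> m \<^bold>< \<^bold>0,
       m \<^bold>< n \<^bold>+ \<^bold>1 \<^bold>\<longleftrightarrow> (m \<^bold>< n \<^bold>\<or> m \<^bold>= n) })"

definition Sigma01_induction :: "fm set" where
  "Sigma01_induction =
    { (subst n \<^bold>0 \<phi> \<^bold>\<and> (\<^bold>\<forall>n\<^bold>. \<phi> \<^bold>\<longrightarrow> subst n (V n \<^bold>+ \<^bold>1) \<phi>)) \<^bold>\<longrightarrow> (\<^bold>\<forall>n\<^bold>. \<phi>)
      | n \<phi>. \<phi> \<in> Sigma01 }"

definition Delta01_comprehension :: "fm set" where
  "Delta01_comprehension =
    { (\<^bold>\<forall>n\<^bold>. \<phi> \<^bold>\<longleftrightarrow> \<psi>) \<^bold>\<longrightarrow> (\<^bold>\<exists>\<^sub>SX\<^bold>. \<^bold>\<forall>n\<^bold>. V n \<^bold>\<in> X \<^bold>\<longleftrightarrow> \<phi>)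
      | n X \<phi> \<psi>. \<phi> \<in> Sigma01 \<and> \<psi> \<in> Pi01 \<and> X \<notin> set_fv \<phi> }"

definition RCA0 :: "fm set" where
  "RCA0 = basic_axioms \<union> Sigma01_induction \<union> Delta01_comprehension"


section \<open>Coding in the language of second-order arithmetic\<close>

text \<open>
  The defining formulas below bind fixed variable names, so their arguments must not contain those
  names. That all uses respect this is confirmed by the lemmas at the end of this theory, which
  compute the meaning of the two principles.
\<close>

definition pair :: "tm \<Rightarrow> tm \<Rightarrow> tm"  ("\<^bold>\<langle>_\<^bold>,/ _\<^bold>\<rangle>") where
  "\<^bold>\<langle>s\<^bold>, t\<^bold>\<rangle> = (s \<^bold>+ t) \<^bold>* (s \<^bold>+ t) \<^bold>+ s"

text \<open>
  A number (k,(m,n)) represents the finite set of all x < k such that m(x + 1) + 1 divides n;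
  a number not of this form represents the empty set. In RCA_0 every finite set is so represented.
  The code of a finite set is the least number representing it.
\<close>

definition fin_mem :: "tm \<Rightarrow> tm \<Rightarrow> fm"  (infix "\<^bold>\<epsilon>" 60) where
  "x \<^bold>\<epsilon> c =
    (let k = ''k''; m = ''m''; n = ''n''; q = ''q'' in
     \<^bold>\<exists>k\<^bold>. \<^bold>\<exists>m\<^bold>. \<^bold>\<exists>n\<^bold>. c \<^bold>= \<^bold>\<langle>V k\<^bold>, \<^bold>\<langle>V m\<^bold>, V n\<^bold>\<rangle>\<^bold>\<rangle> \<^bold>\<and> x \<^bold>< V k \<^bold>\<and>
       (\<^bold>\<exists>q\<^bold>. V n \<^bold>= V q \<^bold>* (V m \<^bold>* (x \<^bold>+ \<^bold>1) \<^bold>+ \<^bold>1)))"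

definition fin_set_code :: "tm \<Rightarrow> fm" where
  "fin_set_code c =
    (let d = ''d''; x = ''x'' in
     \<^bold>\<forall>d\<^bold>. V d \<^bold>< c \<^bold>\<longrightarrow> \<^bold>\<not> (\<^bold>\<forall>x\<^bold>. V x \<^bold>\<epsilon> V d \<^bold>\<longleftrightarrow> V x \<^bold>\<epsilon> c))"

text \<open>
  A finite sequence of length l is (the code of) a finite set of pairs (i,y) that is the graph of a
  function on the numbers below l.
\<close>

definition seq_of_length :: "tm \<Rightarrow> tm \<Rightarrow> fm" where
  "seq_of_length s l =
    (let i = ''i''; p = ''p''; y = ''y''; z = ''z'' in
     fin_set_code s \<^bold>\<and>
     (\<^bold>\<forall>p\<^bold>. V p \<^bold>\<epsilon> s \<^bold>\<longrightarrow> (\<^bold>\<exists>i\<^bold>. \<^bold>\<exists>y\<^bold>. V p \<^bold>= \<^bold>\<langle>V i\<^bold>, V y\<^bold>\<rangle>)) \<^bold>\<and>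
     (\<^bold>\<forall>i\<^bold>. \<^bold>\<forall>y\<^bold>. \<^bold>\<forall>z\<^bold>. \<^bold>\<langle>V i\<^bold>, V y\<^bold>\<rangle> \<^bold>\<epsilon> s \<^bold>\<and> \<^bold>\<langle>V i\<^bold>, V z\<^bold>\<rangle> \<^bold>\<epsilon> s \<^bold>\<longrightarrow> V y \<^bold>= V z) \<^bold>\<and>
     (\<^bold>\<forall>i\<^bold>. V i \<^bold>< l \<^bold>\<longleftrightarrow> (\<^bold>\<exists>y\<^bold>. \<^bold>\<langle>V i\<^bold>, V y\<^bold>\<rangle> \<^bold>\<epsilon> s)))"

definition is_seq :: "tm \<Rightarrow> fm" where
  "is_seq s = (let l = ''l'' in \<^bold>\<exists>l\<^bold>. seq_of_length s (V l))"

text \<open>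
  \<open>fun_on f D\<close>: the set f is the graph of a function from D to the natural numbers, where D is the
  set of all t with \<open>D t\<close>.
\<close>

definition fun_on :: "vname \<Rightarrow> (tm \<Rightarrow> fm) \<Rightarrow> fm" where
  "fun_on f D =
    (let p = ''p''; x = ''x''; y = ''y''; z = ''z'' in
     (\<^bold>\<forall>p\<^bold>. V p \<^bold>\<in> f \<^bold>\<longrightarrow> (\<^bold>\<exists>x\<^bold>. \<^bold>\<exists>y\<^bold>. D (V x) \<^bold>\<and> V p \<^bold>= \<^bold>\<langle>V x\<^bold>, V y\<^bold>\<rangle>)) \<^bold>\<and>
     (\<^bold>\<forall>x\<^bold>. D (V x) \<^bold>\<longrightarrow> (\<^bold>\<exists>y\<^bold>. \<^bold>\<langle>V x\<^bold>, V y\<^bold>\<rangle> \<^bold>\<in> f)) \<^bold>\<and>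
     (\<^bold>\<forall>x\<^bold>. \<^bold>\<forall>y\<^bold>. \<^bold>\<forall>z\<^bold>. \<^bold>\<langle>V x\<^bold>, V y\<^bold>\<rangle> \<^bold>\<in> f \<^bold>\<and> \<^bold>\<langle>V x\<^bold>, V z\<^bold>\<rangle> \<^bold>\<in> f \<^bold>\<longrightarrow> V y \<^bold>= V z))"


section \<open>Weak Koenig's Lemma\<close>

text \<open>As sequences are identified with their graphs, t is an initial segment of s iff t is a subset of s.\<close>

definition binary_tree :: "vname \<Rightarrow> fm" where
  "binary_tree T =
    (let s = ''s''; t = ''t''; i = ''i''; y = ''y''; p = ''p'' in
     (\<^bold>\<forall>s\<^bold>. V s \<^bold>\<in> T \<^bold>\<longrightarrow>
        is_seq (V s) \<^bold>\<and>
        (\<^bold>\<forall>i\<^bold>. \<^bold>\<forall>y\<^bold>. \<^bold>\<langle>V i\<^bold>, V y\<^bold>\<rangle> \<^bold>\<epsilon> V s \<^bold>\<longrightarrow> V y \<^bold>= \<^bold>0 \<^bold>\<or> V y \<^bold>= \<^bold>1)) \<^bold>\<and>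
     (\<^bold>\<forall>s\<^bold>. \<^bold>\<forall>t\<^bold>. V s \<^bold>\<in> T \<^bold>\<and> is_seq (V t) \<^bold>\<and> (\<^bold>\<forall>p\<^bold>. V p \<^bold>\<epsilon> V t \<^bold>\<longrightarrow> V p \<^bold>\<epsilon> V s) \<^bold>\<longrightarrow> V t \<^bold>\<in> T))"

definition infinite_set :: "vname \<Rightarrow> fm" where
  "infinite_set T = (let b = ''b''; s = ''s'' in \<^bold>\<forall>b\<^bold>. \<^bold>\<exists>s\<^bold>. V b \<^bold>< V s \<^bold>\<and> V s \<^bold>\<in> T)"

text \<open>A path is a function g on the natural numbers all of whose restrictions g[l] belong to T.\<close>

definition path_through :: "vname \<Rightarrow> vname \<Rightarrow> fm" where
  "path_through g T =
    (let l = ''l''; s = ''s''; i = ''i''; y = ''y'' in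
     fun_on g (\<lambda>t. t \<^bold>= t) \<^bold>\<and>
     (\<^bold>\<forall>l\<^bold>. \<^bold>\<exists>s\<^bold>. V s \<^bold>\<in> T \<^bold>\<and> seq_of_length (V s) (V l) \<^bold>\<and>
        (\<^bold>\<forall>i\<^bold>. \<^bold>\<forall>y\<^bold>. \<^bold>\<langle>V i\<^bold>, V y\<^bold>\<rangle> \<^bold>\<epsilon> V s \<^bold>\<longrightarrow> \<^bold>\<langle>V i\<^bold>, V y\<^bold>\<rangle> \<^bold>\<in> g)))"

definition WKL :: fm where
  "WKL = (let T = ''T''; g = ''g'' in
     \<^bold>\<forall>\<^sub>ST\<^bold>. binary_tree T \<^bold>\<and> infinite_set T \<^bold>\<longrightarrow> (\<^bold>\<exists>\<^sub>Sg\<^bold>. path_through g T))"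

definition WKL0 :: "fm set" where
  "WKL0 = RCA0 \<union> {WKL}"


section \<open>Bounds and weight functions\<close>

definition relation_on :: "vname \<Rightarrow> vname \<Rightarrow> fm" where
  "relation_on R S =
    (let p = ''p''; x = ''x''; y = ''y'' in
     \<^bold>\<forall>p\<^bold>. V p \<^bold>\<in> R \<^bold>\<longrightarrow> (\<^bold>\<exists>x\<^bold>. \<^bold>\<exists>y\<^bold>. V x \<^bold>\<in> S \<^bold>\<and> V y \<^bold>\<in> S \<^bold>\<and> V p \<^bold>= \<^bold>\<langle>V x\<^bold>, V y\<^bold>\<rangle>))"

definition weight_function :: "vname \<Rightarrow> vname \<Rightarrow> vname \<Rightarrow> fm" where
  "weight_function f R S =
    (let x = ''x''; y = ''y''; u = ''u''; v = ''v'' in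
     fun_on f (\<lambda>t. t \<^bold>\<in> S) \<^bold>\<and>
     (\<^bold>\<forall>x\<^bold>. \<^bold>\<forall>y\<^bold>. \<^bold>\<forall>u\<^bold>. \<^bold>\<forall>v\<^bold>.
        \<^bold>\<langle>V x\<^bold>, V y\<^bold>\<rangle> \<^bold>\<in> R \<^bold>\<and> \<^bold>\<langle>V x\<^bold>, V u\<^bold>\<rangle> \<^bold>\<in> f \<^bold>\<and> \<^bold>\<langle>V y\<^bold>, V v\<^bold>\<rangle> \<^bold>\<in> f \<^bold>\<longrightarrow> V u \<^bold>< V v))"

definition decreasing_seq :: "tm \<Rightarrow> tm \<Rightarrow> vname \<Rightarrow> vname \<Rightarrow> fm" where
  "decreasing_seq s l R S =
    (let i = ''i''; x = ''x''; y = ''y'' in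
     seq_of_length s l \<^bold>\<and>
     (\<^bold>\<forall>i\<^bold>. \<^bold>\<forall>x\<^bold>. \<^bold>\<langle>V i\<^bold>, V x\<^bold>\<rangle> \<^bold>\<epsilon> s \<^bold>\<longrightarrow> V x \<^bold>\<in> S) \<^bold>\<and>
     (\<^bold>\<forall>i\<^bold>. \<^bold>\<forall>x\<^bold>. \<^bold>\<forall>y\<^bold>.
        \<^bold>\<langle>V i\<^bold>, V x\<^bold>\<rangle> \<^bold>\<epsilon> s \<^bold>\<and> \<^bold>\<langle>V i \<^bold>+ \<^bold>1\<^bold>, V y\<^bold>\<rangle> \<^bold>\<epsilon> s \<^bold>\<longrightarrow> \<^bold>\<langle>V y\<^bold>, V x\<^bold>\<rangle> \<^bold>\<in> R))"

text \<open>The empty sequence has no first entry and so puts no constraint on f.\<close>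

definition bound :: "vname \<Rightarrow> vname \<Rightarrow> vname \<Rightarrow> fm" where
  "bound f R S =
    (let s = ''s''; l = ''l''; a = ''a''; b = ''b'' in
     fun_on f (\<lambda>t. t \<^bold>\<in> S) \<^bold>\<and>
     (\<^bold>\<forall>s\<^bold>. \<^bold>\<forall>l\<^bold>. \<^bold>\<forall>a\<^bold>. \<^bold>\<forall>b\<^bold>.
        decreasing_seq (V s) (V l) R S \<^bold>\<and> \<^bold>\<langle>\<^bold>0\<^bold>, V a\<^bold>\<rangle> \<^bold>\<epsilon> V s \<^bold>\<and> \<^bold>\<langle>V a\<^bold>, V b\<^bold>\<rangle> \<^bold>\<in> f \<^bold>\<longrightarrow>
        V l \<^bold>< V b \<^bold>\<or> V l \<^bold>= V b))"

definition bound_iff_weight :: fm where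
  "bound_iff_weight =
    (let S = ''S''; R = ''R''; f = ''f'' in
     \<^bold>\<forall>\<^sub>SS\<^bold>. \<^bold>\<forall>\<^sub>SR\<^bold>. relation_on R S \<^bold>\<longrightarrow>
       ((\<^bold>\<exists>\<^sub>Sf\<^bold>. bound f R S) \<^bold>\<longleftrightarrow> (\<^bold>\<exists>\<^sub>Sf\<^bold>. weight_function f R S)))"


section \<open>The meaning of the formulas in a structure\<close>

lemma tm_val_cong:
  "(\<And>y. y \<in> tm_vars t \<Longrightarrow> e y = e' y) \<Longrightarrow> tm_val M e t = tm_val M e' t"
  by (induction t) auto

lemma tm_val_subst: "tm_val M e (tm_subst x r t) = tm_val M (e(x := tm_val M e r)) t"
  by (induction t) auto

lemma sat_subst:
  assumes "tm_vars r \<subseteq> {x}"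
  shows "sat M e E (subst x r \<phi>) \<longleftrightarrow> sat M (e(x := tm_val M e r)) E \<phi>"
proof (induction \<phi> arbitrary: e E)
  case (All y \<phi>)
  show ?case
  proof (cases "y = x")
    case False
    then have "tm_val M (e(y := a)) r = tm_val M e r" for a
      using assms by (intro tm_val_cong) auto
    moreover have "e(y := a, x := c) = e(x := c, y := a)" for a c
      using False by (rule fun_upd_twist)
    ultimately show ?thesis using False All by (simp del: fun_upd_apply)
  qed (simp del: fun_upd_apply)
next
  case (Ex y \<phi>)
  show ?case
  proof (cases "y = x")
    case False
    then have "tm_val M (e(y := a)) r = tm_val M e r" for a
      using assms by (intro tm_val_cong) auto
    moreover have "e(y := a, x := c) = e(x := c, y := a)" for a c
      using False by (rule fun_upd_twist)
    ultimately show ?thesis using False Ex by (simp del: fun_upd_apply)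
  qed (simp del: fun_upd_apply)
qed (simp_all add: tm_val_subst)

context
  fixes M :: "'a l2_structure"
begin

definition pairM :: "'a \<Rightarrow> 'a \<Rightarrow> 'a" where
  "pairM a b = plusM M (timesM M (plusM M a b) (plusM M a b)) a"

definition fin_memM :: "'a \<Rightarrow> 'a \<Rightarrow> bool" where
  "fin_memM x c \<longleftrightarrow> (\<exists>k m n. c = pairM k (pairM m n) \<and> lessM M x k \<and>
     (\<exists>q. n = timesM M q (plusM M (timesM M m (plusM M x (oneM M))) (oneM M))))"

definition seq_of_lengthM :: "'a \<Rightarrow> 'a \<Rightarrow> bool" where
  "seq_of_lengthM s l \<longleftrightarrow>
     (\<forall>d. lessM M d s \<longrightarrow> \<not> (\<forall>x. fin_memM x d \<longleftrightarrow> fin_memM x s)) \<and>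
     (\<forall>p. fin_memM p s \<longrightarrow> (\<exists>i y. p = pairM i y)) \<and>
     (\<forall>i y z. fin_memM (pairM i y) s \<and> fin_memM (pairM i z) s \<longrightarrow> y = z) \<and>
     (\<forall>i. lessM M i l \<longleftrightarrow> (\<exists>y. fin_memM (pairM i y) s))"

definition fun_onM :: "'a set \<Rightarrow> 'a set \<Rightarrow> bool" where
  "fun_onM F D \<longleftrightarrow>
     (\<forall>p\<in>F. \<exists>x y. x \<in> D \<and> p = pairM x y) \<and>
     (\<forall>x\<in>D. \<exists>y. pairM x y \<in> F) \<and>
     (\<forall>x y z. pairM x y \<in> F \<and> pairM x z \<in> F \<longrightarrow> y = z)"

definition decreasing_seqM :: "'a \<Rightarrow> 'a \<Rightarrow> 'a set \<Rightarrow> 'a set \<Rightarrow> bool" where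
  "decreasing_seqM s l R S \<longleftrightarrow>
     seq_of_lengthM s l \<and>
     (\<forall>i x. fin_memM (pairM i x) s \<longrightarrow> x \<in> S) \<and>
     (\<forall>i x y. fin_memM (pairM i x) s \<and> fin_memM (pairM (plusM M i (oneM M)) y) s
        \<longrightarrow> pairM y x \<in> R)"

definition relation_onM :: "'a set \<Rightarrow> 'a set \<Rightarrow> bool" where
  "relation_onM R S \<longleftrightarrow> (\<forall>p\<in>R. \<exists>x y. x \<in> S \<and> y \<in> S \<and> p = pairM x y)"

definition binary_treeM :: "'a set \<Rightarrow> bool" where
  "binary_treeM T \<longleftrightarrow>
     (\<forall>s\<in>T. (\<exists>l. seq_of_lengthM s l) \<and>
        (\<forall>i y. fin_memM (pairM i y) s \<longrightarrow> y = zeroM M \<or> y = oneM M)) \<and>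
     (\<forall>s t. s \<in> T \<and> (\<exists>l. seq_of_lengthM t l) \<and> (\<forall>p. fin_memM p t \<longrightarrow> fin_memM p s)
        \<longrightarrow> t \<in> T)"

lemma tm_val_pair [simp]: "tm_val M e \<^bold>\<langle>s\<^bold>, t\<^bold>\<rangle> = pairM (tm_val M e s) (tm_val M e t)"
  by (simp add: pair_def pairM_def)

lemma tm_vars_pair [simp]: "tm_vars \<^bold>\<langle>s\<^bold>, t\<^bold>\<rangle> = tm_vars s \<union> tm_vars t"
  by (auto simp: pair_def)

lemma tm_val_upd [simp]: "x \<notin> tm_vars t \<Longrightarrow> tm_val M (e(x := a)) t = tm_val M e t"
  by (rule tm_val_cong) auto

lemma sat_fin_mem [simp]:
  assumes "(tm_vars x \<union> tm_vars c) \<inter> {''k'', ''m'', ''n'', ''q''} = {}"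
  shows "sat M e E (x \<^bold>\<epsilon> c) \<longleftrightarrow> fin_memM (tm_val M e x) (tm_val M e c)"
  using assms by (simp add: Let_def fin_mem_def fin_memM_def)

lemma sat_seq_of_length [simp]:
  assumes "(tm_vars s \<union> tm_vars l) \<inter>
    {''k'', ''m'', ''n'', ''q'', ''d'', ''x'', ''i'', ''p'', ''y'', ''z''} = {}"
  shows "sat M e E (seq_of_length s l) \<longleftrightarrow> seq_of_lengthM (tm_val M e s) (tm_val M e l)"
  using assms by (simp add: Let_def seq_of_length_def fin_set_code_def seq_of_lengthM_def)

lemma sat_is_seq [simp]:
  assumes "tm_vars s \<inter>
    {''k'', ''m'', ''n'', ''q'', ''d'', ''x'', ''i'', ''p'', ''y'', ''z'', ''l''} = {}"
  shows "sat M e E (is_seq s) \<longleftrightarrow> (\<exists>l. seq_of_lengthM (tm_val M e s) l)"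
  using assms by (simp add: Let_def is_seq_def)

lemma sat_fun_on:
  assumes "\<And>e x. sat M e E (D (V x)) \<longleftrightarrow> e x \<in> A"
  shows "sat M e E (fun_on f D) \<longleftrightarrow> fun_onM (E f) A"
  by (simp add: Let_def fun_on_def fun_onM_def assms Ball_def)

lemma sat_decreasing_seq:
  assumes "(tm_vars s \<union> tm_vars l) \<inter>
    {''k'', ''m'', ''n'', ''q'', ''d'', ''x'', ''i'', ''p'', ''y'', ''z''} = {}"
  shows "sat M e E (decreasing_seq s l R S) \<longleftrightarrow>
    decreasing_seqM (tm_val M e s) (tm_val M e l) (E R) (E S)"
  using assms by (simp add: Let_def decreasing_seq_def decreasing_seqM_def)

lemma sat_bound:
  "sat M e E (bound f R S) \<longleftrightarrow> fun_onM (E f) (E S) \<and>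
     (\<forall>s l a b. decreasing_seqM s l (E R) (E S) \<and>
        fin_memM (pairM (zeroM M) a) s \<and> pairM a b \<in> E f \<longrightarrow> lessM M l b \<or> l = b)"
  by (simp add: Let_def bound_def sat_decreasing_seq sat_fun_on[where A = "E S"])

lemma sat_weight_function:
  "sat M e E (weight_function f R S) \<longleftrightarrow> fun_onM (E f) (E S) \<and>
     (\<forall>x y u v. pairM x y \<in> E R \<and> pairM x u \<in> E f \<and> pairM y v \<in> E f \<longrightarrow> lessM M u v)"
  by (simp add: Let_def weight_function_def sat_fun_on[where A = "E S"])

lemma sat_relation_on:
  "sat M e E (relation_on R S) \<longleftrightarrow> relation_onM (E R) (E S)"
  by (simp add: Let_def relation_on_def relation_onM_def Ball_def)

lemma sat_path_through:
  "sat M e E (path_through g T) \<longleftrightarrow> fun_onM (E g) UNIV \<and>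
     (\<forall>l. \<exists>s\<in>E T. seq_of_lengthM s l \<and> (\<forall>i y. fin_memM (pairM i y) s \<longrightarrow> pairM i y \<in> E g))"
  by (simp add: Let_def path_through_def sat_fun_on[where A = UNIV] Bex_def)

lemma sat_binary_tree: "sat M e E (binary_tree T) \<longleftrightarrow> binary_treeM (E T)"
  by (simp add: Let_def binary_tree_def binary_treeM_def Ball_def)

lemma sat_WKL:
  "sat M e E WKL \<longleftrightarrow>
    (\<forall>T\<in>Sets M. binary_treeM T \<and> (\<forall>b. \<exists>s. lessM M b s \<and> s \<in> T) \<longrightarrow>
      (\<exists>G\<in>Sets M. fun_onM G UNIV \<and>
         (\<forall>l. \<exists>s\<in>T. seq_of_lengthM s l \<and> (\<forall>i y. fin_memM (pairM i y) s \<longrightarrow> pairM i y \<in> G))))"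
  by (simp add: Let_def WKL_def infinite_set_def sat_binary_tree sat_path_through)

lemma sat_bound_iff_weight:
  "sat M e E bound_iff_weight \<longleftrightarrow>
    (\<forall>S\<in>Sets M. \<forall>R\<in>Sets M. relation_onM R S \<longrightarrow>
      ((\<exists>F\<in>Sets M. fun_onM F S \<and>
          (\<forall>s l a b. decreasing_seqM s l R S \<and>
             fin_memM (pairM (zeroM M) a) s \<and> pairM a b \<in> F \<longrightarrow> lessM M l b \<or> l = b)) \<longleftrightarrow>
       (\<exists>F\<in>Sets M. fun_onM F S \<and>
          (\<forall>x y u v. pairM x y \<in> R \<and> pairM x u \<in> F \<and> pairM y v \<in> F \<longrightarrow> lessM M u v))))"
  by (simp add: Let_def bound_iff_weight_def sat_relation_on sat_bound sat_weight_function)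

end

end

theory Submission
  imports Defs
begin

text \<open>
  A weight function f yields the bound f + 1. Conversely, given a bound h, the sets of pairs (x,j)
  with j at most the weight of x are described by closure conditions that can be checked on finite
  initial segments, so they form the paths of a binary tree; the tree is infinite because
  the set of (x,j) such that a decreasing sequence of length j + 1 starts at x satisfies the
  conditions, and its initial segments exist by bounded Sigma-1 comprehension. For the reversal,
  disjoint Sigma-1 sets A and B are separated by comparing the weights of two elements attached to
  each x, which a witness for A, respectively B, links by a chain in one or the other direction; all
  chains have length at most 3. Separation gives Weak Koenig's Lemma by separating the nodes whose left
  subtree dies out first from those whose right subtree does.

  All of this takes place in a possibly nonstandard model. A predicate on environments
  is Delta-0 (D0), Sigma-1 (S1) or Delta-1 (R1) if it is defined by such a formula with
  parameters, and F1 are the functions with Sigma-1 graph.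
\<close>

section \<open>Renaming of variables\<close>

text \<open>The obvious weight of x, read off from the longest decreasing sequence starting at x,
  need not be available: whether some such sequence has length j + 1 is a Sigma-1 question, and only
  Delta-1 sets can be formed. A path supplies a set that merely satisfies the same closure
  conditions; the weight of x is then the least j for which (x,j) is missing from it, and the bound
  h guarantees that such a j exists. Induction too is given only for Sigma-1 formulas. Searches over
  finite sets are therefore bounded by explicit codes so that they stay Delta-1, and where a
  statement about all levels of a tree must be carried along a path, induction for Pi-1 predicates
  is derived from the Sigma-1 scheme. Codes of finite sets themselves have to be built inside the
  model, by divisibility, before any sequence can be handled. The axioms concern formulas with named
  variables, while the arguments use predicates. Injective renamings bridge the two: they keep the
  parameters of different formulas apart and leave the shared variables alone, so that definability
  can be read off the shape of a predicate.\<close>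

primrec tm_ren :: "(vname \<Rightarrow> vname) \<Rightarrow> tm \<Rightarrow> tm" where
  "tm_ren r (V x) = V (r x)"
| "tm_ren r \<^bold>0 = \<^bold>0"
| "tm_ren r \<^bold>1 = \<^bold>1"
| "tm_ren r (s \<^bold>+ t) = tm_ren r s \<^bold>+ tm_ren r t"
| "tm_ren r (s \<^bold>* t) = tm_ren r s \<^bold>* tm_ren r t"

primrec fm_ren :: "(vname \<Rightarrow> vname) \<Rightarrow> (vname \<Rightarrow> vname) \<Rightarrow> fm \<Rightarrow> fm" where
  "fm_ren r q (s \<^bold>= t) = (tm_ren r s \<^bold>= tm_ren r t)"
| "fm_ren r q (s \<^bold>< t) = (tm_ren r s \<^bold>< tm_ren r t)"
| "fm_ren r q (t \<^bold>\<in> X) = (tm_ren r t \<^bold>\<in> q X)"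
| "fm_ren r q (\<^bold>\<not> \<phi>) = (\<^bold>\<not> fm_ren r q \<phi>)"
| "fm_ren r q (\<phi> \<^bold>\<and> \<psi>) = (fm_ren r q \<phi> \<^bold>\<and> fm_ren r q \<psi>)"
| "fm_ren r q (\<phi> \<^bold>\<or> \<psi>) = (fm_ren r q \<phi> \<^bold>\<or> fm_ren r q \<psi>)"
| "fm_ren r q (\<phi> \<^bold>\<longrightarrow> \<psi>) = (fm_ren r q \<phi> \<^bold>\<longrightarrow> fm_ren r q \<psi>)"
| "fm_ren r q (\<phi> \<^bold>\<longleftrightarrow> \<psi>) = (fm_ren r q \<phi> \<^bold>\<longleftrightarrow> fm_ren r q \<psi>)"
| "fm_ren r q (\<^bold>\<forall>x\<^bold>. \<phi>) = (\<^bold>\<forall>r x\<^bold>. fm_ren r q \<phi>)"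
| "fm_ren r q (\<^bold>\<exists>x\<^bold>. \<phi>) = (\<^bold>\<exists>r x\<^bold>. fm_ren r q \<phi>)"
| "fm_ren r q (\<^bold>\<forall>\<^sub>SX\<^bold>. \<phi>) = (\<^bold>\<forall>\<^sub>Sq X\<^bold>. fm_ren r q \<phi>)"
| "fm_ren r q (\<^bold>\<exists>\<^sub>SX\<^bold>. \<phi>) = (\<^bold>\<exists>\<^sub>Sq X\<^bold>. fm_ren r q \<phi>)"

lemma tm_val_ren: "tm_val M e (tm_ren r t) = tm_val M (e \<circ> r) t"
  by (induction t) auto

lemma tm_vars_ren: "tm_vars (tm_ren r t) = r ` tm_vars t"
  by (induction t) auto

lemma fun_upd_comp_inj: "inj r \<Longrightarrow> (e(r x := a)) \<circ> r = (e \<circ> r)(x := a)"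
  by (auto simp: fun_eq_iff dest: injD)

text \<open>Injectivity on all names, bound ones included, excludes capture: an update at
  \<open>r x\<close> after renaming is the update at \<open>x\<close> before it, so the induction
  passes through every binder.\<close>

lemma sat_fm_ren:
  assumes "inj r" "inj q"
  shows "sat M e E (fm_ren r q \<phi>) \<longleftrightarrow> sat M (e \<circ> r) (E \<circ> q) \<phi>"
  by (induction \<phi> arbitrary: e E) (simp_all add: tm_val_ren fun_upd_comp_inj assms)

lemma bounded_fm_ren:
  assumes "bounded_fm \<phi>" "inj r"
  shows "bounded_fm (fm_ren r q \<phi>)"
  using assms(1)
  by induction
    (simp_all add: bounded_fm.intros tm_vars_ren inj_image_mem_iff[OF assms(2)])

lemma sat_set_cong:
  "(\<And>X. X \<in> set_fv \<phi> \<Longrightarrow> E X = F X) \<Longrightarrow> sat M e E \<phi> \<longleftrightarrow> sat M e F \<phi>"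
proof (induction \<phi> arbitrary: e E F)
  case (AllS Y \<phi>)
  have "sat M e (E(Y := A)) \<phi> \<longleftrightarrow> sat M e (F(Y := A)) \<phi>" for A
    by (rule AllS.IH) (use AllS.prems in auto)
  then show ?case by simp
next
  case (ExS Y \<phi>)
  have "sat M e (E(Y := A)) \<phi> \<longleftrightarrow> sat M e (F(Y := A)) \<phi>" for A
    by (rule ExS.IH) (use ExS.prems in auto)
  then show ?case by simp
next
  case (All x \<phi>)
  have "sat M (e(x := a)) E \<phi> \<longleftrightarrow> sat M (e(x := a)) F \<phi>" for a
    by (rule All.IH) (use All.prems in auto)
  then show ?case by simp
next
  case (Ex x \<phi>)
  have "sat M (e(x := a)) E \<phi> \<longleftrightarrow> sat M (e(x := a)) F \<phi>" for a
    by (rule Ex.IH) (use Ex.prems in auto)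
  then show ?case by simp
next
  case (And \<phi> \<psi>)
  from And.IH(1)[of E F e] And.IH(2)[of E F e] And.prems show ?case by auto
next
  case (Or \<phi> \<psi>)
  from Or.IH(1)[of E F e] Or.IH(2)[of E F e] Or.prems show ?case by auto
next
  case (Imp \<phi> \<psi>)
  from Imp.IH(1)[of E F e] Imp.IH(2)[of E F e] Imp.prems show ?case by auto
next
  case (Iff \<phi> \<psi>)
  from Iff.IH(1)[of E F e] Iff.IH(2)[of E F e] Iff.prems show ?case by auto
next
  case (Neg \<phi>)
  from Neg.IH[of E F e] Neg.prems show ?case by auto
qed auto

lemma set_fv_ren:
  assumes "inj q" shows "set_fv (fm_ren r q \<phi>) = q ` set_fv \<phi>"
  by (induction \<phi>) (auto dest: injD[OF assms])

text \<open>
  The number variables of index n are named by n letters v; all other names are used for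
  parameters.
\<close>

definition var :: "nat \<Rightarrow> vname" where
  "var n = replicate n CHR ''v''"

definition mix :: "(nat \<Rightarrow> 'a) \<Rightarrow> (vname \<Rightarrow> 'a) \<Rightarrow> vname \<Rightarrow> 'a" where
  "mix e w s = (if s = var (length s) then e (length s) else w s)"

text \<open>Indexed variables remain shared between formulas; every other name is prefixed by
  \<open>h\<close>, which separates the parameters of two formulas that are to be combined.\<close>

definition tag :: "char \<Rightarrow> vname \<Rightarrow> vname" where
  "tag h s = (if s = var (length s) then s else h # s)"

text \<open>Undoes the tagging: names beginning with the letter a are looked up in \<open>f\<close>,
  those beginning with b in \<open>g\<close>. It serves number and set parameters alike.\<close>

definition join :: "(vname \<Rightarrow> 'b) \<Rightarrow> (vname \<Rightarrow> 'b) \<Rightarrow> vname \<Rightarrow> 'b" where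
  "join f g s = (case s of [] \<Rightarrow> f [] | h # t \<Rightarrow> if h = CHR ''a'' then f t else g t)"

definition scons :: "'a \<Rightarrow> (nat \<Rightarrow> 'a) \<Rightarrow> nat \<Rightarrow> 'a"  (infixr "##" 65) where
  "a ## e = (\<lambda>n. case n of 0 \<Rightarrow> a | Suc m \<Rightarrow> e m)"

text \<open>Prepares a formula for quantification over its variable of index 0: that variable
  becomes \<open>''q''\<close>, the index of every other variable drops by one, and parameters get
  the prefix a, which keeps them away from \<open>''q''\<close>.\<close>

definition bind_name :: "vname \<Rightarrow> vname" where
  "bind_name s = (if s = var (length s)
     then (case s of [] \<Rightarrow> ''q'' | h # t \<Rightarrow> t) else CHR ''a'' # s)"

lemma length_var [simp]: "length (var n) = n"
  by (simp add: var_def)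

lemma var_0: "var 0 = []" and var_Suc: "var (Suc n) = CHR ''v'' # var n"
  by (simp_all add: var_def)

lemma var_eq_iff [simp]: "var m = var n \<longleftrightarrow> m = n"
  by (metis length_var)

lemma Cons_neq_var: "h \<noteq> CHR ''v'' \<Longrightarrow> h # s \<noteq> var n"
  by (cases n) (simp_all add: var_def)

lemma scons_0 [simp]: "(a ## e) 0 = a"
  and scons_Suc [simp]: "(a ## e) (Suc n) = e n"
  by (simp_all add: scons_def)

lemma mix_var [simp]: "mix e w (var n) = e n"
  by (simp add: mix_def)

lemma mix_upd: "(mix e w)(var n := a) = mix (e(n := a)) w"
  by (auto simp: mix_def fun_eq_iff)

lemma inj_tag: "h \<noteq> CHR ''v'' \<Longrightarrow> inj (tag h)"
  by (rule inj_on_inverseI[where g = "\<lambda>t. if t = var (length t) then t else tl t"])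
    (simp add: tag_def Cons_neq_var del: length_Cons)

lemma join_a: "join f g \<circ> Cons CHR ''a'' = f" and join_b: "join f g \<circ> Cons CHR ''b'' = g"
  by (auto simp: join_def fun_eq_iff)

lemma mix_join_a: "mix e (join f g) \<circ> tag CHR ''a'' = mix e f"
  and mix_join_b: "mix e (join f g) \<circ> tag CHR ''b'' = mix e g"
  by (auto simp: fun_eq_iff tag_def mix_def join_def Cons_neq_var simp del: length_Cons)

lemma join_range: "(\<And>X. f X \<in> A) \<Longrightarrow> (\<And>X. g X \<in> A) \<Longrightarrow> join f g X \<in> A"
  by (auto simp: join_def split: list.splits)

lemma bind_name_var_0 [simp]: "bind_name (var 0) = ''q''"
  and bind_name_var_Suc [simp]: "bind_name (var (Suc n)) = var n"
  and bind_name_param: "s \<noteq> var (length s) \<Longrightarrow> bind_name s = CHR ''a'' # s"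
  by (simp_all add: bind_name_def) (simp_all add: var_0 var_Suc)

lemma q_neq_var: "''q'' \<noteq> var n"
  by (rule Cons_neq_var) simp

lemma inj_bind_name: "inj bind_name"
proof (rule inj_on_inverseI)
  fix s
  let ?g = "\<lambda>t. if t = ''q'' then var 0
    else if t = var (length t) then var (Suc (length t)) else tl t"
  show "?g (bind_name s) = s"
  proof (cases "s = var (length s)")
    case True
    then obtain n where "s = var n" by blast
    then show ?thesis using q_neq_var by (cases n) (simp_all add: eq_commute[of _ "''q''"])
  next
    case False
    then show ?thesis by (simp add: bind_name_param Cons_neq_var del: length_Cons)
  qed
qed

lemma mix_bind: "(mix e (join w w))(''q'' := a) \<circ> bind_name = mix (a ## e) w"
proof
  fix s
  show "((mix e (join w w))(''q'' := a) \<circ> bind_name) s = mix (a ## e) w s"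
  proof (cases "s = var (length s)")
    case True
    then obtain n where n: "s = var n" by blast
    show ?thesis unfolding n using q_neq_var
      by (cases n) (auto simp: eq_commute[of _ "''q''"])
  next
    case False
    then show ?thesis
      by (auto simp: bind_name_def mix_def join_def Cons_neq_var simp del: length_Cons
          dest: Cons_neq_var[THEN notE, rotated])
  qed
qed

lemma inj_Cons: "inj (Cons h)"
  by (simp add: inj_def)

section \<open>Definability\<close>

locale henkin =
  fixes M :: "'a l2_structure"
  assumes nonempty: "Sets M \<noteq> {}"
begin

text \<open>
  Environments are read in the manner of de Bruijn: in the scope of a quantifier over a, the variable
  a is e 0 and the outer variables are \<open>\<lambda>n. e (Suc n)\<close>.
\<close>

definition TT :: "((nat \<Rightarrow> 'a) \<Rightarrow> 'a) \<Rightarrow> bool" where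
  "TT t \<longleftrightarrow> (\<exists>\<tau> w. \<forall>e. t e = tm_val M (mix e w) \<tau>)"

definition D0 :: "((nat \<Rightarrow> 'a) \<Rightarrow> bool) \<Rightarrow> bool" where
  "D0 P \<longleftrightarrow> (\<exists>\<phi> w E. bounded_fm \<phi> \<and> (\<forall>X. E X \<in> Sets M) \<and> (\<forall>e. P e \<longleftrightarrow> sat M (mix e w) E \<phi>))"

definition S1 :: "((nat \<Rightarrow> 'a) \<Rightarrow> bool) \<Rightarrow> bool" where
  "S1 P \<longleftrightarrow> (\<exists>Q. D0 Q \<and> (\<forall>e. P e \<longleftrightarrow> (\<exists>a. Q (a ## e))))"

lemma TT_var: "TT (\<lambda>e. e n)"
  unfolding TT_def by (rule exI[of _ "V (var n)"]) simp

lemma TT_const: "TT (\<lambda>e. c)"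
proof -
  have "c = tm_val M (mix e (\<lambda>_. c)) (V ''q'')" for e
    by (simp add: mix_def q_neq_var)
  then show ?thesis unfolding TT_def by blast
qed

lemma TT_two:
  assumes "TT s" "TT t"
  obtains \<sigma> \<tau> w where "\<And>e. s e = tm_val M (mix e w) \<sigma>" "\<And>e. t e = tm_val M (mix e w) \<tau>"
proof -
  from assms obtain \<sigma> \<tau> v w where
    "\<And>e. s e = tm_val M (mix e v) \<sigma>" "\<And>e. t e = tm_val M (mix e w) \<tau>"
    by (auto simp: TT_def)
  then show thesis
    by (intro that[of "join v w" "tm_ren (tag CHR ''a'') \<sigma>" "tm_ren (tag CHR ''b'') \<tau>"])
      (simp_all add: tm_val_ren mix_join_a mix_join_b)
qed

lemma TT_plus: assumes "TT s" "TT t" shows "TT (\<lambda>e. plusM M (s e) (t e))"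
proof -
  obtain \<sigma> \<tau> w where
    "\<And>e. s e = tm_val M (mix e w) \<sigma>" "\<And>e. t e = tm_val M (mix e w) \<tau>"
    by (rule TT_two[OF assms]) (rule that)
  then show ?thesis unfolding TT_def
    by (intro exI[of _ "\<sigma> \<^bold>+ \<tau>"] exI[of _ w]) simp
qed

lemma TT_times: assumes "TT s" "TT t" shows "TT (\<lambda>e. timesM M (s e) (t e))"
proof -
  obtain \<sigma> \<tau> w where
    "\<And>e. s e = tm_val M (mix e w) \<sigma>" "\<And>e. t e = tm_val M (mix e w) \<tau>"
    by (rule TT_two[OF assms]) (rule that)
  then show ?thesis unfolding TT_def
    by (intro exI[of _ "\<sigma> \<^bold>* \<tau>"] exI[of _ w]) simp
qed

lemma TT_ren: assumes "TT t" "inj r" shows "TT (\<lambda>e. t (\<lambda>n. e (r n)))"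
proof -
  from assms(1) obtain \<tau> w where t: "\<And>e. t e = tm_val M (mix e w) \<tau>" by (auto simp: TT_def)
  define q where "q s = (if s = var (length s) then var (r (length s)) else s)" for s
  have "mix e w \<circ> q = mix (\<lambda>n. e (r n)) w" for e
    by (auto simp: fun_eq_iff q_def mix_def)
  then show ?thesis unfolding TT_def
    by (intro exI[of _ "tm_ren q \<tau>"] exI[of _ w]) (simp add: t tm_val_ren)
qed

lemma D0_I: "bounded_fm \<phi> \<Longrightarrow> (\<And>X. E X \<in> Sets M) \<Longrightarrow> (\<And>e. P e \<longleftrightarrow> sat M (mix e w) E \<phi>) \<Longrightarrow> D0 P"
  unfolding D0_def by blast

lemma D0_E:
  assumes "D0 P"
  obtains \<phi> w E where "bounded_fm \<phi>" "\<And>X. E X \<in> Sets M" "\<And>e. P e \<longleftrightarrow> sat M (mix e w) E \<phi>"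
proof -
  from assms obtain \<phi> w E where
    "bounded_fm \<phi>" "\<forall>X. E X \<in> Sets M" "\<forall>e. P e \<longleftrightarrow> sat M (mix e w) E \<phi>"
    unfolding D0_def by (elim exE conjE)
  then show thesis by (intro that) simp_all
qed

lemma S1_E:
  assumes "S1 P"
  obtains Q where "D0 Q" "\<And>e. P e \<longleftrightarrow> (\<exists>a. Q (a ## e))"
proof -
  from assms obtain Q where "D0 Q" "\<forall>e. P e \<longleftrightarrow> (\<exists>a. Q (a ## e))"
    unfolding S1_def by (elim exE conjE)
  then show thesis by (intro that) simp_all
qed

lemma some_env: obtains E :: "vname \<Rightarrow> 'a set" where "\<And>X. E X \<in> Sets M"
proof -
  from nonempty obtain A where "A \<in> Sets M" by blast
  then show thesis by (intro that[of "\<lambda>_. A"])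
qed

text \<open>Tagging puts both formulas under one environment. All renamed set variables begin with a
  or b, so the empty name is free for use as the new set variable in comprehension.\<close>

lemma D0_two:
  assumes "D0 P" "D0 Q"
  obtains \<phi> \<psi> w E where "bounded_fm \<phi>" "bounded_fm \<psi>" "\<And>X. E X \<in> Sets M"
    "\<And>e. P e \<longleftrightarrow> sat M (mix e w) E \<phi>" "\<And>e. Q e \<longleftrightarrow> sat M (mix e w) E \<psi>"
    "[] \<notin> set_fv \<phi>" "[] \<notin> set_fv \<psi>"
proof -
  obtain \<phi> v E where \<phi>: "bounded_fm \<phi>" "\<And>X. E X \<in> Sets M"
    "\<And>e. P e \<longleftrightarrow> sat M (mix e v) E \<phi>" by (rule D0_E[OF assms(1)]) (rule that)
  obtain \<psi> w F where \<psi>: "bounded_fm \<psi>" "\<And>X. F X \<in> Sets M"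
    "\<And>e. Q e \<longleftrightarrow> sat M (mix e w) F \<psi>" by (rule D0_E[OF assms(2)]) (rule that)
  note b = \<phi>(1) \<psi>(1) \<phi>(2) \<psi>(2) and s = \<phi>(3) \<psi>(3)
  let ?\<phi> = "fm_ren (tag CHR ''a'') (Cons CHR ''a'') \<phi>" and ?\<psi> = "fm_ren (tag CHR ''b'') (Cons CHR ''b'') \<psi>"
  have inj: "inj (tag CHR ''a'')" "inj (tag CHR ''b'')" by (simp_all add: inj_tag)
  have "bounded_fm ?\<phi>" "bounded_fm ?\<psi>" by (intro bounded_fm_ren b inj)+
  moreover have "join E F X \<in> Sets M" for X by (intro join_range b)
  moreover have "P e \<longleftrightarrow> sat M (mix e (join v w)) (join E F) ?\<phi>"
    "Q e \<longleftrightarrow> sat M (mix e (join v w)) (join E F) ?\<psi>" for e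
    by (simp_all only: sat_fm_ren inj inj_Cons mix_join_a mix_join_b join_a join_b s)
  moreover have "[] \<notin> set_fv ?\<phi>" "[] \<notin> set_fv ?\<psi>"
    by (auto simp: set_fv_ren inj_Cons)
  ultimately show thesis by (rule that)
qed

lemma D0_eq: assumes "TT s" "TT t" shows "D0 (\<lambda>e. s e = t e)"
proof -
  obtain \<sigma> \<tau> w where
    *: "\<And>e. s e = tm_val M (mix e w) \<sigma>" "\<And>e. t e = tm_val M (mix e w) \<tau>"
    by (rule TT_two[OF assms]) (rule that)
  obtain E :: "vname \<Rightarrow> 'a set" where "\<And>X. E X \<in> Sets M" by (rule some_env) (rule that)
  then show ?thesis
    by (intro D0_I[of "\<sigma> \<^bold>= \<tau>" E _ w]) (simp_all add: * bounded_fm.intros)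
qed

lemma D0_less: assumes "TT s" "TT t" shows "D0 (\<lambda>e. lessM M (s e) (t e))"
proof -
  obtain \<sigma> \<tau> w where
    *: "\<And>e. s e = tm_val M (mix e w) \<sigma>" "\<And>e. t e = tm_val M (mix e w) \<tau>"
    by (rule TT_two[OF assms]) (rule that)
  obtain E :: "vname \<Rightarrow> 'a set" where "\<And>X. E X \<in> Sets M" by (rule some_env) (rule that)
  then show ?thesis
    by (intro D0_I[of "\<sigma> \<^bold>< \<tau>" E _ w]) (simp_all add: * bounded_fm.intros)
qed

lemma D0_mem: assumes "TT t" "A \<in> Sets M" shows "D0 (\<lambda>e. t e \<in> A)"
proof -
  from assms obtain \<tau> w where "\<And>e. t e = tm_val M (mix e w) \<tau>"
    by (auto simp: TT_def)
  then show ?thesis using assms(2)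
    by (intro D0_I[of "\<tau> \<^bold>\<in> []" "\<lambda>_. A" _ w]) (simp_all add: bounded_fm.intros)
qed

lemma D0_not: assumes "D0 P" shows "D0 (\<lambda>e. \<not> P e)"
proof -
  obtain \<phi> w E where "bounded_fm \<phi>" "\<And>X. E X \<in> Sets M"
    "\<And>e. P e \<longleftrightarrow> sat M (mix e w) E \<phi>" by (rule D0_E[OF assms]) (rule that)
  then show ?thesis
    by (intro D0_I[of "\<^bold>\<not> \<phi>" E _ w]) (simp_all add: bounded_fm.intros)
qed

lemma D0_conj: assumes "D0 P" "D0 Q" shows "D0 (\<lambda>e. P e \<and> Q e)"
proof (rule D0_two[OF assms])
  fix \<phi> \<psi> w E
  assume "bounded_fm \<phi>" "bounded_fm \<psi>" "\<And>X. E X \<in> Sets M"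
    "\<And>e. P e \<longleftrightarrow> sat M (mix e w) E \<phi>" "\<And>e. Q e \<longleftrightarrow> sat M (mix e w) E \<psi>"
  then show ?thesis
    by (intro D0_I[of "\<phi> \<^bold>\<and> \<psi>" E _ w]) (simp_all add: bounded_fm.intros)
qed

lemma D0_disj: assumes "D0 P" "D0 Q" shows "D0 (\<lambda>e. P e \<or> Q e)"
  using D0_not[OF D0_conj[OF D0_not D0_not, OF assms]] by simp

lemma D0_imp: assumes "D0 P" "D0 Q" shows "D0 (\<lambda>e. P e \<longrightarrow> Q e)"
  using D0_disj[OF D0_not assms(2), OF assms(1)] unfolding imp_conv_disj .

lemma D0_iff: assumes "D0 P" "D0 Q" shows "D0 (\<lambda>e. P e \<longleftrightarrow> Q e)"
  using D0_conj[OF D0_imp D0_imp, OF assms assms(2,1)] unfolding iff_conv_conj_imp .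

lemma D0_ren: assumes "D0 P" "inj r" shows "D0 (\<lambda>e. P (\<lambda>n. e (r n)))"
proof -
  obtain \<phi> w E where *: "bounded_fm \<phi>" "\<And>X. E X \<in> Sets M"
    "\<And>e. P e \<longleftrightarrow> sat M (mix e w) E \<phi>" by (rule D0_E[OF assms(1)]) (rule that)
  define q where "q s = (if s = var (length s) then var (r (length s)) else s)" for s
  have q: "inj q"
  proof (rule injI)
    fix s t assume "q s = q t"
    then have "s = var (length s) \<longleftrightarrow> t = var (length t)"
      by (auto simp: q_def split: if_splits)
    with \<open>q s = q t\<close> show "s = t"
      using injD[OF assms(2), of "length s" "length t"] by (auto simp: q_def split: if_splits)
  qed
  have "mix e w \<circ> q = mix (\<lambda>n. e (r n)) w" for e
    by (auto simp: fun_eq_iff q_def mix_def)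
  then show ?thesis
    by (intro D0_I[of "fm_ren q id \<phi>" E _ w]) (simp_all add: * bounded_fm_ren q sat_fm_ren)
qed

lemma D0_shift: "D0 P \<Longrightarrow> D0 (\<lambda>e. P (\<lambda>n. e (Suc n)))"
  by (rule D0_ren[where r = Suc]) simp_all

text \<open>The bounding term lies outside the scope of the quantifier, so it is tagged with b
  instead of being renamed by \<open>bind_name\<close>. Hence \<open>''q''\<close> does not occur in
  it, as \<open>bounded_fm\<close> requires, and its parameters stay apart from those of the
  matrix.\<close>

lemma D0_ball_scons:
  assumes "TT t" "D0 P"
  shows "D0 (\<lambda>e. \<forall>a. lessM M a (t e) \<longrightarrow> P (a ## e))"
proof -
  obtain \<phi> w E where *: "bounded_fm \<phi>" "\<And>X. E X \<in> Sets M"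
    "\<And>e. P e \<longleftrightarrow> sat M (mix e w) E \<phi>" by (rule D0_E[OF assms(2)]) (rule that)
  from assms(1) obtain \<tau> v where t: "\<And>e. t e = tm_val M (mix e v) \<tau>" by (auto simp: TT_def)
  let ?\<tau> = "tm_ren (tag CHR ''b'') \<tau>"
  let ?W = "join w v"
  have W: "(mix e ?W)(''q'' := a) \<circ> bind_name = mix (a ## e) w" for e a
  proof -
    have "(mix e ?W)(''q'' := a) \<circ> bind_name = (mix e (join w w))(''q'' := a) \<circ> bind_name"
    proof
      fix s show "((mix e ?W)(''q'' := a) \<circ> bind_name) s = ((mix e (join w w))(''q'' := a) \<circ> bind_name) s"
      proof (cases "s = var (length s)")
        case True
        then obtain n where n: "s = var n" by blast
        show ?thesis unfolding n using q_neq_var by (cases n) (auto simp: eq_commute[of _ "''q''"])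
      next
        case False
        then show ?thesis by (auto simp: bind_name_def mix_def join_def)
      qed
    qed
    then show ?thesis by (simp add: mix_bind)
  qed
  have fresh: "''q'' \<notin> tm_vars ?\<tau>"
    using q_neq_var by (auto simp: tm_vars_ren tag_def)
  have t': "tm_val M ((mix e ?W)(''q'' := a)) ?\<tau> = t e" for e a
    unfolding tm_val_upd[OF fresh] by (simp add: tm_val_ren mix_join_b t)
  have "bounded_fm (\<^bold>\<forall>''q''\<^bold>. V ''q'' \<^bold>< ?\<tau> \<^bold>\<longrightarrow> fm_ren bind_name id \<phi>)"
    by (rule bounded_fm.intros(9)[OF bounded_fm_ren[OF *(1) inj_bind_name] fresh])
  moreover have "(\<forall>a. lessM M a (t e) \<longrightarrow> P (a ## e)) \<longleftrightarrow>
    sat M (mix e ?W) E (\<^bold>\<forall>''q''\<^bold>. V ''q'' \<^bold>< ?\<tau> \<^bold>\<longrightarrow> fm_ren bind_name id \<phi>)" for e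
    unfolding sat.simps t' sat_fm_ren[OF inj_bind_name inj_on_id] W *(3) by simp
  ultimately show ?thesis by (intro D0_I[OF _ *(2)])
qed

text \<open>The premise has the shape \<open>P (\<lambda>n. e (Suc n)) (e 0)\<close> so that
  higher-order unification can open the quantifier. All quantifier rules below follow this pattern;
  definability then follows by repeated introduction.\<close>

lemma D0_ball:
  assumes "TT t" "D0 (\<lambda>e. P (\<lambda>n. e (Suc n)) (e 0))"
  shows "D0 (\<lambda>e. \<forall>a. lessM M a (t e) \<longrightarrow> P e a)"
  using D0_ball_scons[OF assms] by simp

lemma D0_bex:
  assumes "TT t" "D0 (\<lambda>e. P (\<lambda>n. e (Suc n)) (e 0))"
  shows "D0 (\<lambda>e. \<exists>a. lessM M a (t e) \<and> P e a)"
  using D0_not[OF D0_ball[OF assms(1), of "\<lambda>e a. \<not> P e a"]] D0_not[OF assms(2)] by simp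

lemmas D0_intros = D0_eq D0_less D0_mem D0_ball D0_bex D0_not D0_conj D0_disj D0_imp D0_iff
  TT_var TT_plus TT_times TT_const

lemma S1_ex_D0:
  assumes "D0 (\<lambda>e. P (\<lambda>n. e (Suc n)) (e 0))"
  shows "S1 (\<lambda>e. \<exists>a. P e a)"
  unfolding S1_def by (rule exI, rule conjI, rule assms) simp

lemma S1_D0: "D0 P \<Longrightarrow> S1 P"
  using S1_ex_D0[of "\<lambda>e a. P e"] D0_shift by simp

end

section \<open>Induction and comprehension for predicates on environments\<close>

locale rca0 = henkin +
  assumes rca0: "M \<Turnstile> RCA0"
begin

lemma rca0_sat: "\<phi> \<in> RCA0 \<Longrightarrow> (\<And>X. E X \<in> Sets M) \<Longrightarrow> sat M e E \<phi>"
  using rca0 by (auto simp: models_def)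

lemma scons_upd: "e(0 := a) = a ## (\<lambda>n. e (Suc n))"
  by (auto simp: fun_eq_iff scons_def split: nat.split)

lemma S1_induct:
  assumes S: "S1 (\<lambda>e. P (e 0))"
    and 0: "P (zeroM M)" and step: "\<And>a. P a \<Longrightarrow> P (plusM M a (oneM M))"
  shows "P a"
proof -
  obtain Q where Q: "D0 Q" "\<And>e. P (e 0) \<longleftrightarrow> (\<exists>a. Q (a ## e))" by (rule S1_E[OF S]) (rule that)
  obtain \<theta> w E where *: "bounded_fm \<theta>" "\<And>X. E X \<in> Sets M"
    "\<And>e. Q e \<longleftrightarrow> sat M (mix e w) E \<theta>" by (rule D0_E[OF Q(1)]) (rule that)
  \<comment> \<open>Index 0 is taken by the unbounded witness, so the induction variable
    \<open>e 0\<close> of the predicate becomes the variable of index 1.\<close>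
  let ?\<phi> = "\<^bold>\<exists>(var 0)\<^bold>. \<theta>" and ?n = "var 1"
  have sat: "sat M (mix e w) E ?\<phi> \<longleftrightarrow> P (e 1)" for e
    using Q(2)[of "\<lambda>n. e (Suc n)"] by (simp add: mix_upd scons_upd *(3)[symmetric])
  let ?I = "(subst ?n \<^bold>0 ?\<phi> \<^bold>\<and> (\<^bold>\<forall>?n\<^bold>. ?\<phi> \<^bold>\<longrightarrow> subst ?n (V ?n \<^bold>+ \<^bold>1) ?\<phi>)) \<^bold>\<longrightarrow> (\<^bold>\<forall>?n\<^bold>. ?\<phi>)"
  have "?I \<in> RCA0"
    using *(1) unfolding RCA0_def Sigma01_induction_def Sigma01_def by blast
  from rca0_sat[OF this *(2)] have "sat M (mix e w) E ?I" for e .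
  then show ?thesis
    using 0 step by (simp add: sat_subst mix_upd sat del: subst.simps sat.simps(10))
qed

lemma D0_induct:
  "D0 (\<lambda>e. P (e 0)) \<Longrightarrow> P (zeroM M) \<Longrightarrow> (\<And>a. P a \<Longrightarrow> P (plusM M a (oneM M))) \<Longrightarrow> P a"
  by (rule S1_induct[of P]) (simp_all add: S1_D0)

lemma S1_comprehension:
  assumes S: "S1 (\<lambda>e. P (e 0))" "S1 (\<lambda>e. \<not> P (e 0))"
  shows "Collect P \<in> Sets M"
proof -
  obtain Q where Q: "D0 Q" "\<And>e. P (e 0) \<longleftrightarrow> (\<exists>a. Q (a ## e))" by (rule S1_E[OF S(1)]) (rule that)
  obtain Q' where Q': "D0 Q'" "\<And>e. \<not> P (e 0) \<longleftrightarrow> (\<exists>a. Q' (a ## e))"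
    by (rule S1_E[OF S(2)]) (rule that)
  obtain \<theta> \<eta> w E where
    *: "bounded_fm \<theta>" "bounded_fm \<eta>" "\<And>X. E X \<in> Sets M"
    "\<And>e. Q e \<longleftrightarrow> sat M (mix e w) E \<theta>" "\<And>e. \<not> Q' e \<longleftrightarrow> sat M (mix e w) E \<eta>"
    "[] \<notin> set_fv \<theta>" by (rule D0_two[OF Q(1) D0_not[OF Q'(1)]]) (rule that)
  let ?\<phi> = "\<^bold>\<exists>(var 0)\<^bold>. \<theta>" and ?\<psi> = "\<^bold>\<forall>(var 0)\<^bold>. \<eta>" and ?n = "var 1"
  have sat: "sat M (mix e w) E ?\<phi> \<longleftrightarrow> P (e 1)" "sat M (mix e w) E ?\<psi> \<longleftrightarrow> P (e 1)" for e
    using Q(2)[of "\<lambda>n. e (Suc n)"] Q'(2)[of "\<lambda>n. e (Suc n)"]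
    by (auto simp: mix_upd scons_upd *(4,5)[symmetric])
  have fresh: "sat M e (E([] := A)) ?\<phi> \<longleftrightarrow> sat M e E ?\<phi>" for e A
    by (rule sat_set_cong) (use *(6) in auto)
  let ?I = "(\<^bold>\<forall>?n\<^bold>. ?\<phi> \<^bold>\<longleftrightarrow> ?\<psi>) \<^bold>\<longrightarrow> (\<^bold>\<exists>\<^sub>S[]\<^bold>. \<^bold>\<forall>?n\<^bold>. V ?n \<^bold>\<in> [] \<^bold>\<longleftrightarrow> ?\<phi>)"
  have "?\<phi> \<in> Sigma01" "?\<psi> \<in> Pi01" "[] \<notin> set_fv ?\<phi>"
    using *(1,2,6) by (auto simp: Sigma01_def Pi01_def)
  then have "?I \<in> Delta01_comprehension"
    unfolding Delta01_comprehension_def by blast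
  then have "?I \<in> RCA0" by (simp add: RCA0_def)
  from rca0_sat[OF this *(3)] have "sat M (mix e w) E ?I" for e .
  then have "sat M (mix undefined w) E ?I" .
  moreover define \<phi> \<psi> where "\<phi> = ?\<phi>" and "\<psi> = ?\<psi>"
  ultimately have "\<exists>A\<in>Sets M. \<forall>a. a \<in> A \<longleftrightarrow> P a"
    using sat fresh unfolding \<phi>_def[symmetric] \<psi>_def[symmetric] by (simp add: mix_upd)
  then show ?thesis by (metis Collect_mem_eq Collect_cong)
qed

section \<open>Arithmetic in a model\<close>

abbreviation zr ("\<zero>") where "\<zero> \<equiv> zeroM M"
abbreviation un ("\<one>") where "\<one> \<equiv> oneM M"
abbreviation pl (infixl "\<oplus>" 65) where "x \<oplus> y \<equiv> plusM M x y"
abbreviation tms (infixl "\<otimes>" 70) where "x \<otimes> y \<equiv> timesM M x y"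
abbreviation ls (infix "\<prec>" 50) where "x \<prec> y \<equiv> lessM M x y"

definition leM (infix "\<preceq>" 50) where "x \<preceq> y \<longleftrightarrow> x \<prec> y \<or> x = y"

text \<open>The basic axioms contain no set variables, so the set environment may be arbitrary, even
  with values outside \<open>Sets M\<close>.\<close>

lemma basic_sat: "\<phi> \<in> basic_axioms \<Longrightarrow> sat M e E \<phi>"
proof -
  assume *: "\<phi> \<in> basic_axioms"
  obtain F :: "vname \<Rightarrow> 'a set" where F: "\<And>X. F X \<in> Sets M" by (rule some_env) (rule that)
  have "sat M e F \<phi>" by (rule rca0_sat) (use * F in \<open>auto simp: RCA0_def\<close>)
  moreover have "sat M e E \<phi> = sat M e F \<phi>"
    by (rule sat_set_cong) (use * in \<open>auto simp: basic_axioms_def Let_def\<close>)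
  ultimately show ?thesis by simp
qed

lemma suc_neq_0: "b \<oplus> \<one> \<noteq> \<zero>"
  and suc_inj: "a \<oplus> \<one> = b \<oplus> \<one> \<Longrightarrow> a = b"
  and add_zero: "a \<oplus> \<zero> = a"
  and add_suc: "a \<oplus> (b \<oplus> \<one>) = (a \<oplus> b) \<oplus> \<one>"
  and mult_zero: "a \<otimes> \<zero> = \<zero>"
  and mult_suc: "a \<otimes> (b \<oplus> \<one>) = a \<otimes> b \<oplus> a"
  and not_less_zero: "\<not> a \<prec> \<zero>"
  and less_suc: "a \<prec> b \<oplus> \<one> \<longleftrightarrow> a \<prec> b \<or> a = b"
proof -
  have "\<forall>\<phi>\<in>basic_axioms. sat M ((\<lambda>_. a)(''m'' := a, ''n'' := b)) (\<lambda>_. {}) \<phi>"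
    using basic_sat by blast
  then show "b \<oplus> \<one> \<noteq> \<zero>" "a \<oplus> \<one> = b \<oplus> \<one> \<Longrightarrow> a = b" "a \<oplus> \<zero> = a"
    "a \<oplus> (b \<oplus> \<one>) = (a \<oplus> b) \<oplus> \<one>" "a \<otimes> \<zero> = \<zero>" "a \<otimes> (b \<oplus> \<one>) = a \<otimes> b \<oplus> a"
    "\<not> a \<prec> \<zero>" "a \<prec> b \<oplus> \<one> \<longleftrightarrow> a \<prec> b \<or> a = b"
    by (auto simp: basic_axioms_def Let_def)
qed

lemma zero_add: "\<zero> \<oplus> a = a"
  by (rule D0_induct[where a = a]) (intro D0_intros, simp_all add: add_zero add_suc)

lemma suc_add: "(a \<oplus> \<one>) \<oplus> b = (a \<oplus> b) \<oplus> \<one>"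
  by (rule D0_induct[where a = b]) (intro D0_intros, simp_all add: add_zero add_suc)

lemma add_comm: "a \<oplus> b = b \<oplus> a"
  by (rule D0_induct[where a = b]) (intro D0_intros, simp_all add: add_zero add_suc zero_add suc_add)

lemma add_assoc': "(a \<oplus> b) \<oplus> c = a \<oplus> (b \<oplus> c)"
  by (rule D0_induct[where a = c]) (intro D0_intros, simp_all add: add_zero add_suc)

lemma add_left_comm': "a \<oplus> (b \<oplus> c) = b \<oplus> (a \<oplus> c)"
  by (metis add_assoc' add_comm)

lemmas add_acs = add_assoc' add_comm add_left_comm'

lemma zero_mult: "\<zero> \<otimes> a = \<zero>"
  by (rule D0_induct[where a = a]) (intro D0_intros, simp_all add: add_zero mult_zero mult_suc)

lemma suc_mult: "(a \<oplus> \<one>) \<otimes> b = a \<otimes> b \<oplus> b"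
proof (rule D0_induct[where a = b])
  fix c assume "(a \<oplus> \<one>) \<otimes> c = a \<otimes> c \<oplus> c"
  then show "(a \<oplus> \<one>) \<otimes> (c \<oplus> \<one>) = a \<otimes> (c \<oplus> \<one>) \<oplus> (c \<oplus> \<one>)"
    by (simp add: mult_suc add_acs)
qed (intro D0_intros, simp add: mult_zero add_zero)

lemma mult_comm: "a \<otimes> b = b \<otimes> a"
  by (rule D0_induct[where a = b])
    (intro D0_intros, simp_all add: mult_zero zero_mult mult_suc suc_mult)

lemma mult_one': "a \<otimes> \<one> = a"
  by (metis mult_suc mult_zero zero_add)

lemma distrib_left': "a \<otimes> (b \<oplus> c) = a \<otimes> b \<oplus> a \<otimes> c"
proof (rule D0_induct[where a = c])
  fix c assume "a \<otimes> (b \<oplus> c) = a \<otimes> b \<oplus> a \<otimes> c"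
  then show "a \<otimes> (b \<oplus> (c \<oplus> \<one>)) = a \<otimes> b \<oplus> a \<otimes> (c \<oplus> \<one>)"
    by (simp add: mult_suc add_assoc'[symmetric])
qed (intro D0_intros, simp add: mult_zero add_zero)

lemma mult_assoc': "(a \<otimes> b) \<otimes> c = a \<otimes> (b \<otimes> c)"
  by (rule D0_induct[where a = c])
    (intro D0_intros, simp_all add: mult_zero mult_suc distrib_left' mult_one')

lemma add_cancel: "a \<oplus> c = b \<oplus> c \<longleftrightarrow> a = b"
  by (rule D0_induct[where a = c])
    (intro D0_intros, auto simp: add_zero add_suc dest: suc_inj)

lemma add_cancel_left: "c \<oplus> a = c \<oplus> b \<longleftrightarrow> a = b"
  by (simp add: add_comm[of c] add_cancel)

lemma zero_or_suc: "a = \<zero> \<or> (\<exists>b. a = b \<oplus> \<one>)"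
proof (rule S1_induct[where a = a])
  show "S1 (\<lambda>e. e 0 = \<zero> \<or> (\<exists>b. e 0 = b \<oplus> \<one>))"
  proof -
    have "S1 (\<lambda>e. \<exists>b. e 0 = \<zero> \<or> e 0 = b \<oplus> \<one>)"
      by (intro S1_ex_D0 D0_intros)
    then show ?thesis by simp
  qed
qed auto

section \<open>The order in terms of addition\<close>

lemma less_iff_add: "a \<prec> b \<longleftrightarrow> (\<exists>c. b = a \<oplus> (c \<oplus> \<one>))"
proof
  have "a \<prec> b \<longrightarrow> (\<exists>c. b = a \<oplus> (c \<oplus> \<one>))"
  proof (rule S1_induct[where a = b])
    have "S1 (\<lambda>e. \<exists>c. a \<prec> e 0 \<longrightarrow> e 0 = a \<oplus> (c \<oplus> \<one>))"
      by (intro S1_ex_D0 D0_intros)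
    then show "S1 (\<lambda>e. a \<prec> e 0 \<longrightarrow> (\<exists>c. e 0 = a \<oplus> (c \<oplus> \<one>)))" by simp
  next
    fix b assume IH: "a \<prec> b \<longrightarrow> (\<exists>c. b = a \<oplus> (c \<oplus> \<one>))"
    show "a \<prec> b \<oplus> \<one> \<longrightarrow> (\<exists>c. b \<oplus> \<one> = a \<oplus> (c \<oplus> \<one>))"
    proof
      assume "a \<prec> b \<oplus> \<one>"
      then consider "a \<prec> b" | "a = b" by (auto simp: less_suc)
      then show "\<exists>c. b \<oplus> \<one> = a \<oplus> (c \<oplus> \<one>)"
      proof cases
        case 1 then show ?thesis using IH by (metis add_suc)
      next
        case 2 then show ?thesis by (metis zero_add)
      qed
    qed
  qed (simp add: not_less_zero)
  then show "a \<prec> b \<Longrightarrow> \<exists>c. b = a \<oplus> (c \<oplus> \<one>)" by simp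
next
  have "a \<prec> a \<oplus> (c \<oplus> \<one>)" for c
    by (rule D0_induct[where a = c]) (intro D0_intros, auto simp: add_zero add_suc less_suc)
  then show "\<exists>c. b = a \<oplus> (c \<oplus> \<one>) \<Longrightarrow> a \<prec> b" by blast
qed

lemma le_iff_add': "a \<preceq> b \<longleftrightarrow> (\<exists>c. b = a \<oplus> c)"
  unfolding leM_def less_iff_add
proof
  assume "\<exists>c. b = a \<oplus> c"
  then obtain c where "b = a \<oplus> c" ..
  then show "(\<exists>c. b = a \<oplus> (c \<oplus> \<one>)) \<or> a = b"
    using zero_or_suc[of c] by (auto simp: add_zero)
next
  assume "(\<exists>c. b = a \<oplus> (c \<oplus> \<one>)) \<or> a = b"
  then show "\<exists>c. b = a \<oplus> c"
    using add_zero[of b] by metis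
qed

lemma le_total: "a \<preceq> b \<or> b \<preceq> a"
proof -
  have "a \<prec> b \<or> a = b \<or> b \<prec> a"
  proof (rule D0_induct[where a = b])
    show "a \<prec> \<zero> \<or> a = \<zero> \<or> \<zero> \<prec> a"
      using zero_or_suc[of a] by (auto simp: less_iff_add zero_add)
    fix b assume "a \<prec> b \<or> a = b \<or> b \<prec> a"
    then consider "a \<prec> b \<oplus> \<one>" | "b \<prec> a" by (auto simp: less_suc)
    then show "a \<prec> b \<oplus> \<one> \<or> a = b \<oplus> \<one> \<or> b \<oplus> \<one> \<prec> a"
    proof cases
      case 2
      then obtain c where c: "a = b \<oplus> (c \<oplus> \<one>)" by (auto simp: less_iff_add)
      show ?thesis
        using zero_or_suc[of c]
      proof
        assume "c = \<zero>"
        then show ?thesis by (simp add: c zero_add)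
      next
        assume "\<exists>d. c = d \<oplus> \<one>"
        then obtain d where "c = d \<oplus> \<one>" ..
        then have "a = (b \<oplus> \<one>) \<oplus> (d \<oplus> \<one>)" by (simp add: c add_acs)
        then show ?thesis unfolding less_iff_add[of "b \<oplus> \<one>"] by blast
      qed
    qed simp
  qed (intro D0_intros)
  then show ?thesis by (auto simp: leM_def)
qed

text \<open>Truncated subtraction, which is what \<open>linordered_semidom\<close> expects of its
  difference operation.\<close>

definition minusM (infixl "\<ominus>" 65) where
  "a \<ominus> b = (if b \<preceq> a then THE c. a = b \<oplus> c else \<zero>)"

lemma add_minus: "(a \<oplus> b) \<ominus> a = b"
  unfolding minusM_def le_iff_add' by (auto simp: add_cancel_left)

lemma minus_eq_0: "\<not> b \<preceq> a \<Longrightarrow> a \<ominus> b = \<zero>"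
  by (simp add: minusM_def)

lemma less_le_not_le': "a \<prec> b \<longleftrightarrow> a \<preceq> b \<and> \<not> b \<preceq> a"
proof
  assume "a \<prec> b"
  then obtain c where c: "b = a \<oplus> (c \<oplus> \<one>)" by (auto simp: less_iff_add)
  have "\<not> b \<preceq> a"
  proof
    assume "b \<preceq> a"
    then obtain d where "a = b \<oplus> d" by (auto simp: le_iff_add')
    then have "a \<oplus> \<zero> = a \<oplus> ((c \<oplus> d) \<oplus> \<one>)" by (simp add: c add_acs add_zero)
    then show False using suc_neq_0 by (metis add_cancel_left)
  qed
  then show "a \<preceq> b \<and> \<not> b \<preceq> a" using \<open>a \<prec> b\<close> by (simp add: leM_def)
next
  assume "a \<preceq> b \<and> \<not> b \<preceq> a"
  then show "a \<prec> b" by (auto simp: leM_def)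
qed

lemma le_antisym': "a \<preceq> b \<Longrightarrow> b \<preceq> a \<Longrightarrow> a = b"
  by (metis leM_def less_le_not_le')

text \<open>Gives the model the library of ordered semidomains. Besides order and arithmetic this
  provides the calculus of divisibility on which the coding of finite sets rests.\<close>

sublocale N: linordered_semidom where minus = minusM and plus = "plusM M" and zero = "zeroM M"
  and times = "timesM M" and less_eq = leM and less = "lessM M" and one = "oneM M"
proof
  fix a b c
  show "a \<oplus> b \<oplus> c = a \<oplus> (b \<oplus> c)" "a \<oplus> b = b \<oplus> a" "\<zero> \<oplus> a = a"
    by (fact add_assoc' add_comm zero_add)+
  show "a \<otimes> b \<otimes> c = a \<otimes> (b \<otimes> c)" "a \<otimes> b = b \<otimes> a" by (fact mult_assoc' mult_comm)+
  show "\<one> \<otimes> a = a" "\<zero> \<otimes> a = \<zero>" "a \<otimes> \<zero> = \<zero>"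
    by (simp_all add: mult_comm[of \<one>] mult_one' zero_mult mult_zero)
  show "(a \<oplus> b) \<otimes> c = a \<otimes> c \<oplus> b \<otimes> c"
    by (metis distrib_left' mult_comm)
  show "\<zero> \<noteq> \<one>" using suc_neq_0[of \<zero>] by (simp add: zero_add)
  show "a \<oplus> b \<ominus> a = b" by (rule add_minus)
  show "a \<prec> b \<longleftrightarrow> a \<preceq> b \<and> \<not> b \<preceq> a" by (rule less_le_not_le')
  show "a \<preceq> a" by (simp add: leM_def)
  show "a \<preceq> b \<Longrightarrow> b \<preceq> c \<Longrightarrow> a \<preceq> c"
    by (auto simp: le_iff_add' add_assoc' add_cancel_left)
  show "a \<preceq> b \<Longrightarrow> b \<preceq> a \<Longrightarrow> a = b" by (rule le_antisym')
  show "a \<preceq> b \<or> b \<preceq> a" by (rule le_total)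
  show "a \<preceq> b \<Longrightarrow> c \<oplus> a \<preceq> c \<oplus> b"
    by (auto simp: le_iff_add' add_assoc' add_cancel_left)
  show "\<zero> \<prec> \<one>" using less_suc[of \<zero> \<zero>] by (simp add: zero_add)
  show "b \<preceq> a \<Longrightarrow> a \<ominus> b \<oplus> b = a" 
    using add_comm[of "a \<ominus> b" b] by (auto simp: le_iff_add' add_minus)
  show less: "a \<prec> b \<Longrightarrow> \<zero> \<prec> c \<Longrightarrow> c \<otimes> a \<prec> c \<otimes> b" for a b c
  proof -
    assume "a \<prec> b" "\<zero> \<prec> c"
    then obtain d f where "b = a \<oplus> (d \<oplus> \<one>)" "c = f \<oplus> \<one>"
      by (auto simp: less_iff_add zero_add)
    then have "c \<otimes> b = c \<otimes> a \<oplus> ((f \<oplus> \<one>) \<otimes> d \<oplus> f \<oplus> \<one>)"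
      by (simp add: distrib_left' mult_one' add_assoc')
    then show "c \<otimes> a \<prec> c \<otimes> b" unfolding less_iff_add by blast
  qed
  show "a \<noteq> \<zero> \<Longrightarrow> b \<noteq> \<zero> \<Longrightarrow> a \<otimes> b \<noteq> \<zero>"
    using zero_or_suc[of a] zero_or_suc[of b] by (auto simp: mult_suc add_suc suc_neq_0)
  show "a \<otimes> (b \<ominus> c) = a \<otimes> b \<ominus> a \<otimes> c"
  proof (cases "c \<preceq> b")
    case True
    then obtain d where "b = c \<oplus> d" by (auto simp: le_iff_add')
    then show ?thesis by (simp add: distrib_left' add_minus)
  next
    case False
    show ?thesis
    proof (cases "a = \<zero>")
      case True
      then show ?thesis using add_minus[of \<zero> \<zero>] by (simp add: zero_mult zero_add)
    next
      case a: False
      then have "\<zero> \<prec> a" using zero_or_suc[of a] by (auto simp: less_iff_add zero_add)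
      then have "\<not> a \<otimes> c \<preceq> a \<otimes> b"
        using False less[of b c a] le_total[of b c] by (simp add: less_le_not_le')
      then show ?thesis using False by (simp add: minus_eq_0 mult_zero)
    qed
  qed
  show "a \<ominus> b \<ominus> c = a \<ominus> (b \<oplus> c)"
  proof (cases "b \<oplus> c \<preceq> a")
    case True
    then obtain d where "a = b \<oplus> c \<oplus> d" by (auto simp: le_iff_add')
    then show ?thesis by (simp add: add_minus add_assoc') (simp add: add_minus flip: add_assoc')
  next
    case False
    show ?thesis
    proof (cases "b \<preceq> a")
      case True
      then obtain d where d: "a = b \<oplus> d" by (auto simp: le_iff_add')
      then have "\<not> c \<preceq> d" using False by (auto simp: le_iff_add' add_assoc' add_cancel_left)
      then show ?thesis using False by (simp add: d add_minus minus_eq_0)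
    next
      case b: False
      have "\<zero> \<ominus> c = \<zero>"
      proof (cases "c \<preceq> \<zero>")
        case True
        then have "c = \<zero>" using le_antisym'[of c \<zero>] by (simp add: le_iff_add' zero_add)
        then show ?thesis using add_minus[of \<zero> \<zero>] by (simp add: zero_add)
      qed (simp add: minus_eq_0)
      then show ?thesis using False b by (simp add: minus_eq_0)
    qed
  qed
qed (rule distrib_left')

section \<open>Sigma-1 and Delta-1 definability\<close>

text \<open>Induction and comprehension take predicates of \<open>e 0\<close> alone. Freezing the
  entries from k on turns them into number parameters, the value \<open>c n\<close> being stored
  under the letter b followed by \<open>var n\<close>.\<close>

lemma D0_fix: assumes "D0 P" shows "D0 (\<lambda>e. P (\<lambda>n. if n < k then e n else c n))"
proof -
  obtain \<phi> w E where *: "bounded_fm \<phi>" "\<And>X. E X \<in> Sets M"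
    "\<And>e. P e \<longleftrightarrow> sat M (mix e w) E \<phi>" by (rule D0_E[OF assms]) (rule that)
  define q where "q s = (if s = var (length s) then (if length s < k then s else CHR ''b'' # s)
    else CHR ''a'' # s)" for s
  let ?w = "join w (\<lambda>s. c (length s))"
  have q: "inj q"
  proof (rule inj_on_inverseI)
    fix s show "(\<lambda>t. if t = var (length t) then t else tl t) (q s) = s"
      by (auto simp: q_def Cons_neq_var simp del: length_Cons)
  qed
  have "mix e ?w \<circ> q = mix (\<lambda>n. if n < k then e n else c n) w" for e
    by (auto simp: fun_eq_iff q_def mix_def join_def Cons_neq_var simp del: length_Cons)
  then show ?thesis
    by (intro D0_I[of "fm_ren q id \<phi>" E _ ?w]) (simp_all add: * bounded_fm_ren q sat_fm_ren)
qed

text \<open>A common bound for witnesses is quantified outside them and occupies index 1 inside; the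
  renaming skips it. \<open>D0_env2\<close> does the same for a bound at index 2.\<close>

lemma D0_env1:
  assumes "D0 P" shows "D0 (\<lambda>e. P (e 0 ## (\<lambda>n. e (Suc (Suc n)))))"
proof -
  have "inj (case_nat 0 (\<lambda>n. Suc (Suc n)))" by (auto simp: inj_def split: nat.splits)
  from D0_ren[OF assms this] show ?thesis
    by (rule back_subst[of D0]) (auto simp: fun_eq_iff scons_def split: nat.split intro!: arg_cong[of _ _ P])
qed

lemma D0_env2:
  assumes "D0 P" shows "D0 (\<lambda>e. P (e 0 ## e (Suc 0) ## (\<lambda>n. e (Suc (Suc (Suc n))))))"
proof -
  have "inj (case_nat 0 (case_nat 1 (\<lambda>n. Suc (Suc (Suc n)))))"
    by (auto simp: inj_def split: nat.splits)
  from D0_ren[OF assms this] show ?thesis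
    by (rule back_subst[of D0]) (auto simp: fun_eq_iff scons_def split: nat.split intro!: arg_cong[of _ _ P])
qed

lemma D0_env2_fix:
  assumes "D0 P" shows "D0 (\<lambda>e. P (e 0 ## e (Suc 0) ## d))"
  using D0_fix[OF assms, of 2 "\<lambda>n. d (n - 2)"]
  by (rule back_subst[of D0])
    (auto simp: fun_eq_iff scons_def numeral_2_eq_2 split: nat.split intro!: arg_cong[of _ _ P])

lemma less_add_one: "a \<preceq> c \<longleftrightarrow> a \<prec> c \<oplus> \<one>"
  by (auto simp: leM_def less_suc)

text \<open>Merges unbounded existential quantifiers: two witnesses exist iff some c bounds a pair
  of them, and the inner quantifiers are then bounded. The form c + 1 suits the strict bounds of
  bounded formulas.\<close>

lemma two_bound: obtains c where "a \<prec> c \<oplus> \<one>" "b \<prec> c \<oplus> \<one>"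
  using le_total[of a b] by (auto simp: less_add_one[symmetric])

lemma S1_conj: assumes "S1 P" "S1 Q" shows "S1 (\<lambda>e. P e \<and> Q e)"
proof -
  obtain P' where P: "D0 P'" "\<And>e. P e \<longleftrightarrow> (\<exists>a. P' (a ## e))" by (rule S1_E[OF assms(1)]) (rule that)
  obtain Q' where Q: "D0 Q'" "\<And>e. Q e \<longleftrightarrow> (\<exists>a. Q' (a ## e))" by (rule S1_E[OF assms(2)]) (rule that)
  have "S1 (\<lambda>e. \<exists>c. (\<exists>a. a \<prec> c \<oplus> \<one> \<and> P' (a ## e)) \<and> (\<exists>b. b \<prec> c \<oplus> \<one> \<and> Q' (b ## e)))"
    by (intro S1_ex_D0 D0_intros D0_env1 P Q)
  moreover have "P e \<and> Q e \<longleftrightarrow>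
      (\<exists>c. (\<exists>a. a \<prec> c \<oplus> \<one> \<and> P' (a ## e)) \<and> (\<exists>b. b \<prec> c \<oplus> \<one> \<and> Q' (b ## e)))" for e
    unfolding P(2) Q(2) by (meson two_bound)
  ultimately show ?thesis by simp
qed

lemma S1_disj: assumes "S1 P" "S1 Q" shows "S1 (\<lambda>e. P e \<or> Q e)"
proof -
  obtain P' where P: "D0 P'" "\<And>e. P e \<longleftrightarrow> (\<exists>a. P' (a ## e))" by (rule S1_E[OF assms(1)]) (rule that)
  obtain Q' where Q: "D0 Q'" "\<And>e. Q e \<longleftrightarrow> (\<exists>a. Q' (a ## e))" by (rule S1_E[OF assms(2)]) (rule that)
  have "S1 (\<lambda>e. \<exists>c. P' (c ## e) \<or> Q' (c ## e))"
    unfolding S1_def by (rule exI[of _ "\<lambda>e. P' e \<or> Q' e"]) (simp add: D0_disj P(1) Q(1))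
  then show ?thesis by (simp add: P(2) Q(2) ex_disj_distrib)
qed

lemma S1_ex:
  assumes "S1 (\<lambda>e. P (\<lambda>n. e (Suc n)) (e 0))"
  shows "S1 (\<lambda>e. \<exists>a. P e a)"
proof -
  obtain Q where Q: "D0 Q" "\<And>e. P (\<lambda>n. e (Suc n)) (e 0) \<longleftrightarrow> (\<exists>a. Q (a ## e))"
    by (rule S1_E[OF assms]) (rule that)
  have "S1 (\<lambda>e. \<exists>c. \<exists>a. a \<prec> c \<oplus> \<one> \<and> (\<exists>b. b \<prec> c \<oplus> \<one> \<and> Q (b ## a ## e)))"
    by (intro S1_ex_D0 D0_intros D0_env2 Q)
  moreover have "(\<exists>a. P e a) \<longleftrightarrow>
      (\<exists>c. \<exists>a. a \<prec> c \<oplus> \<one> \<and> (\<exists>b. b \<prec> c \<oplus> \<one> \<and> Q (b ## a ## e)))" for e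
    using Q(2)[of "_ ## e"] by simp (meson two_bound)
  ultimately show ?thesis by simp
qed

text \<open>This is Sigma-1 collection. Induction on k, up to \<open>t e\<close>, produces one c
  above witnesses for all a < k; the unbounded quantifier over c then moves in front of the bounded
  one.\<close>

lemma S1_ball_TT:
  assumes "TT t" "S1 (\<lambda>e. P (\<lambda>n. e (Suc n)) (e 0))"
  shows "S1 (\<lambda>e. \<forall>a. a \<prec> t e \<longrightarrow> P e a)"
proof -
  obtain Q where Q: "D0 Q" "\<And>e. P (\<lambda>n. e (Suc n)) (e 0) \<longleftrightarrow> (\<exists>a. Q (a ## e))"
    by (rule S1_E[OF assms(2)]) (rule that)
  have P: "P e a \<longleftrightarrow> (\<exists>b. Q (b ## a ## e))" for e a
    using Q(2)[of "a ## e"] by simp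
  have "TT (\<lambda>e. t (\<lambda>n. e (Suc n)))"
    using TT_ren[OF assms(1), of Suc] by simp
  then have "S1 (\<lambda>e. \<exists>c. \<forall>a. a \<prec> t e \<longrightarrow> (\<exists>b. b \<prec> c \<and> Q (b ## a ## e)))"
    by (intro S1_ex_D0 D0_ball D0_bex TT_var D0_env2 Q)
  moreover have "(\<forall>a. a \<prec> t e \<longrightarrow> P e a) \<longleftrightarrow>
      (\<exists>c. \<forall>a. a \<prec> t e \<longrightarrow> (\<exists>b. b \<prec> c \<and> Q (b ## a ## e)))" (is "?L \<longleftrightarrow> ?R") for e
  proof
    assume ?L
    have "\<exists>c. k \<preceq> t e \<longrightarrow> (\<forall>a. a \<prec> k \<longrightarrow> (\<exists>b. b \<prec> c \<and> Q (b ## a ## e)))" for k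
    proof (rule S1_induct[where a = k])
      show "S1 (\<lambda>e'. \<exists>c. e' 0 \<preceq> t e \<longrightarrow> (\<forall>a. a \<prec> e' 0 \<longrightarrow> (\<exists>b. b \<prec> c \<and> Q (b ## a ## e))))"
        unfolding less_add_one by (intro S1_ex_D0 D0_intros D0_env2_fix Q)
      show "\<exists>c. \<zero> \<preceq> t e \<longrightarrow> (\<forall>a. a \<prec> \<zero> \<longrightarrow> (\<exists>b. b \<prec> c \<and> Q (b ## a ## e)))"
        by (simp add: not_less_zero)
      fix k assume "\<exists>c. k \<preceq> t e \<longrightarrow> (\<forall>a. a \<prec> k \<longrightarrow> (\<exists>b. b \<prec> c \<and> Q (b ## a ## e)))"
      then obtain c where c: "k \<preceq> t e \<Longrightarrow> a \<prec> k \<Longrightarrow> \<exists>b. b \<prec> c \<and> Q (b ## a ## e)" for a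
        by blast
      show "\<exists>c. k \<oplus> \<one> \<preceq> t e \<longrightarrow> (\<forall>a. a \<prec> k \<oplus> \<one> \<longrightarrow> (\<exists>b. b \<prec> c \<and> Q (b ## a ## e)))"
      proof (cases "k \<oplus> \<one> \<preceq> t e")
        case True
        then have k: "k \<prec> t e" by (metis less_add_one less_suc leM_def N.less_le_trans)
        then obtain b where b: "Q (b ## k ## e)" using \<open>?L\<close> by (auto simp: P)
        obtain d where d: "b \<prec> d \<oplus> \<one>" "c \<prec> d \<oplus> \<one>" by (rule two_bound)
        have "\<forall>a. a \<prec> k \<oplus> \<one> \<longrightarrow> (\<exists>b. b \<prec> d \<oplus> \<one> \<and> Q (b ## a ## e))"
          using c k b d by (metis less_suc leM_def N.less_trans)
        then show ?thesis by blast
      qed blast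
    qed
    then show ?R by (metis N.order_refl)
  qed (auto simp: P)
  ultimately show ?thesis by simp
qed

lemma S1_ren: assumes "S1 P" "inj r" shows "S1 (\<lambda>e. P (\<lambda>n. e (r n)))"
proof -
  obtain Q where Q: "D0 Q" "\<And>e. P e \<longleftrightarrow> (\<exists>a. Q (a ## e))" by (rule S1_E[OF assms(1)]) (rule that)
  have "inj (case_nat 0 (\<lambda>n. Suc (r n)))"
    by (rule injI) (auto dest: injD[OF assms(2)] split: nat.splits)
  from D0_ren[OF Q(1) this]
  have "D0 (\<lambda>e. Q (e 0 ## (\<lambda>n. e (Suc (r n)))))"
    by (rule back_subst[of D0]) (auto simp: fun_eq_iff scons_def split: nat.split intro!: arg_cong[of _ _ Q])
  then have "S1 (\<lambda>e. \<exists>a. Q (a ## (\<lambda>n. e (r n))))" by (rule S1_ex_D0)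
  then show ?thesis by (simp add: Q(2))
qed

section \<open>Delta-1 predicates and functions with Sigma-1 graph\<close>

definition R1 :: "((nat \<Rightarrow> 'a) \<Rightarrow> bool) \<Rightarrow> bool" where
  "R1 P \<longleftrightarrow> S1 P \<and> S1 (\<lambda>e. \<not> P e)"

definition F1 :: "((nat \<Rightarrow> 'a) \<Rightarrow> 'a) \<Rightarrow> bool" where
  "F1 f \<longleftrightarrow> S1 (\<lambda>e. e 0 = f (\<lambda>n. e (Suc n)))"

lemma S1_R1: "R1 P \<Longrightarrow> S1 P"
  by (simp add: R1_def)

lemma R1_D0: "D0 P \<Longrightarrow> R1 P"
  by (simp add: R1_def S1_D0 D0_not)

lemma R1_not: "R1 P \<Longrightarrow> R1 (\<lambda>e. \<not> P e)"
  by (simp add: R1_def)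

lemma R1_conj: "R1 P \<Longrightarrow> R1 Q \<Longrightarrow> R1 (\<lambda>e. P e \<and> Q e)"
  unfolding R1_def de_Morgan_conj de_Morgan_disj by (elim conjE, intro conjI S1_conj S1_disj)

lemma R1_disj: "R1 P \<Longrightarrow> R1 Q \<Longrightarrow> R1 (\<lambda>e. P e \<or> Q e)"
  unfolding R1_def de_Morgan_conj de_Morgan_disj by (elim conjE, intro conjI S1_conj S1_disj)

lemma R1_imp: "R1 P \<Longrightarrow> R1 Q \<Longrightarrow> R1 (\<lambda>e. P e \<longrightarrow> Q e)"
  unfolding imp_conv_disj by (intro R1_disj R1_not)

lemma R1_iff: "R1 P \<Longrightarrow> R1 Q \<Longrightarrow> R1 (\<lambda>e. P e \<longleftrightarrow> Q e)"
  unfolding iff_conv_conj_imp by (intro R1_conj R1_imp)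

lemma R1_ren: "R1 P \<Longrightarrow> inj r \<Longrightarrow> R1 (\<lambda>e. P (\<lambda>n. e (r n)))"
  unfolding R1_def using S1_ren[of P r] S1_ren[of "\<lambda>e. \<not> P e" r] by blast

lemma F1_TT: "TT t \<Longrightarrow> F1 t"
  unfolding F1_def using TT_ren[of t Suc] by (intro S1_D0 D0_intros) simp_all

lemma F1_shift: assumes "F1 f" shows "S1 (\<lambda>e. e 0 = f (\<lambda>n. e (Suc (Suc n))))"
proof -
  have "inj (case_nat 0 (\<lambda>n. Suc (Suc n)))" by (auto simp: inj_def split: nat.splits)
  from S1_ren[OF assms[unfolded F1_def] this] show ?thesis by simp
qed

lemma S1_subst:
  assumes "F1 f" "S1 (\<lambda>e. P (\<lambda>n. e (Suc n)) (e 0))"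
  shows "S1 (\<lambda>e. P e (f e))"
proof -
  have "S1 (\<lambda>e. \<exists>y. y = f e \<and> P e y)"
    by (rule S1_ex, rule S1_conj) (use assms F1_def in auto)
  then show ?thesis by simp
qed

text \<open>As f is total and single-valued, both \<open>P e (f e)\<close> and its negation can be
  written with an existential quantifier over the value of f; hence substitution preserves
  Delta-1.\<close>

lemma R1_subst:
  assumes "F1 f" "R1 (\<lambda>e. P (\<lambda>n. e (Suc n)) (e 0))"
  shows "R1 (\<lambda>e. P e (f e))"
  using S1_subst[OF assms(1), of P] S1_subst[OF assms(1), of "\<lambda>e y. \<not> P e y"] assms(2)
  by (simp add: R1_def)

lemma F1_subst:
  assumes "F1 f" "F1 (\<lambda>e. G (\<lambda>n. e (Suc n)) (e 0))"
  shows "F1 (\<lambda>e. G e (f e))"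
proof -
  have "inj (case_nat 1 (case_nat 0 (\<lambda>n. Suc (Suc n))))" by (auto simp: inj_def split: nat.splits)
  from S1_ren[OF assms(2)[unfolded F1_def] this]
  have "S1 (\<lambda>e. \<exists>y. y = f (\<lambda>n. e (Suc n)) \<and> e 0 = G (\<lambda>n. e (Suc n)) y)"
    by (intro S1_ex S1_conj F1_shift assms(1)) simp
  then show ?thesis by (simp add: F1_def)
qed

lemma F1_weaken: assumes "F1 f" shows "F1 (\<lambda>e. f (\<lambda>n. e (Suc n)))"
  unfolding F1_def using F1_shift[OF assms] .

lemma F1_var: "F1 (\<lambda>e. e n)" and F1_const: "F1 (\<lambda>e. c)"
  by (simp_all add: F1_TT TT_var TT_const)

lemma F1_comp2:
  assumes "F1 (\<lambda>e. H (e 1) (e 0))" "F1 f" "F1 g"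
  shows "F1 (\<lambda>e. H (f e) (g e))"
proof (rule F1_subst[OF assms(2)], rule F1_subst[OF F1_weaken[OF assms(3)]])
  show "F1 (\<lambda>e. H (e (Suc 0)) (e 0))" using assms(1) by simp
qed

lemma R1_comp2:
  assumes "R1 (\<lambda>e. H (e 1) (e 0))" "F1 f" "F1 g"
  shows "R1 (\<lambda>e. H (f e) (g e))"
proof (rule R1_subst[OF assms(2)], rule R1_subst[OF F1_weaken[OF assms(3)]])
  show "R1 (\<lambda>e. H (e (Suc 0)) (e 0))" using assms(1) by simp
qed

lemma F1_plus: "F1 f \<Longrightarrow> F1 g \<Longrightarrow> F1 (\<lambda>e. f e \<oplus> g e)"
  by (rule F1_comp2) (intro F1_TT TT_plus TT_var)

lemma F1_times: "F1 f \<Longrightarrow> F1 g \<Longrightarrow> F1 (\<lambda>e. f e \<otimes> g e)"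
  by (rule F1_comp2) (intro F1_TT TT_times TT_var)

lemma F1_pair: "F1 f \<Longrightarrow> F1 g \<Longrightarrow> F1 (\<lambda>e. pairM M (f e) (g e))"
  unfolding pairM_def by (intro F1_plus F1_times)

lemma R1_eq: "F1 f \<Longrightarrow> F1 g \<Longrightarrow> R1 (\<lambda>e. f e = g e)"
  by (rule R1_comp2) (intro R1_D0 D0_intros)

lemma R1_less: "F1 f \<Longrightarrow> F1 g \<Longrightarrow> R1 (\<lambda>e. f e \<prec> g e)"
  by (rule R1_comp2) (intro R1_D0 D0_intros)

lemma R1_le: "F1 f \<Longrightarrow> F1 g \<Longrightarrow> R1 (\<lambda>e. f e \<preceq> g e)"
  unfolding leM_def by (intro R1_disj R1_less R1_eq)

lemma R1_mem: "F1 f \<Longrightarrow> A \<in> Sets M \<Longrightarrow> R1 (\<lambda>e. f e \<in> A)"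
  by (rule R1_subst, assumption) (intro R1_D0 D0_intros)

lemma inj_skip1: "inj (case_nat 0 (\<lambda>n. Suc (Suc n)))"
  by (auto simp: inj_def split: nat.splits)

lemma S1_ball:
  assumes "F1 f" "S1 (\<lambda>e. P (\<lambda>n. e (Suc n)) (e 0))"
  shows "S1 (\<lambda>e. \<forall>a. a \<prec> f e \<longrightarrow> P e a)"
proof (rule S1_subst[OF assms(1), where P = "\<lambda>e y. \<forall>a. a \<prec> y \<longrightarrow> P e a"])
  show "S1 (\<lambda>e. \<forall>a. a \<prec> e 0 \<longrightarrow> P (\<lambda>n. e (Suc n)) a)"
    using S1_ren[OF assms(2) inj_skip1] by (intro S1_ball_TT TT_var) simp
qed

lemma S1_bex:
  assumes "F1 f" "S1 (\<lambda>e. P (\<lambda>n. e (Suc n)) (e 0))"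
  shows "S1 (\<lambda>e. \<exists>a. a \<prec> f e \<and> P e a)"
  by (intro S1_ex S1_conj S1_R1[OF R1_less] F1_var F1_weaken assms)

lemma R1_ball:
  assumes "F1 f" "R1 (\<lambda>e. P (\<lambda>n. e (Suc n)) (e 0))"
  shows "R1 (\<lambda>e. \<forall>a. a \<prec> f e \<longrightarrow> P e a)"
  using S1_ball[of f P] S1_bex[of f "\<lambda>e a. \<not> P e a"] assms by (simp add: R1_def)

lemma R1_bex:
  assumes "F1 f" "R1 (\<lambda>e. P (\<lambda>n. e (Suc n)) (e 0))"
  shows "R1 (\<lambda>e. \<exists>a. a \<prec> f e \<and> P e a)"
  using S1_bex[of f P] S1_ball[of f "\<lambda>e a. \<not> P e a"] assms by (simp add: R1_def)

lemma R1_ball_le: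
  assumes "F1 f" "R1 (\<lambda>e. P (\<lambda>n. e (Suc n)) (e 0))"
  shows "R1 (\<lambda>e. \<forall>a. a \<preceq> f e \<longrightarrow> P e a)"
  unfolding less_add_one by (intro R1_ball F1_plus F1_const assms)

lemma R1_bex_le:
  assumes "F1 f" "R1 (\<lambda>e. P (\<lambda>n. e (Suc n)) (e 0))"
  shows "R1 (\<lambda>e. \<exists>a. a \<preceq> f e \<and> P e a)"
  unfolding less_add_one by (intro R1_bex F1_plus F1_const assms)

lemmas R1_intros = F1_var F1_const F1_plus F1_times F1_pair R1_eq R1_less R1_le R1_mem
  R1_ball R1_bex R1_ball_le R1_bex_le R1_not R1_conj R1_disj R1_imp R1_iff

section \<open>Induction and comprehension principles\<close>

lemma R1_comprehension: "R1 (\<lambda>e. P (e 0)) \<Longrightarrow> Collect P \<in> Sets M"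
  by (simp add: R1_def S1_comprehension)

text \<open>If there were no least element, the statement that P fails everywhere below k would be
  inductive in k. It is Sigma-1 because bounded quantification preserves Sigma-1.\<close>

lemma P1_least:
  assumes "S1 (\<lambda>e. \<not> P (e 0))" "P a"
  obtains m where "P m" "\<And>b. b \<prec> m \<Longrightarrow> \<not> P b"
proof (rule ccontr)
  assume neg: "\<not> thesis"
  have "\<forall>b. b \<prec> k \<longrightarrow> \<not> P b" for k
  proof (rule S1_induct[where a = k])
    show "S1 (\<lambda>e. \<forall>b. b \<prec> e 0 \<longrightarrow> \<not> P b)"
      using S1_ren[OF assms(1), of "case_nat 0 Suc"]
      by (intro S1_ball F1_var) (simp add: assms(1))
    fix k assume "\<forall>b. b \<prec> k \<longrightarrow> \<not> P b"
    then show "\<forall>b. b \<prec> k \<oplus> \<one> \<longrightarrow> \<not> P b"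
      using neg that by (auto simp: less_suc)
  qed (simp add: not_less_zero)
  then show False using assms(2) less_suc by blast
qed

lemma S1_less_induct:
  assumes "S1 (\<lambda>e. P (e 0))" "\<And>a. (\<And>b. b \<prec> a \<Longrightarrow> P b) \<Longrightarrow> P a"
  shows "P a"
proof (rule ccontr)
  assume "\<not> P a"
  then obtain m where "\<not> P m" "\<And>b. b \<prec> m \<Longrightarrow> \<not> \<not> P b"
    using assms(1) by (rule_tac P1_least[of "\<lambda>a. \<not> P a" a]) auto
  then show False using assms(2) by blast
qed

text \<open>A counterexample a is pushed downwards: Sigma-1 induction on k finds a counterexample j
  with j + k = a. At k = a it must be 0.\<close>

lemma P1_induct:
  assumes "S1 (\<lambda>e. \<not> P (e 0))" "P \<zero>" "\<And>a. P a \<Longrightarrow> P (a \<oplus> \<one>)"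
  shows "P a"
proof (rule ccontr)
  assume a: "\<not> P a"
  \<comment> \<open>The second disjunct absorbs the values of k beyond a, for which no such j
    exists.\<close>
  have "(\<exists>j. \<not> P j \<and> j \<oplus> k = a) \<or> a \<prec> k" for k
  proof (rule S1_induct[where a = k])
    have "S1 (\<lambda>e. \<not> P (e 0))" by (rule assms(1))
    then show "S1 (\<lambda>e. (\<exists>j. \<not> P j \<and> j \<oplus> e 0 = a) \<or> a \<prec> e 0)"
      by (intro S1_disj S1_ex S1_conj S1_R1[OF R1_eq] S1_R1[OF R1_less] R1_intros)
    show "(\<exists>j. \<not> P j \<and> j \<oplus> \<zero> = a) \<or> a \<prec> \<zero>" using a by simp
    fix k assume "(\<exists>j. \<not> P j \<and> j \<oplus> k = a) \<or> a \<prec> k"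
    then show "(\<exists>j. \<not> P j \<and> j \<oplus> (k \<oplus> \<one>) = a) \<or> a \<prec> k \<oplus> \<one>"
    proof
      assume "\<exists>j. \<not> P j \<and> j \<oplus> k = a"
      then obtain j where j: "\<not> P j" "j \<oplus> k = a" by blast
      then obtain i where i: "j = i \<oplus> \<one>" using zero_or_suc[of j] assms(2) by auto
      then have "\<not> P i" using j assms(3) by blast
      moreover have "i \<oplus> (k \<oplus> \<one>) = a" using i j by (simp add: add_acs)
      ultimately show ?thesis by blast
    qed (simp add: less_suc)
  qed
  from this[of a] obtain j where "\<not> P j" "j \<oplus> a = a" by auto
  then show False using assms(2) by simp
qed

section \<open>Pairs and codes of finite sets\<close>

abbreviation pr where "pr a b \<equiv> pairM M a b"
abbreviation fm (infix "\<epsilon>" 50) where "x \<epsilon> c \<equiv> fin_memM M x c"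
abbreviation dv (infix "dvM" 50) where "d dvM n \<equiv> dvd.dvd (timesM M) d n"

lemmas N_alg = N.distrib_left N.distrib_right N.add.assoc N.add.commute N.add.left_commute
  N.mult.assoc N.mult.commute N.mult.left_commute

lemma zero_le [simp]: "\<zero> \<preceq> a"
  by (simp add: le_iff_add')

lemma le_mult_self: "a \<preceq> a \<otimes> a"
proof (cases "a = \<zero>")
  case False
  then have "\<one> \<preceq> a" using zero_or_suc[of a] by (auto simp: le_iff_add' N.add.commute)
  then show ?thesis using N.mult_left_mono[of "\<one>" a a] by simp
qed simp

lemma fst_le_pr: "a \<preceq> pr a b"
  unfolding pairM_def le_iff_add' by (metis N.add.commute)

lemma snd_le_pr: "b \<preceq> pr a b"
proof -
  have "b \<preceq> a \<oplus> b" by (metis le_iff_add' N.add.commute)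
  also have "\<dots> \<preceq> (a \<oplus> b) \<otimes> (a \<oplus> b)" by (rule le_mult_self)
  also have "\<dots> \<preceq> pr a b" unfolding pairM_def le_iff_add' by blast
  finally show ?thesis .
qed

lemma pr_mono: "a \<preceq> c \<Longrightarrow> b \<preceq> d \<Longrightarrow> pr a b \<preceq> pr c d"
  unfolding pairM_def by (intro N.add_mono N.mult_mono zero_le)

text \<open>With u = a + b the code of the pair lies between u * u and u * u + u, hence below (u +
  1) * (u + 1). Codes of pairs with different sums thus fall into disjoint intervals.\<close>

lemma pr_sum_less: assumes "a \<oplus> b \<prec> c \<oplus> d" shows "pr a b \<prec> pr c d"
proof -
  let ?u = "a \<oplus> b"
  have "pr a b \<preceq> ?u \<otimes> ?u \<oplus> ?u"
    unfolding pairM_def by (intro N.add_left_mono) (auto simp: le_iff_add')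
  also have "\<dots> \<prec> (?u \<oplus> \<one>) \<otimes> (?u \<oplus> \<one>)"
    unfolding less_iff_add by (rule exI[of _ ?u]) (simp add: N.distrib_left N.distrib_right add_acs)
  also have "\<dots> \<preceq> (c \<oplus> d) \<otimes> (c \<oplus> d)"
  proof -
    have "?u \<oplus> \<one> \<preceq> c \<oplus> d"
      using assms by (auto simp: less_iff_add le_iff_add' add_acs)
    then show ?thesis by (intro N.mult_mono zero_le)
  qed
  also have "\<dots> \<preceq> pr c d" unfolding pairM_def le_iff_add' by blast
  finally show ?thesis .
qed

lemma pr_inj [simp]: "pr a b = pr c d \<longleftrightarrow> a = c \<and> b = d"
proof
  assume eq: "pr a b = pr c d"
  have sum: "a \<oplus> b = c \<oplus> d"
    using pr_sum_less[of a b c d] pr_sum_less[of c d a b] eq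
    by (metis N.less_irrefl N.linorder_cases)
  then have "a = c" using eq unfolding pairM_def sum by (simp add: add_cancel_left)
  then show "a = c \<and> b = d" using sum by (simp add: add_cancel_left)
qed simp

lemma fin_mem_pr: "x \<epsilon> pr k (pr m n) \<longleftrightarrow> x \<prec> k \<and> m \<otimes> (x \<oplus> \<one>) \<oplus> \<one> dvM n"
  unfolding fin_memM_def dvd.dvd_def by (auto simp: N.mult.commute)

lemma fin_mem_less: "x \<epsilon> c \<Longrightarrow> x \<prec> c"
  unfolding fin_memM_def using fst_le_pr by (metis N.less_le_trans)

text \<open>Bounding the quotient makes divisibility, and with it membership in coded sets, Delta-1.
  For d = 0 the quotient is arbitrary and 0 is chosen.\<close>

lemma dv_bounded: "d dvM n \<longleftrightarrow> (\<exists>q. q \<preceq> n \<and> n = d \<otimes> q)"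
proof
  assume "d dvM n"
  then obtain q where q: "n = d \<otimes> q" by (auto simp: dvd.dvd_def)
  show "\<exists>q. q \<preceq> n \<and> n = d \<otimes> q"
    using zero_or_suc[of d]
  proof
    assume "d = \<zero>"
    then show ?thesis using q by (intro exI[of _ \<zero>]) simp
  next
    assume "\<exists>c. d = c \<oplus> \<one>"
    then have "q \<preceq> n" using q by (auto simp: N.distrib_right le_iff_add' N.add.commute)
    then show ?thesis using q by blast
  qed
qed (auto simp: dvd.dvd_def)

lemma R1_dv: "F1 f \<Longrightarrow> F1 g \<Longrightarrow> R1 (\<lambda>e. f e dvM g e)"
  by (rule R1_comp2) (unfold dv_bounded, intro R1_intros)

lemma fin_mem_bounded: "x \<epsilon> c \<longleftrightarrow> (\<exists>k. k \<preceq> c \<and> (\<exists>m. m \<preceq> c \<and> (\<exists>n. n \<preceq> c \<and>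
    c = pr k (pr m n) \<and> x \<prec> k \<and> m \<otimes> (x \<oplus> \<one>) \<oplus> \<one> dvM n)))"
proof
  assume "x \<epsilon> c"
  then obtain k m n where c: "c = pr k (pr m n)" by (auto simp: fin_memM_def)
  have "k \<preceq> c" "m \<preceq> c" "n \<preceq> c"
    unfolding c by (metis fst_le_pr snd_le_pr N.order_trans)+
  moreover have "x \<prec> k \<and> m \<otimes> (x \<oplus> \<one>) \<oplus> \<one> dvM n"
    using \<open>x \<epsilon> c\<close> by (simp add: c fin_mem_pr)
  ultimately show "\<exists>k. k \<preceq> c \<and> (\<exists>m. m \<preceq> c \<and> (\<exists>n. n \<preceq> c \<and>
    c = pr k (pr m n) \<and> x \<prec> k \<and> m \<otimes> (x \<oplus> \<one>) \<oplus> \<one> dvM n))" using c by blast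
qed (auto simp: fin_mem_pr)

lemma R1_fin_mem: "F1 f \<Longrightarrow> F1 g \<Longrightarrow> R1 (\<lambda>e. f e \<epsilon> g e)"
  by (rule R1_comp2) (unfold fin_mem_bounded, intro R1_intros R1_dv)

text \<open>Put p = m(x+1)+1 and r = m(y+1)+1. The numbers (y+1)p and (x+1)r differ exactly by the
  distance d + 1 of x and y, so p divides n(d+1). As d + 1 divides m, p divides nm(x+1); it also
  divides np = nm(x+1) + n, hence n. Two cases replace the subtraction, and neither gcd nor primes
  are needed.\<close>

lemma beta_coprime:
  assumes dvd: "\<And>i. i \<prec> b \<Longrightarrow> i \<oplus> \<one> dvM m" and xy: "x \<prec> b" "y \<prec> b" "x \<noteq> y"
    and pn: "m \<otimes> (x \<oplus> \<one>) \<oplus> \<one> dvM n \<otimes> (m \<otimes> (y \<oplus> \<one>) \<oplus> \<one>)"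
  shows "m \<otimes> (x \<oplus> \<one>) \<oplus> \<one> dvM n"
proof -
  let ?p = "m \<otimes> (x \<oplus> \<one>) \<oplus> \<one>" and ?r = "m \<otimes> (y \<oplus> \<one>) \<oplus> \<one>"
  have "\<exists>d. d \<oplus> \<one> dvM m \<and> ?p dvM n \<otimes> (d \<oplus> \<one>)"
  proof (cases "x \<prec> y")
    case True
    then obtain d where d: "y = x \<oplus> (d \<oplus> \<one>)" by (auto simp: less_iff_add)
    have "d \<prec> y" unfolding d less_iff_add by (rule exI[of _ x]) (simp add: add_acs)
    then have "d \<oplus> \<one> dvM m" using dvd xy by (meson N.less_trans)
    moreover have "(x \<oplus> \<one>) \<otimes> (n \<otimes> ?r) \<oplus> n \<otimes> (d \<oplus> \<one>) = (n \<otimes> (y \<oplus> \<one>)) \<otimes> ?p"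
      unfolding d by (simp only: N_alg N.mult_1_left N.mult_1_right)
    moreover have "?p dvM (x \<oplus> \<one>) \<otimes> (n \<otimes> ?r)" "?p dvM (n \<otimes> (y \<oplus> \<one>)) \<otimes> ?p"
      using pn by (simp_all add: N.dvd_mult N.dvd_mult2)
    ultimately show ?thesis using N.dvd_add_right_iff by metis
  next
    case False
    then have "y \<prec> x" using xy by (metis N.linorder_cases)
    then obtain d where d: "x = y \<oplus> (d \<oplus> \<one>)" by (auto simp: less_iff_add)
    have "d \<prec> x" unfolding d less_iff_add by (rule exI[of _ y]) (simp add: add_acs)
    then have "d \<oplus> \<one> dvM m" using dvd xy by (meson N.less_trans)
    moreover have "(n \<otimes> (y \<oplus> \<one>)) \<otimes> ?p \<oplus> n \<otimes> (d \<oplus> \<one>) = (x \<oplus> \<one>) \<otimes> (n \<otimes> ?r)"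
      unfolding d by (simp only: N_alg N.mult_1_left N.mult_1_right)
    moreover have "?p dvM (x \<oplus> \<one>) \<otimes> (n \<otimes> ?r)" "?p dvM (n \<otimes> (y \<oplus> \<one>)) \<otimes> ?p"
      using pn by (simp_all add: N.dvd_mult N.dvd_mult2)
    ultimately show ?thesis using N.dvd_add_right_iff by metis
  qed
  then obtain d where d: "d \<oplus> \<one> dvM m" "?p dvM n \<otimes> (d \<oplus> \<one>)" by blast
  then obtain q where "m = (d \<oplus> \<one>) \<otimes> q" by (auto simp: dvd.dvd_def)
  then have "n \<otimes> m \<otimes> (x \<oplus> \<one>) = n \<otimes> (d \<oplus> \<one>) \<otimes> (q \<otimes> (x \<oplus> \<one>))"
    by (simp add: N.mult.assoc)
  then have "?p dvM n \<otimes> m \<otimes> (x \<oplus> \<one>)" using d(2) by (simp add: N.dvd_mult2)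
  moreover have "?p dvM n \<otimes> m \<otimes> (x \<oplus> \<one>) \<oplus> n"
  proof -
    have "n \<otimes> m \<otimes> (x \<oplus> \<one>) \<oplus> n = n \<otimes> ?p" by (simp add: N.distrib_left N.mult.assoc)
    then show ?thesis by simp
  qed
  ultimately show ?thesis by (simp add: N.dvd_add_right_iff)
qed

text \<open>Sigma-1 induction on b, multiplying by \<open>f b\<close> at each step. Positivity
  excludes the trivial multiple 0.\<close>

lemma common_multiple:
  assumes "F1 (\<lambda>e. f (e 0))" "\<And>i. \<zero> \<prec> f i"
  shows "\<exists>m. \<zero> \<prec> m \<and> (\<forall>i. i \<prec> b \<longrightarrow> f i dvM m)"
proof (rule S1_induct[where a = b])
  have F: "F1 (\<lambda>e. f (g e))" if "F1 g" for g
    using F1_comp2[of "\<lambda>a b. f b" g g] assms(1) that by simp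
  show "S1 (\<lambda>e. \<exists>m. \<zero> \<prec> m \<and> (\<forall>i. i \<prec> e 0 \<longrightarrow> f i dvM m))"
    by (intro S1_ex S1_R1 R1_intros R1_dv F)
  show "\<exists>m. \<zero> \<prec> m \<and> (\<forall>i. i \<prec> \<zero> \<longrightarrow> f i dvM m)"
    using N.zero_less_one not_less_zero by blast
  fix b assume "\<exists>m. \<zero> \<prec> m \<and> (\<forall>i. i \<prec> b \<longrightarrow> f i dvM m)"
  then obtain m where m: "\<zero> \<prec> m" "\<And>i. i \<prec> b \<Longrightarrow> f i dvM m" by blast
  have "\<zero> \<prec> m \<otimes> f b \<and> (\<forall>i. i \<prec> b \<oplus> \<one> \<longrightarrow> f i dvM m \<otimes> f b)"
    using m assms(2) by (auto simp: less_suc N.dvd_mult2)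
  then show "\<exists>m. \<zero> \<prec> m \<and> (\<forall>i. i \<prec> b \<oplus> \<one> \<longrightarrow> f i dvM m)" by blast
qed

text \<open>
  The number z = (b,(m,n)) codes all x < b. As m is divisible by 1, ..., b, the moduli m(x + 1) + 1
  are pairwise coprime, so every Sigma-1 subset has a code with the same b and m and a smaller n.
\<close>

definition full_code :: "'a \<Rightarrow> 'a \<Rightarrow> bool" where
  "full_code b z \<longleftrightarrow> (\<exists>m. m \<preceq> z \<and> (\<exists>n. n \<preceq> z \<and> z = pr b (pr m n) \<and> \<zero> \<prec> m \<and> \<zero> \<prec> n \<and>
    (\<forall>i. i \<prec> b \<longrightarrow> i \<oplus> \<one> dvM m) \<and> (\<forall>x. x \<prec> b \<longrightarrow> m \<otimes> (x \<oplus> \<one>) \<oplus> \<one> dvM n)))"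

lemma suc_pos [simp]: "\<zero> \<prec> a \<oplus> \<one>"
  by (simp add: less_suc) (metis leM_def zero_le)

lemma full_code_ex: "\<exists>z. full_code b z"
proof -
  obtain m where m: "\<zero> \<prec> m" "\<And>i. i \<prec> b \<Longrightarrow> i \<oplus> \<one> dvM m"
    using common_multiple[OF F1_plus[OF F1_var F1_const], of \<one> b] by auto
  have "F1 (\<lambda>e. m \<otimes> (e 0 \<oplus> \<one>) \<oplus> \<one>)" by (intro R1_intros)
  then obtain n where n: "\<zero> \<prec> n" "\<And>x. x \<prec> b \<Longrightarrow> m \<otimes> (x \<oplus> \<one>) \<oplus> \<one> dvM n"
    using common_multiple[of "\<lambda>x. m \<otimes> (x \<oplus> \<one>) \<oplus> \<one>" b] by auto
  then have "full_code b (pr b (pr m n))"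
    unfolding full_code_def
  proof (intro exI conjI allI impI)
    show "m \<preceq> pr b (pr m n)" "n \<preceq> pr b (pr m n)"
      by (meson fst_le_pr snd_le_pr N.order_trans)+
  qed (auto simp: m n)
  then show ?thesis by blast
qed

text \<open>
  The least positive n divisible by the moduli of all x in the set is divisible by no others, since
  by coprimality any other modulus could be cancelled.
\<close>

lemma subset_code:
  assumes "full_code b z" "S1 (\<lambda>e. P (e 0))"
  shows "\<exists>c. c \<preceq> z \<and> (\<forall>x. x \<epsilon> c \<longleftrightarrow> x \<prec> b \<and> P x)"
proof -
  from assms(1) obtain m k where z: "z = pr b (pr m k)" and m: "\<zero> \<prec> m" "\<zero> \<prec> k"
    "\<And>i. i \<prec> b \<Longrightarrow> i \<oplus> \<one> dvM m" "\<And>x. x \<prec> b \<Longrightarrow> m \<otimes> (x \<oplus> \<one>) \<oplus> \<one> dvM k"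
    by (auto simp: full_code_def)
  let ?p = "\<lambda>x. m \<otimes> (x \<oplus> \<one>) \<oplus> \<one>"
  \<comment> \<open>Positivity matters, as 0 is divisible by every modulus. The matrix is a negated
    conjunction so that the complement of \<open>?C\<close> is visibly Sigma-1 when P is.\<close>
  let ?C = "\<lambda>n. \<zero> \<prec> n \<and> (\<forall>x. x \<prec> b \<longrightarrow> \<not> (P x \<and> \<not> ?p x dvM n))"
  have neg: "\<not> ?C n \<longleftrightarrow> n = \<zero> \<or> (\<exists>x. x \<prec> b \<and> (P x \<and> \<not> ?p x dvM n))" for n
    using zero_le[of n] by (auto simp: leM_def)
  have P: "S1 (\<lambda>e. P (f e))" if "F1 f" for f
    by (rule S1_subst[OF that]) (rule assms(2))
  have "S1 (\<lambda>e. \<not> ?C (e 0))"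
    unfolding neg by (intro S1_disj S1_bex S1_conj P S1_R1[OF R1_eq] S1_R1[OF R1_not] R1_dv R1_intros)
  then obtain n where n: "?C n" "\<And>d. d \<prec> n \<Longrightarrow> \<not> ?C d"
    using P1_least[of ?C k] m by blast
  have "n \<preceq> k" using n(2)[of k] m by (metis N.not_less)
  have "P x" if x: "x \<prec> b" "?p x dvM n" for x
  proof (rule ccontr)
    assume "\<not> P x"
    from x(2) obtain d where d: "n = d \<otimes> ?p x" by (auto simp: dvd.dvd_def N.mult.commute)
    have "?C d"
    proof (intro conjI allI impI notI)
      show "\<zero> \<prec> d" using n(1) zero_le[of d] by (auto simp: d leM_def)
      fix y assume y: "y \<prec> b" "P y \<and> \<not> ?p y dvM d"
      then have "?p y dvM n" using n(1) by blast
      then have "?p y dvM d" unfolding d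
        using y x \<open>\<not> P x\<close> by (intro beta_coprime[of b m y x d] m) auto
      then show False using y by simp
    qed
    \<comment> \<open>The cancelled modulus exceeds 1 because m is positive, and d is positive, so
      the quotient is strictly smaller than the least n.\<close>
    moreover have "d \<prec> n"
    proof -
      have "\<zero> \<prec> m \<otimes> (x \<oplus> \<one>)" using m by simp
      moreover have "\<zero> \<prec> d" using \<open>?C d\<close> by blast
      ultimately have "d \<oplus> \<zero> \<prec> d \<oplus> d \<otimes> (m \<otimes> (x \<oplus> \<one>))"
        by (intro N.add_strict_left_mono) simp
      then show ?thesis by (simp add: d N.distrib_left N.add.commute)
    qed
    ultimately show False using n(2) by blast
  qed
  then have "\<forall>x. x \<epsilon> pr b (pr m n) \<longleftrightarrow> x \<prec> b \<and> P x"
    using n(1) by (auto simp: fin_mem_pr)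
  moreover have "pr b (pr m n) \<preceq> z"
    unfolding z by (intro pr_mono N.order_refl \<open>n \<preceq> k\<close>)
  ultimately show ?thesis by blast
qed

section \<open>Search and finite comprehension\<close>

definition Mu :: "('a \<Rightarrow> bool) \<Rightarrow> 'a" where
  "Mu p = (THE a. p a \<and> (\<forall>b. b \<prec> a \<longrightarrow> \<not> p b))"

lemma Mu_eq: "p a \<Longrightarrow> (\<And>b. b \<prec> a \<Longrightarrow> \<not> p b) \<Longrightarrow> Mu p = a"
  unfolding Mu_def by (rule the_equality) (auto intro: N.linorder_cases)

lemma Mu_least:
  assumes "R1 (\<lambda>e. p (e 0))" "p a"
  shows Mu_prop: "p (Mu p)" and Mu_min: "b \<prec> Mu p \<Longrightarrow> \<not> p b"
proof -
  have "S1 (\<lambda>e. \<not> p (e 0))" using assms(1) by (simp add: R1_def)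
  then obtain m where m: "p m" "\<And>b. b \<prec> m \<Longrightarrow> \<not> p b"
    using assms(2) by (rule P1_least[of p a]) (rule that)
  then have "Mu p = m" by (rule Mu_eq)
  then show "p (Mu p)" "b \<prec> Mu p \<Longrightarrow> \<not> p b" using m by auto
qed

lemma S1_fix:
  assumes "S1 (\<lambda>e. P (\<lambda>n. e (Suc n)) (e 0))"
  shows "S1 (\<lambda>e. P d (e 0))"
proof -
  obtain Q where Q: "D0 Q" "\<And>e. P (\<lambda>n. e (Suc n)) (e 0) \<longleftrightarrow> (\<exists>a. Q (a ## e))"
    by (rule S1_E[OF assms]) (rule that)
  have "P d a \<longleftrightarrow> (\<exists>b. Q (b ## a ## d))" for a
    using Q(2)[of "a ## d"] by simp
  moreover have "S1 (\<lambda>e. \<exists>b. Q (b ## e 0 ## d))"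
    by (intro S1_ex_D0 D0_env2_fix Q)
  ultimately show ?thesis by simp
qed

lemma R1_fix: "R1 (\<lambda>e. P (\<lambda>n. e (Suc n)) (e 0)) \<Longrightarrow> R1 (\<lambda>e. P d (e 0))"
  unfolding R1_def using S1_fix[of P d] S1_fix[of "\<lambda>e a. \<not> P e a" d] by simp

text \<open>The graph says that \<open>P e\<close> holds at the value and fails below it, which is
  Delta-1. That a solution exists in every environment makes this description exact.\<close>

lemma F1_Mu:
  assumes R: "R1 (\<lambda>e. P (\<lambda>n. e (Suc n)) (e 0))" and ex: "\<And>e. \<exists>a. P e a"
  shows "F1 (\<lambda>e. Mu (P e))"
proof -
  have "R1 (\<lambda>e. P (\<lambda>n. e (Suc n)) (e 0) \<and> (\<forall>b. b \<prec> e 0 \<longrightarrow> \<not> P (\<lambda>n. e (Suc n)) b))"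
    using R R1_ren[OF R inj_skip1] by (intro R1_conj R1_ball R1_not F1_var) simp_all
  moreover have "a = Mu (P d) \<longleftrightarrow> P d a \<and> (\<forall>b. b \<prec> a \<longrightarrow> \<not> P d b)" for a d
    using Mu_prop[OF R1_fix[OF R]] Mu_min[OF R1_fix[OF R]] ex[of d] Mu_eq[of "P d" a] by metis
  ultimately show ?thesis unfolding F1_def by (simp add: S1_R1)
qed

text \<open>Bounds the least codes of all coded sets of numbers below b, and so turns quantifiers
  over subsets of an initial segment into bounded ones.\<close>

definition code_bound :: "'a \<Rightarrow> 'a" where
  "code_bound b = Mu (full_code b)"

lemma R1_full_code: "R1 (\<lambda>e. full_code (e 1) (e 0))"
  unfolding full_code_def by (intro R1_intros R1_dv)

lemma F1_code_bound: assumes "F1 f" shows "F1 (\<lambda>e. code_bound (f e))"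
  unfolding code_bound_def by (intro F1_Mu R1_comp2[OF R1_full_code] F1_weaken assms F1_var full_code_ex)

lemma full_code_code_bound: "full_code b (code_bound b)"
proof -
  have "R1 (\<lambda>e. full_code b (e 0))" by (intro R1_comp2[OF R1_full_code] F1_var F1_const)
  then show ?thesis unfolding code_bound_def using full_code_ex Mu_prop by blast
qed

text \<open>Equality of sets is written as two inclusions with bounded quantifiers to make the
  search predicate Delta-1 whenever P is; \<open>code_iff\<close> restores the extensional
  reading.\<close>

definition fcode :: "'a \<Rightarrow> ('a \<Rightarrow> bool) \<Rightarrow> 'a" where
  "fcode b P = Mu (\<lambda>c. (\<forall>x. x \<prec> c \<longrightarrow> x \<epsilon> c \<longrightarrow> x \<prec> b \<and> P x) \<and> (\<forall>x. x \<prec> b \<longrightarrow> P x \<longrightarrow> x \<epsilon> c))"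

definition canon :: "'a \<Rightarrow> bool" where
  "canon s \<longleftrightarrow> (\<forall>d. d \<prec> s \<longrightarrow> \<not> (\<forall>x. x \<epsilon> d \<longleftrightarrow> x \<epsilon> s))"

lemma code_iff: "(\<forall>x. x \<prec> c \<longrightarrow> x \<epsilon> c \<longrightarrow> x \<prec> b \<and> P x) \<and> (\<forall>x. x \<prec> b \<longrightarrow> P x \<longrightarrow> x \<epsilon> c) \<longleftrightarrow>
    (\<forall>x. x \<epsilon> c \<longleftrightarrow> x \<prec> b \<and> P x)"
  using fin_mem_less by blast

lemma fcode_cong: "(\<And>x. x \<prec> b \<Longrightarrow> P x \<longleftrightarrow> Q x) \<Longrightarrow> fcode b P = fcode b Q"
  unfolding fcode_def code_iff by (rule arg_cong[where f = Mu]) auto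

lemma S1_code_ex: "S1 (\<lambda>e. P (e 0)) \<Longrightarrow> \<exists>c. \<forall>x. x \<epsilon> c \<longleftrightarrow> x \<prec> b \<and> P x"
  using subset_code[OF full_code_code_bound] by blast

lemma canon_eq: "canon s \<Longrightarrow> canon t \<Longrightarrow> (\<And>x. x \<epsilon> s \<longleftrightarrow> x \<epsilon> t) \<Longrightarrow> s = t"
  unfolding canon_def by (metis N.linorder_cases)

lemma canon_le_code_bound: assumes "canon s" "\<And>x. x \<epsilon> s \<Longrightarrow> x \<prec> b" shows "s \<preceq> code_bound b"
proof -
  have "S1 (\<lambda>e. e 0 \<epsilon> s)" by (intro S1_R1 R1_fin_mem R1_intros)
  then obtain c where "c \<preceq> code_bound b" "\<forall>x. x \<epsilon> c \<longleftrightarrow> x \<prec> b \<and> x \<epsilon> s"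
    using subset_code[OF full_code_code_bound, of "\<lambda>x. x \<epsilon> s" b] by blast
  moreover from this have "\<not> c \<prec> s"
    using assms by (auto simp: canon_def)
  ultimately show ?thesis by (metis N.not_less N.order_trans)
qed

lemma
  assumes "R1 (\<lambda>e. P (e 0))"
  shows fcode_mem: "x \<epsilon> fcode b P \<longleftrightarrow> x \<prec> b \<and> P x" and fcode_canon: "canon (fcode b P)"
proof -
  let ?q = "\<lambda>c. (\<forall>x. x \<prec> c \<longrightarrow> x \<epsilon> c \<longrightarrow> x \<prec> b \<and> P x) \<and> (\<forall>x. x \<prec> b \<longrightarrow> P x \<longrightarrow> x \<epsilon> c)"
  have P: "R1 (\<lambda>e. P (f e))" if "F1 f" for f
    by (rule R1_subst[OF that]) (rule assms)
  have R: "R1 (\<lambda>e. ?q (e 0))"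
    by (intro R1_intros R1_fin_mem P)
  obtain c where c: "?q c" using S1_code_ex[OF S1_R1[OF assms]] unfolding code_iff by blast
  have "?q (fcode b P)" unfolding fcode_def by (rule Mu_prop[of ?q, OF R, OF c])
  then have mem: "x \<epsilon> fcode b P \<longleftrightarrow> x \<prec> b \<and> P x" for x unfolding code_iff by simp
  then show "x \<epsilon> fcode b P \<longleftrightarrow> x \<prec> b \<and> P x" .
  have "\<not> ?q d" if "d \<prec> fcode b P" for d
    using that unfolding fcode_def by (rule Mu_min[of ?q, OF R, OF c])
  then show "canon (fcode b P)"
    unfolding canon_def mem code_iff by simp
qed

lemma fcode_le_code_bound: "R1 (\<lambda>e. P (e 0)) \<Longrightarrow> fcode b P \<preceq> code_bound b"
  by (rule canon_le_code_bound) (simp_all add: fcode_canon fcode_mem)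

lemma F1_fcode:
  assumes f: "F1 f" and P: "R1 (\<lambda>e. P (\<lambda>n. e (Suc n)) (e 0))"
  shows "F1 (\<lambda>e. fcode (f e) (P e))"
  unfolding fcode_def
proof (rule F1_Mu)
  have "R1 (\<lambda>e. P (\<lambda>n. e (Suc (Suc n))) (e 0))"
    using R1_ren[OF P inj_skip1] by simp
  moreover have "F1 (\<lambda>e. f (\<lambda>n. e (Suc (Suc n))))" "F1 (\<lambda>e. f (\<lambda>n. e (Suc n)))"
    using F1_weaken[OF F1_weaken[OF f]] F1_weaken[OF f] by simp_all
  ultimately show "R1 (\<lambda>e. (\<forall>x. x \<prec> e 0 \<longrightarrow> x \<epsilon> e 0 \<longrightarrow> x \<prec> f (\<lambda>n. e (Suc n)) \<and> P (\<lambda>n. e (Suc n)) x) \<and>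
      (\<forall>x. x \<prec> f (\<lambda>n. e (Suc n)) \<longrightarrow> P (\<lambda>n. e (Suc n)) x \<longrightarrow> x \<epsilon> e 0))"
    by (intro R1_intros R1_fin_mem)
  show "\<exists>c. (\<forall>x. x \<prec> c \<longrightarrow> x \<epsilon> c \<longrightarrow> x \<prec> f e \<and> P e x) \<and> (\<forall>x. x \<prec> f e \<longrightarrow> P e x \<longrightarrow> x \<epsilon> c)" for e
    unfolding code_iff by (rule S1_code_ex[OF S1_R1[OF R1_fix[OF P]]])
qed

section \<open>Binary sequences\<close>

text \<open>The characteristic function of d below l, as a coded sequence;
  \<open>pr l \<one> \<oplus> \<one>\<close> exceeds every pair (i,y) with i < l and y at most 1. In
  the other direction, \<open>ones\<close> recovers a set from a sequence.\<close>

definition bin_seq :: "'a \<Rightarrow> 'a \<Rightarrow> 'a" where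
  "bin_seq d l = fcode (pr l \<one> \<oplus> \<one>)
     (\<lambda>p. \<exists>i. i \<prec> l \<and> (i \<epsilon> d \<and> p = pr i \<one> \<or> \<not> i \<epsilon> d \<and> p = pr i \<zero>))"

definition ones :: "'a \<Rightarrow> 'a" where
  "ones s = fcode s (\<lambda>i. pr i \<one> \<epsilon> s)"

lemma F1_bin_seq: "F1 f \<Longrightarrow> F1 g \<Longrightarrow> F1 (\<lambda>e. bin_seq (f e) (g e))"
  by (rule F1_comp2) (unfold bin_seq_def, intro F1_fcode R1_intros R1_fin_mem)

lemma F1_ones: "F1 f \<Longrightarrow> F1 (\<lambda>e. ones (f e))"
  by (rule F1_comp2[where H = "\<lambda>_ s. ones s" and f = f])
    (unfold ones_def, intro F1_fcode R1_intros R1_fin_mem, assumption+)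

lemma bin_seq_mem': "p \<epsilon> bin_seq d l \<longleftrightarrow> (\<exists>i. i \<prec> l \<and> (i \<epsilon> d \<and> p = pr i \<one> \<or> \<not> i \<epsilon> d \<and> p = pr i \<zero>))"
proof -
  have "R1 (\<lambda>e. \<exists>i. i \<prec> l \<and> (i \<epsilon> d \<and> e 0 = pr i \<one> \<or> \<not> i \<epsilon> d \<and> e 0 = pr i \<zero>))"
    by (intro R1_intros R1_fin_mem)
  moreover have "pr i y \<prec> pr l \<one> \<oplus> \<one>" if "i \<prec> l" "y = \<zero> \<or> y = \<one>" for i y
    unfolding less_add_one[symmetric] using that by (intro pr_mono) (auto simp: leM_def)
  ultimately show ?thesis unfolding bin_seq_def by (subst fcode_mem) auto
qed

lemma bin_seq_mem: "pr i y \<epsilon> bin_seq d l \<longleftrightarrow> i \<prec> l \<and> (i \<epsilon> d \<and> y = \<one> \<or> \<not> i \<epsilon> d \<and> y = \<zero>)"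
  unfolding bin_seq_mem' by auto

lemma bin_seq_canon: "canon (bin_seq d l)"
  unfolding bin_seq_def by (rule fcode_canon) (intro R1_intros R1_fin_mem)

lemma ones_mem: "i \<epsilon> ones s \<longleftrightarrow> pr i \<one> \<epsilon> s"
proof -
  have "R1 (\<lambda>e. pr (e 0) \<one> \<epsilon> s)" by (intro R1_intros R1_fin_mem)
  moreover have "pr i \<one> \<epsilon> s \<Longrightarrow> i \<prec> s"
    using fin_mem_less fst_le_pr by (metis N.le_less_trans)
  ultimately show ?thesis unfolding ones_def by (subst fcode_mem) auto
qed

lemma seq_of_lengthM_canon:
  "seq_of_lengthM M s l \<longleftrightarrow> canon s \<and>
     (\<forall>p. p \<epsilon> s \<longrightarrow> (\<exists>i y. p = pr i y)) \<and>
     (\<forall>i y z. pr i y \<epsilon> s \<and> pr i z \<epsilon> s \<longrightarrow> y = z) \<and>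
     (\<forall>i. i \<prec> l \<longleftrightarrow> (\<exists>y. pr i y \<epsilon> s))"
  unfolding seq_of_lengthM_def canon_def ..

lemma bin_seq_seq: "seq_of_lengthM M (bin_seq d l) l"
  unfolding seq_of_lengthM_canon bin_seq_mem by (auto simp: bin_seq_canon bin_seq_mem')

lemma seq_length_unique: "seq_of_lengthM M s l \<Longrightarrow> seq_of_lengthM M s l' \<Longrightarrow> l = l'"
  unfolding seq_of_lengthM_canon by (metis N.linorder_cases N.less_irrefl)

lemma bin_seq_eqI:
  assumes "seq_of_lengthM M s l" "\<And>i y. pr i y \<epsilon> s \<Longrightarrow> y = \<zero> \<or> y = \<one>"
    "\<And>i. i \<prec> l \<Longrightarrow> i \<epsilon> d \<longleftrightarrow> pr i \<one> \<epsilon> s"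
  shows "s = bin_seq d l"
proof (rule canon_eq)
  show "canon s" using assms(1) by (simp add: seq_of_lengthM_canon)
  fix p
  have s: "(\<exists>i y. p = pr i y)" if "p \<epsilon> s" using assms(1) that by (simp add: seq_of_lengthM_canon)
  have u: "y = z" if "pr i y \<epsilon> s" "pr i z \<epsilon> s" for i y z
    using assms(1) that by (auto simp: seq_of_lengthM_canon)
  have l: "i \<prec> l \<longleftrightarrow> (\<exists>y. pr i y \<epsilon> s)" for i using assms(1) by (auto simp: seq_of_lengthM_canon)
  show "p \<epsilon> s \<longleftrightarrow> p \<epsilon> bin_seq d l"
  proof
    assume "p \<epsilon> s"
    then obtain i y where p: "p = pr i y" "pr i y \<epsilon> s" using s by auto
    then have "i \<prec> l" using l by blast
    then show "p \<epsilon> bin_seq d l"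
      using assms(2)[of i y] assms(3)[of i] p u[of i y \<one>] by (auto simp: bin_seq_mem)
  next
    assume "p \<epsilon> bin_seq d l"
    then obtain i where i: "i \<prec> l" "i \<epsilon> d \<and> p = pr i \<one> \<or> \<not> i \<epsilon> d \<and> p = pr i \<zero>"
      by (auto simp: bin_seq_mem')
    then obtain y where "pr i y \<epsilon> s" using l by blast
    then show "p \<epsilon> s" using assms(2)[of i y] assms(3)[of i] i by auto
  qed
qed (rule bin_seq_canon)

lemma bin_seq_cong: "(\<And>i. i \<prec> l \<Longrightarrow> i \<epsilon> d \<longleftrightarrow> i \<epsilon> d') \<Longrightarrow> bin_seq d l = bin_seq d' l"
  by (rule bin_seq_eqI[OF bin_seq_seq]) (auto simp: bin_seq_mem)

text \<open>For positive l the code exceeds the pair holding the last entry, hence the last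
  position. This lets the length be bounded by the code when a tree of sequences is defined.\<close>

lemma le_bin_seq: "l \<preceq> bin_seq d l"
  using zero_or_suc[of l]
proof
  assume "\<exists>k. l = k \<oplus> \<one>"
  then obtain k where k: "l = k \<oplus> \<one>" ..
  then have "\<exists>y. pr k y \<epsilon> bin_seq d l" by (auto simp: bin_seq_mem less_suc)
  then obtain y where "pr k y \<prec> bin_seq d l" using fin_mem_less by blast
  then have "k \<prec> bin_seq d l" using fst_le_pr by (metis N.le_less_trans)
  then show ?thesis by (auto simp: k less_iff_add le_iff_add' add_acs)
qed simp

section \<open>Weak Koenig's Lemma for trees of finite sets\<close>

definition wkl :: bool where
  "wkl \<longleftrightarrow> (\<forall>T\<in>Sets M. binary_treeM M T \<and> (\<forall>b. \<exists>s. b \<prec> s \<and> s \<in> T) \<longrightarrow>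
      (\<exists>G\<in>Sets M. fun_onM M G UNIV \<and>
         (\<forall>l. \<exists>s\<in>T. seq_of_lengthM M s l \<and> (\<forall>i y. pr i y \<epsilon> s \<longrightarrow> pr i y \<in> G))))"

text \<open>A node is a number d, read as a finite set, together with a length l; only the elements
  of d below l count, so many d represent the same node. The second clause combines this invariance
  with closure under initial segments, and the third replaces infinity by a node at every
  level.\<close>

definition tree :: "('a \<Rightarrow> 'a \<Rightarrow> bool) \<Rightarrow> bool" where
  "tree T \<longleftrightarrow> R1 (\<lambda>e. T (e 1) (e 0)) \<and>
     (\<forall>d l d' l'. T d l \<longrightarrow> l' \<preceq> l \<longrightarrow> (\<forall>i. i \<prec> l' \<longrightarrow> (i \<epsilon> d \<longleftrightarrow> i \<epsilon> d')) \<longrightarrow> T d' l') \<and>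
     (\<forall>l. \<exists>d. T d l)"

definition wkl_sets :: bool where
  "wkl_sets \<longleftrightarrow> (\<forall>T. tree T \<longrightarrow>
     (\<exists>X\<in>Sets M. \<forall>d l. (\<forall>i. i \<prec> l \<longrightarrow> (i \<epsilon> d \<longleftrightarrow> i \<in> X)) \<longrightarrow> T d l))"

lemma treeD:
  assumes "tree T"
  shows tree_R1: "F1 f \<Longrightarrow> F1 g \<Longrightarrow> R1 (\<lambda>e. T (f e) (g e))"
    and tree_down: "T d l \<Longrightarrow> l' \<preceq> l \<Longrightarrow> (\<And>i. i \<prec> l' \<Longrightarrow> i \<epsilon> d \<longleftrightarrow> i \<epsilon> d') \<Longrightarrow> T d' l'"
    and tree_ex: "\<exists>d. T d l"
proof -
  show "F1 f \<Longrightarrow> F1 g \<Longrightarrow> R1 (\<lambda>e. T (f e) (g e))"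
    by (rule R1_comp2) (use assms in \<open>simp_all add: tree_def\<close>)
  show "T d l \<Longrightarrow> l' \<preceq> l \<Longrightarrow> (\<And>i. i \<prec> l' \<Longrightarrow> i \<epsilon> d \<longleftrightarrow> i \<epsilon> d') \<Longrightarrow> T d' l'" "\<exists>d. T d l"
    using assms unfolding tree_def by blast+
qed

lemma ones_bin_seq: "i \<prec> l \<Longrightarrow> i \<epsilon> ones (bin_seq d l) \<longleftrightarrow> i \<epsilon> d"
  by (simp add: ones_mem bin_seq_mem)

lemma bin_seq_ones:
  assumes "seq_of_lengthM M s l" "\<And>i y. pr i y \<epsilon> s \<Longrightarrow> y = \<zero> \<or> y = \<one>"
  shows "s = bin_seq (ones s) l"
  by (rule bin_seq_eqI[OF assms]) (simp_all add: ones_mem)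

lemma zero_neq_one [simp]: "\<zero> \<noteq> \<one>"
  using N.zero_neq_one .

text \<open>Nodes are turned into sequence codes by \<open>bin_seq\<close>. A path function G then
  yields the set of places where it takes the value 1.\<close>

lemma wkl_imp_wkl_sets: assumes wkl shows wkl_sets
  unfolding wkl_sets_def
proof (intro allI impI)
  fix T assume T: "tree T"
  \<comment> \<open>Recovering the node as \<open>ones s\<close> and bounding its length by s gives
    a Delta-1 description; \<open>iff\<close> below shows it equivalent to the one with arbitrary d
    and l.\<close>
  let ?T = "{s. \<exists>l. l \<preceq> s \<and> s = bin_seq (ones s) l \<and> T (ones s) l}"
  have set: "?T \<in> Sets M"
    by (rule R1_comprehension) (intro R1_intros F1_bin_seq F1_ones tree_R1[OF T])
  have iff: "s \<in> ?T \<longleftrightarrow> (\<exists>d l. s = bin_seq d l \<and> T d l)" for s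
  proof
    assume "\<exists>d l. s = bin_seq d l \<and> T d l"
    then obtain d l where s: "s = bin_seq d l" "T d l" by blast
    have "s = bin_seq (ones s) l" unfolding s(1) by (rule bin_seq_cong) (simp add: ones_bin_seq)
    moreover have "T (ones s) l"
      by (rule tree_down[OF T s(2)]) (simp_all add: s(1) ones_bin_seq)
    ultimately show "s \<in> ?T" using le_bin_seq[of l d] s(1) by blast
  qed blast
  have "binary_treeM M ?T"
    unfolding binary_treeM_def
  proof (intro conjI ballI allI impI)
    fix s assume "s \<in> ?T"
    then obtain d l where s: "s = bin_seq d l" unfolding iff by blast
    show "\<exists>l. seq_of_lengthM M s l" unfolding s using bin_seq_seq by blast
    fix i y assume "pr i y \<epsilon> s"
    then show "y = \<zero> \<or> y = \<one>" by (auto simp: s bin_seq_mem)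
  next
    fix s t assume "s \<in> ?T \<and> (\<exists>l. seq_of_lengthM M t l) \<and> (\<forall>p. p \<epsilon> t \<longrightarrow> p \<epsilon> s)"
    then obtain d l k where s: "s = bin_seq d l" "T d l" and t: "seq_of_lengthM M t k"
      and sub: "\<And>p. p \<epsilon> t \<Longrightarrow> p \<epsilon> s" unfolding iff by blast
    have k: "i \<prec> k \<longleftrightarrow> (\<exists>y. pr i y \<epsilon> t)" for i using t by (auto simp: seq_of_lengthM_canon)
    have kl: "i \<prec> l" if ik: "i \<prec> k" for i
    proof -
      obtain y where "pr i y \<epsilon> t" using ik k[of i] by auto
      then have "pr i y \<epsilon> bin_seq d l" using sub[of "pr i y"] s(1) by simp
      then show ?thesis by (simp add: bin_seq_mem)
    qed
    have "k \<preceq> l" using kl[of l] by (metis N.less_irrefl N.not_less)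
    moreover have "t = bin_seq d k"
    proof (rule bin_seq_eqI[OF t])
      fix i y assume "pr i y \<epsilon> t"
      then show "y = \<zero> \<or> y = \<one>" using sub[of "pr i y"] by (auto simp: s bin_seq_mem)
    next
      fix i assume "i \<prec> k"
      then obtain y where y: "pr i y \<epsilon> t" using k[of i] by auto
      then have "i \<epsilon> d \<and> y = \<one> \<or> \<not> i \<epsilon> d \<and> y = \<zero>" using sub[OF y] by (simp add: s bin_seq_mem)
      moreover have "pr i \<one> \<epsilon> t \<Longrightarrow> i \<epsilon> d" using sub[of "pr i \<one>"] by (auto simp: s bin_seq_mem)
      ultimately show "i \<epsilon> d \<longleftrightarrow> pr i \<one> \<epsilon> t" using y by auto
    qed
    moreover have "T d k" by (rule tree_down[OF T s(2) \<open>k \<preceq> l\<close>]) simp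
    ultimately show "t \<in> ?T" unfolding iff by blast
  qed
  moreover have "\<exists>s. b \<prec> s \<and> s \<in> ?T" for b
  proof -
    obtain d where d: "T d (b \<oplus> \<one>)" using tree_ex[OF T] by blast
    have "\<exists>y. pr b y \<epsilon> bin_seq d (b \<oplus> \<one>)" by (auto simp: bin_seq_mem less_suc)
    then obtain y where "pr b y \<prec> bin_seq d (b \<oplus> \<one>)" using fin_mem_less by blast
    then have "b \<prec> bin_seq d (b \<oplus> \<one>)" using fst_le_pr by (metis N.le_less_trans)
    then show ?thesis unfolding iff using d by blast
  qed
  ultimately obtain G where G: "G \<in> Sets M" "fun_onM M G UNIV"
    "\<And>l. \<exists>s\<in>?T. seq_of_lengthM M s l \<and> (\<forall>i y. pr i y \<epsilon> s \<longrightarrow> pr i y \<in> G)"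
    using assms[unfolded wkl_def, rule_format, OF set] by blast
  let ?X = "{i. pr i \<one> \<in> G}"
  show "\<exists>X\<in>Sets M. \<forall>d l. (\<forall>i. i \<prec> l \<longrightarrow> (i \<epsilon> d \<longleftrightarrow> i \<in> X)) \<longrightarrow> T d l"
  proof (intro bexI[of _ ?X] allI impI)
    show "?X \<in> Sets M" by (rule R1_comprehension) (intro R1_intros G)
    fix d l assume d: "\<forall>i. i \<prec> l \<longrightarrow> (i \<epsilon> d \<longleftrightarrow> i \<in> ?X)"
    obtain s where "s \<in> ?T" and s: "seq_of_lengthM M s l" "\<And>i y. pr i y \<epsilon> s \<Longrightarrow> pr i y \<in> G"
      using G(3)[of l] by blast
    then obtain c k where "s = bin_seq c k" "T c k" unfolding iff by blast
    moreover then have "k = l" using s(1) bin_seq_seq seq_length_unique by blast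
    ultimately have c: "s = bin_seq c l" "T c l" by simp_all
    show "T d l"
    proof (rule tree_down[OF T c(2)])
      fix i assume i: "i \<prec> l"
      have u: "pr i \<zero> \<in> G \<Longrightarrow> pr i \<one> \<in> G \<Longrightarrow> False"
        using G(2) zero_neq_one unfolding fun_onM_def by blast
      show "i \<epsilon> c \<longleftrightarrow> i \<epsilon> d"
      proof (cases "i \<epsilon> c")
        case True
        then have "pr i \<one> \<in> G" using i by (intro s(2)) (simp add: c bin_seq_mem)
        then show ?thesis using True d i by simp
      next
        case False
        then have "pr i \<zero> \<in> G" using i by (intro s(2)) (simp add: c bin_seq_mem)
        then show ?thesis using False d i u by auto
      qed
    qed simp
  qed
qed

text \<open>Infinity of T only says that its codes are unbounded. As the 0-1 sequences of length at
  most l have bounded codes, a large enough code in T belongs to a longer sequence, which can be cut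
  down to length l.\<close>

lemma wkl_sets_imp_wkl: assumes wkl_sets shows wkl
  unfolding wkl_def
proof (intro ballI impI)
  fix T assume set: "T \<in> Sets M"
    and "binary_treeM M T \<and> (\<forall>b. \<exists>s. b \<prec> s \<and> s \<in> T)"
  then have bt: "binary_treeM M T" and inf: "\<And>b. \<exists>s. b \<prec> s \<and> s \<in> T" by blast+
  have sub: "bin_seq c k \<in> T" if "bin_seq d l \<in> T" "k \<preceq> l" "\<And>i. i \<prec> k \<Longrightarrow> i \<epsilon> d \<longleftrightarrow> i \<epsilon> c" for c d k l
  proof -
    have "p \<epsilon> bin_seq d l" if "p \<epsilon> bin_seq c k" for p
      using that \<open>\<And>i. i \<prec> k \<Longrightarrow> i \<epsilon> d \<longleftrightarrow> i \<epsilon> c\<close> \<open>k \<preceq> l\<close>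
      unfolding bin_seq_mem' by (metis N.less_le_trans)
    then show ?thesis using bt \<open>bin_seq d l \<in> T\<close> bin_seq_seq unfolding binary_treeM_def by blast
  qed
  have "tree (\<lambda>d l. bin_seq d l \<in> T)"
    unfolding tree_def
  proof (intro conjI allI impI)
    show "R1 (\<lambda>e. bin_seq (e 1) (e 0) \<in> T)" by (intro R1_intros F1_bin_seq set)
    show "bin_seq c k \<in> T" if "bin_seq d l \<in> T" "k \<preceq> l" "\<forall>i. i \<prec> k \<longrightarrow> (i \<epsilon> d \<longleftrightarrow> i \<epsilon> c)" for c d k l
      using sub that by blast
    fix l
    obtain s where s: "code_bound (pr l \<one> \<oplus> \<one>) \<prec> s" "s \<in> T" using inf by blast
    then obtain k where k: "seq_of_lengthM M s k" using bt unfolding binary_treeM_def by blast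
    have 01: "y = \<zero> \<or> y = \<one>" if "pr i y \<epsilon> s" for i y
      using that s(2) bt unfolding binary_treeM_def by blast
    have "l \<preceq> k"
    proof (rule ccontr)
      assume "\<not> l \<preceq> k"
      then have kl: "k \<preceq> l" using le_total by blast
      have "p \<prec> pr l \<one> \<oplus> \<one>" if "p \<epsilon> s" for p
      proof -
        obtain i y where p: "p = pr i y" using k \<open>p \<epsilon> s\<close> by (auto simp: seq_of_lengthM_canon)
        then have "i \<prec> k" using k \<open>p \<epsilon> s\<close> by (auto simp: seq_of_lengthM_canon)
        then have "i \<preceq> l" using kl by (metis N.less_imp_le N.order_trans)
        moreover have "y \<preceq> \<one>" using 01[of i y] p \<open>p \<epsilon> s\<close> by auto
        ultimately show ?thesis unfolding less_add_one[symmetric] p by (rule pr_mono)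
      qed
      then have "s \<preceq> code_bound (pr l \<one> \<oplus> \<one>)"
        using k by (intro canon_le_code_bound) (auto simp: seq_of_lengthM_canon)
      then show False using s(1) by (metis N.not_less)
    qed
    moreover have "s = bin_seq (ones s) k" by (rule bin_seq_ones[OF k 01])
    ultimately show "\<exists>d. bin_seq d l \<in> T" using s(2) sub[of "ones s" k l "ones s"] by auto
  qed
  then obtain X where X: "X \<in> Sets M" "\<And>d l. (\<And>i. i \<prec> l \<Longrightarrow> i \<epsilon> d \<longleftrightarrow> i \<in> X) \<Longrightarrow> bin_seq d l \<in> T"
    using assms unfolding wkl_sets_def by blast
  let ?G = "{p. \<exists>i. i \<preceq> p \<and> (i \<in> X \<and> p = pr i \<one> \<or> \<not> i \<in> X \<and> p = pr i \<zero>)}"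
  have G: "pr i y \<in> ?G \<longleftrightarrow> i \<in> X \<and> y = \<one> \<or> i \<notin> X \<and> y = \<zero>" for i y
    using fst_le_pr by auto
  show "\<exists>G\<in>Sets M. fun_onM M G UNIV \<and>
    (\<forall>l. \<exists>s\<in>T. seq_of_lengthM M s l \<and> (\<forall>i y. pr i y \<epsilon> s \<longrightarrow> pr i y \<in> G))"
  proof (intro bexI[of _ ?G] conjI allI)
    show "?G \<in> Sets M" by (rule R1_comprehension) (intro R1_intros X)
    have "\<exists>x y. x \<in> UNIV \<and> p = pr x y" if "p \<in> ?G" for p using that by blast
    then show "fun_onM M ?G UNIV" unfolding fun_onM_def G by blast
    fix l
    have "R1 (\<lambda>e. e 0 \<in> X)" by (intro R1_intros X)
    then obtain d where d: "\<And>i. i \<epsilon> d \<longleftrightarrow> i \<prec> l \<and> i \<in> X"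
      using S1_code_ex[OF S1_R1, of "\<lambda>i. i \<in> X" l] by blast
    have "bin_seq d l \<in> T" using d by (intro X(2)) simp
    moreover have "pr i y \<in> ?G" if "pr i y \<epsilon> bin_seq d l" for i y
      using that unfolding G bin_seq_mem d by blast
    ultimately show "\<exists>s\<in>T. seq_of_lengthM M s l \<and> (\<forall>i y. pr i y \<epsilon> s \<longrightarrow> pr i y \<in> ?G)"
      using bin_seq_seq by blast
  qed
qed

section \<open>Bounds and weight functions\<close>

definition has_bound :: "'a set \<Rightarrow> 'a set \<Rightarrow> bool" where
  "has_bound S R \<longleftrightarrow> (\<exists>F\<in>Sets M. fun_onM M F S \<and>
     (\<forall>s l a b. decreasing_seqM M s l R S \<and> pr \<zero> a \<epsilon> s \<and> pr a b \<in> F \<longrightarrow> l \<prec> b \<or> l = b))"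

definition has_weight :: "'a set \<Rightarrow> 'a set \<Rightarrow> bool" where
  "has_weight S R \<longleftrightarrow> (\<exists>F\<in>Sets M. fun_onM M F S \<and>
     (\<forall>x y u v. pr x y \<in> R \<and> pr x u \<in> F \<and> pr y v \<in> F \<longrightarrow> u \<prec> v))"

lemma suc_le_iff: "a \<oplus> \<one> \<preceq> b \<longleftrightarrow> a \<prec> b"
  unfolding less_iff_add le_iff_add' by (auto simp: add_acs)

lemma pr_less: "pr x y \<prec> l \<Longrightarrow> x \<prec> l" "pr x y \<prec> l \<Longrightarrow> y \<prec> l"
  using fst_le_pr snd_le_pr by (metis N.le_less_trans)+

lemma fun_on_ex: "fun_onM M F S \<Longrightarrow> x \<in> S \<Longrightarrow> \<exists>y. pr x y \<in> F"
  and fun_on_dom: "fun_onM M F S \<Longrightarrow> pr x y \<in> F \<Longrightarrow> x \<in> S"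
  and fun_on_unique: "fun_onM M F S \<Longrightarrow> pr x y \<in> F \<Longrightarrow> pr x z \<in> F \<Longrightarrow> y = z"
  unfolding fun_onM_def by (blast, fastforce, blast)

lemma dec_seq: "decreasing_seqM M s l R S \<Longrightarrow> i \<prec> l \<longleftrightarrow> (\<exists>x. pr i x \<epsilon> s)"
  and dec_unique: "decreasing_seqM M s l R S \<Longrightarrow> pr i x \<epsilon> s \<Longrightarrow> pr i y \<epsilon> s \<Longrightarrow> x = y"
  and dec_in: "decreasing_seqM M s l R S \<Longrightarrow> pr i x \<epsilon> s \<Longrightarrow> x \<in> S"
  and dec_step: "decreasing_seqM M s l R S \<Longrightarrow> pr i x \<epsilon> s \<Longrightarrow> pr (i \<oplus> \<one>) y \<epsilon> s \<Longrightarrow> pr y x \<in> R"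
  and dec_canon: "decreasing_seqM M s l R S \<Longrightarrow> canon s"
  and dec_pair: "decreasing_seqM M s l R S \<Longrightarrow> p \<epsilon> s \<Longrightarrow> \<exists>i x. p = pr i x"
  unfolding decreasing_seqM_def seq_of_lengthM_canon by blast+

lemma decI:
  assumes "canon s" "\<And>p. p \<epsilon> s \<Longrightarrow> \<exists>i x. p = pr i x"
    "\<And>i x y. pr i x \<epsilon> s \<Longrightarrow> pr i y \<epsilon> s \<Longrightarrow> x = y"
    "\<And>i. i \<prec> l \<longleftrightarrow> (\<exists>x. pr i x \<epsilon> s)"
    "\<And>i x. pr i x \<epsilon> s \<Longrightarrow> x \<in> S"
    "\<And>i x y. pr i x \<epsilon> s \<Longrightarrow> pr (i \<oplus> \<one>) y \<epsilon> s \<Longrightarrow> pr y x \<in> R"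
  shows "decreasing_seqM M s l R S"
  unfolding decreasing_seqM_def seq_of_lengthM_canon
  by (intro conjI allI impI; (elim conjE)?) (fact assms)+

section \<open>From a weight function to a bound\<close>

lemma weight_imp_bound:
  assumes "has_weight S R" shows "has_bound S R"
proof -
  obtain F where F: "F \<in> Sets M" and f: "fun_onM M F S"
    and w: "\<And>x y u v. pr x y \<in> R \<Longrightarrow> pr x u \<in> F \<Longrightarrow> pr y v \<in> F \<Longrightarrow> u \<prec> v"
    using assms unfolding has_weight_def by blast
  \<comment> \<open>The successor is needed because an element of weight 0 still starts a decreasing
    sequence of length 1.\<close>
  let ?G = "{p. \<exists>x. x \<preceq> p \<and> (\<exists>y. y \<preceq> p \<and> p = pr x (y \<oplus> \<one>) \<and> pr x y \<in> F)}"
  have "y \<preceq> y \<oplus> \<one>" for y unfolding less_add_one[symmetric] by (simp add: leM_def less_suc)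
  then have "y \<preceq> pr x (y \<oplus> \<one>)" for x y using snd_le_pr by (metis N.order_trans)
  then have G: "pr x z \<in> ?G \<longleftrightarrow> (\<exists>y. z = y \<oplus> \<one> \<and> pr x y \<in> F)" for x z
    using fst_le_pr by auto
  show ?thesis
    unfolding has_bound_def
  proof (intro bexI[of _ ?G] conjI allI impI)
    show "?G \<in> Sets M" by (rule R1_comprehension) (intro R1_intros F)
    have "\<exists>x y. x \<in> S \<and> p = pr x y" if "p \<in> ?G" for p using that fun_on_dom[OF f] by blast
    then show "fun_onM M ?G S"
      using f unfolding fun_onM_def G by blast
    fix s l a b
    assume *: "decreasing_seqM M s l R S \<and> pr \<zero> a \<epsilon> s \<and> pr a b \<in> ?G"
    then obtain y where y: "b = y \<oplus> \<one>" "pr a y \<in> F" unfolding G by blast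
    note dec = conjunct1[OF *]
    \<comment> \<open>Each step lowers the weight by at least one, so the weight u of entry i
      satisfies u + i at most y. An entry at position b = y + 1 would contradict this.\<close>
    have claim: "\<not> i \<prec> l \<or> (\<exists>x u. pr i x \<epsilon> s \<and> pr x u \<in> F \<and> u \<oplus> i \<preceq> y)" for i
    proof (rule S1_induct[where a = i])
      show "S1 (\<lambda>e. \<not> e 0 \<prec> l \<or> (\<exists>x u. pr (e 0) x \<epsilon> s \<and> pr x u \<in> F \<and> u \<oplus> e 0 \<preceq> y))"
        by (intro S1_disj S1_ex S1_R1 R1_intros R1_fin_mem F)
      have "pr \<zero> a \<epsilon> s \<and> pr a y \<in> F \<and> y \<oplus> \<zero> \<preceq> y" using * y by simp
      then show "\<not> \<zero> \<prec> l \<or> (\<exists>x u. pr \<zero> x \<epsilon> s \<and> pr x u \<in> F \<and> u \<oplus> \<zero> \<preceq> y)" by blast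
      fix i assume IH: "\<not> i \<prec> l \<or> (\<exists>x u. pr i x \<epsilon> s \<and> pr x u \<in> F \<and> u \<oplus> i \<preceq> y)"
      show "\<not> i \<oplus> \<one> \<prec> l \<or> (\<exists>x u. pr (i \<oplus> \<one>) x \<epsilon> s \<and> pr x u \<in> F \<and> u \<oplus> (i \<oplus> \<one>) \<preceq> y)"
      proof (cases "i \<oplus> \<one> \<prec> l")
        case True
        have "i \<prec> i \<oplus> \<one>" by (simp add: less_suc)
        then have "i \<prec> l" using True by (rule N.less_trans)
        then obtain x u where x: "pr i x \<epsilon> s" "pr x u \<in> F" "u \<oplus> i \<preceq> y" using IH by blast
        obtain x' where x': "pr (i \<oplus> \<one>) x' \<epsilon> s" using dec_seq[OF dec, of "i \<oplus> \<one>"] True by blast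
        obtain u' where u': "pr x' u' \<in> F" using fun_on_ex[OF f dec_in[OF dec x']] by blast
        have "u' \<prec> u" using w[OF dec_step[OF dec x(1) x'] u' x(2)] .
        then have "u' \<oplus> \<one> \<preceq> u" by (simp add: suc_le_iff)
        then have "(u' \<oplus> \<one>) \<oplus> i \<preceq> u \<oplus> i" by (rule N.add_right_mono)
        moreover have "u' \<oplus> (i \<oplus> \<one>) = (u' \<oplus> \<one>) \<oplus> i" by (simp only: add_acs)
        ultimately have "u' \<oplus> (i \<oplus> \<one>) \<preceq> y" using N.order_trans[OF _ x(3)] by simp
        then show ?thesis using x' u' by blast
      qed simp
    qed
    show "l \<prec> b \<or> l = b"
    proof (rule ccontr)
      assume "\<not> (l \<prec> b \<or> l = b)"
      then have "b \<prec> l" by (metis N.linorder_cases)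
      then obtain u where "u \<oplus> b \<preceq> y" using claim[of b] by blast
      then have "b \<preceq> y" by (metis N.add_increasing N.order_trans zero_le N.order_refl)
      then show False unfolding y suc_le_iff by simp
    qed
  qed
qed

section \<open>From a bound to a weight function\<close>

lemma canon_bounded: "canon s \<longleftrightarrow> (\<forall>d. d \<prec> s \<longrightarrow> \<not> (\<forall>x. x \<prec> s \<longrightarrow> (x \<epsilon> d \<longleftrightarrow> x \<epsilon> s)))"
  unfolding canon_def using fin_mem_less by (meson N.less_trans)

text \<open>Positions and entries of a coded sequence are smaller than its code, so all quantifiers
  can be bounded. This makes being a decreasing sequence Delta-1.\<close>

lemma dec_bounded: "decreasing_seqM M s l R S \<longleftrightarrow>
    (\<forall>d. d \<prec> s \<longrightarrow> \<not> (\<forall>x. x \<prec> s \<longrightarrow> (x \<epsilon> d \<longleftrightarrow> x \<epsilon> s))) \<and>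
    (\<forall>p. p \<prec> s \<longrightarrow> p \<epsilon> s \<longrightarrow> (\<exists>i. i \<prec> s \<and> (\<exists>y. y \<prec> s \<and> p = pr i y))) \<and>
    (\<forall>i. i \<prec> l \<longrightarrow> (\<exists>y. y \<prec> s \<and> pr i y \<epsilon> s)) \<and>
    (\<forall>i. i \<prec> s \<longrightarrow> (\<forall>x. x \<prec> s \<longrightarrow> pr i x \<epsilon> s \<longrightarrow> i \<prec> l \<and> x \<in> S \<and>
      (\<forall>y. y \<prec> s \<longrightarrow> (pr i y \<epsilon> s \<longrightarrow> x = y) \<and> (pr (i \<oplus> \<one>) y \<epsilon> s \<longrightarrow> pr y x \<in> R))))"
  (is "_ \<longleftrightarrow> ?C \<and> ?P \<and> ?L \<and> ?Q")
proof -
  have b: "i \<prec> s" "x \<prec> s" if "pr i x \<epsilon> s" for i x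
    using fin_mem_less[OF that] pr_less by blast+
  show ?thesis
  proof
    assume dec: "decreasing_seqM M s l R S"
    have ?C using dec_canon[OF dec] unfolding canon_bounded .
    moreover have ?P using dec_pair[OF dec] b by blast
    moreover have ?L using dec_seq[OF dec] b by blast
    moreover have ?Q using dec_seq[OF dec] dec_unique[OF dec] dec_in[OF dec] dec_step[OF dec] by blast
    ultimately show "?C \<and> ?P \<and> ?L \<and> ?Q" by blast
  next
    assume *: "?C \<and> ?P \<and> ?L \<and> ?Q"
    show "decreasing_seqM M s l R S"
    proof (rule decI)
      have q: "i \<prec> l" "x \<in> S"
        "y \<prec> s \<Longrightarrow> pr i y \<epsilon> s \<Longrightarrow> x = y" "y \<prec> s \<Longrightarrow> pr (i \<oplus> \<one>) y \<epsilon> s \<Longrightarrow> pr y x \<in> R"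
        if "pr i x \<epsilon> s" for i x y
        using * b[OF that] that by simp_all
      show "canon s" using * unfolding canon_bounded by blast
      show "\<exists>i x. p = pr i x" if "p \<epsilon> s" for p using * fin_mem_less[OF that] that by blast
      show "x = y" if "pr i x \<epsilon> s" "pr i y \<epsilon> s" for i x y
        using q(3)[OF that(1) b(2)[OF that(2)] that(2)] .
      have "\<exists>x. pr i x \<epsilon> s" if "i \<prec> l" for i using * that by blast
      then show "i \<prec> l \<longleftrightarrow> (\<exists>x. pr i x \<epsilon> s)" for i using q(1)[of i] by auto
      show "x \<in> S" if "pr i x \<epsilon> s" for i x using q(2)[OF that] .
      show "pr y x \<in> R" if "pr i x \<epsilon> s" "pr (i \<oplus> \<one>) y \<epsilon> s" for i x y
        using q(4)[OF that(1) b(2)[OF that(2)] that(2)] .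
    qed
  qed
qed

lemma R1_dec:
  assumes "S \<in> Sets M" "R \<in> Sets M" "F1 f" "F1 g"
  shows "R1 (\<lambda>e. decreasing_seqM M (f e) (g e) R S)"
  by (rule R1_comp2[OF _ assms(3,4)]) (unfold dec_bounded, intro R1_intros R1_fin_mem assms(1,2))

lemma dec_Nil: "decreasing_seqM M (fcode \<zero> (\<lambda>_. False)) \<zero> R S"
proof -
  have R: "R1 (\<lambda>e. False)" using R1_less[OF F1_const F1_const, of \<zero> \<zero>] by simp
  have "\<not> p \<epsilon> fcode \<zero> (\<lambda>_. False)" for p using fcode_mem[of "\<lambda>_. False", OF R] by simp
  then show ?thesis using fcode_canon[of "\<lambda>_. False", OF R] by (intro decI) (auto simp: not_less_zero)
qed

lemma dec_Cons:
  assumes dec: "decreasing_seqM M s k R S" and "y \<in> S" and R: "\<And>x. pr \<zero> x \<epsilon> s \<Longrightarrow> pr x y \<in> R"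
  shows "\<exists>t. decreasing_seqM M t (k \<oplus> \<one>) R S \<and> pr \<zero> y \<epsilon> t"
proof -
  \<comment> \<open>The old positions move up by one to make room for y; i and z are bounded by p to
    keep the predicate Delta-1.\<close>
  let ?P = "\<lambda>p. p = pr \<zero> y \<or> (\<exists>i. i \<preceq> p \<and> (\<exists>z. z \<preceq> p \<and> p = pr (i \<oplus> \<one>) z \<and> pr i z \<epsilon> s))"
  \<comment> \<open>Exceeds every pair of the new sequence: i < s and z < s put (i + 1, z) at or
    below (s, s).\<close>
  define b where "b = pr s s \<oplus> pr \<zero> y \<oplus> \<one>"
  define t where "t = fcode b ?P"
  have P: "R1 (\<lambda>e. ?P (e 0))" by (intro R1_intros R1_fin_mem)
  have 1: "pr (i \<oplus> \<one>) z \<prec> b" if "pr i z \<epsilon> s" for i z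
  proof -
    have "i \<prec> s" "z \<prec> s" using fin_mem_less[OF that] pr_less by blast+
    then have "pr (i \<oplus> \<one>) z \<preceq> pr s s"
      by (intro pr_mono) (simp_all only: suc_le_iff N.less_imp_le)
    also have "\<dots> \<preceq> pr s s \<oplus> pr \<zero> y" by (auto simp: le_iff_add')
    finally show ?thesis unfolding b_def less_add_one .
  qed
  have 2: "pr \<zero> y \<prec> b"
    unfolding b_def less_add_one[symmetric] le_iff_add' by (metis N.add.commute)
  have "i \<preceq> pr (i \<oplus> \<one>) z" for i z
    using fst_le_pr[of "i \<oplus> \<one>" z] by (metis suc_le_iff leM_def)
  then have mem: "p \<epsilon> t \<longleftrightarrow> p = pr \<zero> y \<or> (\<exists>i z. p = pr (i \<oplus> \<one>) z \<and> pr i z \<epsilon> s)" for p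
    unfolding t_def fcode_mem[of ?P, OF P] using 1 2 snd_le_pr by auto
  have mem0: "pr \<zero> z \<epsilon> t \<longleftrightarrow> z = y" and memS: "pr (i \<oplus> \<one>) z \<epsilon> t \<longleftrightarrow> pr i z \<epsilon> s" for i z
    using suc_neq_0[symmetric] by (auto simp: mem add_cancel suc_neq_0)
  have mem1: "pr \<one> z \<epsilon> t \<longleftrightarrow> pr \<zero> z \<epsilon> s" for z
    using memS[of \<zero> z] by simp
  have "decreasing_seqM M t (k \<oplus> \<one>) R S"
  proof (rule decI)
    show "canon t" unfolding t_def by (rule fcode_canon[of ?P, OF P])
    show "\<exists>i x. p = pr i x" if "p \<epsilon> t" for p using that mem by blast
    fix i
    consider "i = \<zero>" | j where "i = j \<oplus> \<one>" using zero_or_suc[of i] by blast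
    note cases = this
    show "x = z" if "pr i x \<epsilon> t" "pr i z \<epsilon> t" for x z
      using cases that by cases (auto simp: mem0 memS dest: dec_unique[OF dec])
    show "i \<prec> k \<oplus> \<one> \<longleftrightarrow> (\<exists>x. pr i x \<epsilon> t)"
      using cases
    proof cases
      case 2
      then show ?thesis using dec_seq[OF dec, of j] by (simp add: memS)
    qed (simp add: mem0)
    show "x \<in> S" if "pr i x \<epsilon> t" for x
      using cases that by cases (auto simp: mem0 memS \<open>y \<in> S\<close> dest: dec_in[OF dec])
    show "pr z x \<in> R" if "pr i x \<epsilon> t" "pr (i \<oplus> \<one>) z \<epsilon> t" for x z
      using cases that by cases (auto simp: mem0 mem1 memS intro: R dec_step[OF dec])
  qed
  then show ?thesis using mem0 by blast
qed

text \<open>Membership of (x,j) asserts that the weight of x is at least j. Every clause mentions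
  only pairs with code below l, which makes the condition hereditary under shortening; closure
  downwards in j is not demanded.\<close>

definition partial_weight :: "'a set \<Rightarrow> 'a set \<Rightarrow> 'a set \<Rightarrow> 'a \<Rightarrow> 'a \<Rightarrow> bool" where
  "partial_weight S R H d l \<longleftrightarrow>
     (\<forall>x y b. pr x y \<prec> l \<longrightarrow> pr x y \<epsilon> d \<longrightarrow> pr x b \<in> H \<longrightarrow> \<not> b \<preceq> y) \<and>
     (\<forall>x. x \<in> S \<longrightarrow> pr x \<zero> \<prec> l \<longrightarrow> pr x \<zero> \<epsilon> d) \<and>
     (\<forall>x y j. pr x y \<in> R \<longrightarrow> pr x j \<prec> l \<longrightarrow> pr x j \<epsilon> d \<longrightarrow> pr y (j \<oplus> \<one>) \<prec> l \<longrightarrow> pr y (j \<oplus> \<one>) \<epsilon> d)"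

lemma partial_weight_bounded: "partial_weight S R H d l \<longleftrightarrow>
     (\<forall>x. x \<prec> l \<longrightarrow> (\<forall>y. y \<prec> l \<longrightarrow> (\<forall>b. b \<preceq> y \<longrightarrow>
        pr x y \<prec> l \<longrightarrow> pr x y \<epsilon> d \<longrightarrow> \<not> pr x b \<in> H))) \<and>
     (\<forall>x. x \<prec> l \<longrightarrow> x \<in> S \<longrightarrow> pr x \<zero> \<prec> l \<longrightarrow> pr x \<zero> \<epsilon> d) \<and>
     (\<forall>x. x \<prec> l \<longrightarrow> (\<forall>y. y \<prec> l \<longrightarrow> (\<forall>j. j \<prec> l \<longrightarrow> pr x y \<in> R \<longrightarrow> pr x j \<prec> l \<longrightarrow>
        pr x j \<epsilon> d \<longrightarrow> pr y (j \<oplus> \<one>) \<prec> l \<longrightarrow> pr y (j \<oplus> \<one>) \<epsilon> d)))"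
proof -
  have "(\<forall>x y b. pr x y \<prec> l \<longrightarrow> pr x y \<epsilon> d \<longrightarrow> pr x b \<in> H \<longrightarrow> \<not> b \<preceq> y) \<longleftrightarrow>
     (\<forall>x. x \<prec> l \<longrightarrow> (\<forall>y. y \<prec> l \<longrightarrow> (\<forall>b. b \<preceq> y \<longrightarrow>
        pr x y \<prec> l \<longrightarrow> pr x y \<epsilon> d \<longrightarrow> \<not> pr x b \<in> H)))"
    by (auto dest: pr_less)
  moreover have "(\<forall>x. x \<in> S \<longrightarrow> pr x \<zero> \<prec> l \<longrightarrow> pr x \<zero> \<epsilon> d) \<longleftrightarrow>
     (\<forall>x. x \<prec> l \<longrightarrow> x \<in> S \<longrightarrow> pr x \<zero> \<prec> l \<longrightarrow> pr x \<zero> \<epsilon> d)"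
    by (auto dest: pr_less)
  moreover have "(\<forall>x y j. pr x y \<in> R \<longrightarrow> pr x j \<prec> l \<longrightarrow> pr x j \<epsilon> d \<longrightarrow>
      pr y (j \<oplus> \<one>) \<prec> l \<longrightarrow> pr y (j \<oplus> \<one>) \<epsilon> d) \<longleftrightarrow>
     (\<forall>x. x \<prec> l \<longrightarrow> (\<forall>y. y \<prec> l \<longrightarrow> (\<forall>j. j \<prec> l \<longrightarrow> pr x y \<in> R \<longrightarrow> pr x j \<prec> l \<longrightarrow>
        pr x j \<epsilon> d \<longrightarrow> pr y (j \<oplus> \<one>) \<prec> l \<longrightarrow> pr y (j \<oplus> \<one>) \<epsilon> d)))"
    by (auto dest: pr_less)
  ultimately show ?thesis unfolding partial_weight_def by simp
qed

lemma tree_partial_weight: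
  assumes sets: "S \<in> Sets M" "R \<in> Sets M" "H \<in> Sets M" and rel: "relation_onM M R S"
    and bound: "\<And>s l a b. decreasing_seqM M s l R S \<Longrightarrow> pr \<zero> a \<epsilon> s \<Longrightarrow> pr a b \<in> H \<Longrightarrow> l \<preceq> b"
  shows "tree (partial_weight S R H)"
  unfolding tree_def
proof (intro conjI allI impI)
  show "R1 (\<lambda>e. partial_weight S R H (e 1) (e 0))"
    unfolding partial_weight_bounded by (intro R1_intros R1_fin_mem sets)
  show "partial_weight S R H c k"
    if T: "partial_weight S R H d l" and kl: "k \<preceq> l" and eq: "\<forall>i. i \<prec> k \<longrightarrow> (i \<epsilon> d \<longleftrightarrow> i \<epsilon> c)" for c d k l
  proof -
    have l: "i \<prec> l" and c: "i \<epsilon> c \<longleftrightarrow> i \<epsilon> d" if "i \<prec> k" for i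
      using that kl eq N.less_le_trans by blast+
    show ?thesis
      unfolding partial_weight_def
    proof (intro conjI allI impI)
      show "\<not> b \<preceq> y" if "pr x y \<prec> k" "pr x y \<epsilon> c" "pr x b \<in> H" for x y b
        using T that l[OF that(1)] c[OF that(1)] unfolding partial_weight_def by blast
      show "pr x \<zero> \<epsilon> c" if "x \<in> S" "pr x \<zero> \<prec> k" for x
        using T that l[OF that(2)] c[OF that(2)] unfolding partial_weight_def by blast
      show "pr y (j \<oplus> \<one>) \<epsilon> c"
        if "pr x y \<in> R" "pr x j \<prec> k" "pr x j \<epsilon> c" "pr y (j \<oplus> \<one>) \<prec> k" for x y j
        using T that l[OF that(2)] c[OF that(2)] l[OF that(4)] c[OF that(4)]
        unfolding partial_weight_def by blast
    qed
  qed
  fix l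
  \<comment> \<open>The length j + 1 fits all three clauses: one-element sequences give j = 0, the
    bound gives j < b, and prepending y to a sequence from x raises j by one. The sequence s is
    unbounded here, so \<open>?P\<close> is only Sigma-1, and just its part below l is
    coded.\<close>
  let ?P = "\<lambda>p. \<exists>x j s. p = pr x j \<and> decreasing_seqM M s (j \<oplus> \<one>) R S \<and> pr \<zero> x \<epsilon> s"
  have "S1 (\<lambda>e. ?P (e 0))"
    by (intro S1_ex S1_R1 R1_intros R1_dec R1_fin_mem sets)
  then obtain d where "\<And>p. p \<epsilon> d \<longleftrightarrow> p \<prec> l \<and> ?P p"
    using S1_code_ex[of ?P l] by blast
  then have d: "pr x j \<epsilon> d \<longleftrightarrow> pr x j \<prec> l \<and>
      (\<exists>s. decreasing_seqM M s (j \<oplus> \<one>) R S \<and> pr \<zero> x \<epsilon> s)" for x j by simp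
  have "partial_weight S R H d l"
    unfolding partial_weight_def
  proof (intro conjI allI impI)
    fix x y b assume "pr x y \<epsilon> d" "pr x b \<in> H"
    then have "y \<oplus> \<one> \<preceq> b" unfolding d using bound by blast
    then show "\<not> b \<preceq> y" by (simp add: suc_le_iff N.not_le)
  next
    fix x assume "x \<in> S" "pr x \<zero> \<prec> l"
    moreover have "\<not> pr \<zero> z \<epsilon> fcode \<zero> (\<lambda>_. False)" for z
      using dec_seq[OF dec_Nil[of R S], of \<zero>] by (auto simp: not_less_zero)
    ultimately show "pr x \<zero> \<epsilon> d"
      unfolding d using dec_Cons[OF dec_Nil, of x S R] by blast
  next
    fix x y j assume xy: "pr x y \<in> R" and x: "pr x j \<epsilon> d" and y: "pr y (j \<oplus> \<one>) \<prec> l"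
    obtain s where s: "decreasing_seqM M s (j \<oplus> \<one>) R S" "pr \<zero> x \<epsilon> s" using x unfolding d by blast
    have "y \<in> S" using rel xy unfolding relation_onM_def by auto
    moreover have "pr z y \<in> R" if "pr \<zero> z \<epsilon> s" for z
      using dec_unique[OF s(1) that s(2)] xy by simp
    ultimately show "pr y (j \<oplus> \<one>) \<epsilon> d" unfolding d using y dec_Cons[OF s(1)] by blast
  qed
  then show "\<exists>d. partial_weight S R H d l" by blast
qed

text \<open>Let u and v be the least numbers missing at x and at y, where x R y. Then v is not 0,
  and v = j + 1 with j < u is impossible, since (x,j) in X forces (y,j+1) into X; so u < v.\<close>

lemma bound_imp_weight:
  assumes wkl_sets "S \<in> Sets M" "R \<in> Sets M" "relation_onM M R S" "has_bound S R"
  shows "has_weight S R"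
proof -
  obtain H where H: "H \<in> Sets M" and h: "fun_onM M H S"
    and b: "\<And>s l a b. decreasing_seqM M s l R S \<Longrightarrow> pr \<zero> a \<epsilon> s \<Longrightarrow> pr a b \<in> H \<Longrightarrow> l \<preceq> b"
    using assms(5) unfolding has_bound_def leM_def by blast
  have "tree (partial_weight S R H)"
    by (rule tree_partial_weight[OF assms(2,3) H assms(4)]) (rule b)
  with assms(1) obtain X where X: "X \<in> Sets M"
    and T: "\<And>d l. (\<And>i. i \<prec> l \<Longrightarrow> i \<epsilon> d \<longleftrightarrow> i \<in> X) \<Longrightarrow> partial_weight S R H d l"
    unfolding wkl_sets_def by blast
  have ex: "\<exists>d. partial_weight S R H d l \<and> (\<forall>i. i \<prec> l \<longrightarrow> (i \<epsilon> d \<longleftrightarrow> i \<in> X))" for l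
  proof -
    have "S1 (\<lambda>e. e 0 \<in> X)" by (intro S1_R1 R1_intros X)
    then obtain d where "\<forall>i. i \<epsilon> d \<longleftrightarrow> i \<prec> l \<and> i \<in> X"
      using S1_code_ex[of "\<lambda>i. i \<in> X" l] by blast
    then show ?thesis using T[of l d] by blast
  qed
  have X1: "\<not> b \<preceq> y" if "pr x y \<in> X" "pr x b \<in> H" for x y b
  proof -
    obtain d where d: "partial_weight S R H d (pr x y \<oplus> \<one>)"
      "\<forall>i. i \<prec> pr x y \<oplus> \<one> \<longrightarrow> (i \<epsilon> d \<longleftrightarrow> i \<in> X)" using ex by blast
    have "pr x y \<prec> pr x y \<oplus> \<one>" by (simp add: less_suc)
    with d that show ?thesis unfolding partial_weight_def by blast
  qed
  have X2: "pr x \<zero> \<in> X" if "x \<in> S" for x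
  proof -
    obtain d where d: "partial_weight S R H d (pr x \<zero> \<oplus> \<one>)"
      "\<forall>i. i \<prec> pr x \<zero> \<oplus> \<one> \<longrightarrow> (i \<epsilon> d \<longleftrightarrow> i \<in> X)" using ex by blast
    have "pr x \<zero> \<prec> pr x \<zero> \<oplus> \<one>" by (simp add: less_suc)
    with d that show ?thesis unfolding partial_weight_def by blast
  qed
  have X3: "pr y (j \<oplus> \<one>) \<in> X" if "pr x y \<in> R" "pr x j \<in> X" for x y j
  proof -
    obtain c where c: "pr x j \<prec> c \<oplus> \<one>" "pr y (j \<oplus> \<one>) \<prec> c \<oplus> \<one>" by (rule two_bound)
    obtain d where d: "partial_weight S R H d (c \<oplus> \<one>)"
      "\<forall>i. i \<prec> c \<oplus> \<one> \<longrightarrow> (i \<epsilon> d \<longleftrightarrow> i \<in> X)" using ex by blast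
    with c that show ?thesis unfolding partial_weight_def by blast
  qed
  \<comment> \<open>X need not be closed downwards in j, so the weight is taken to be the first
    missing j. One exists because (x,b) is missing when b is the bound at x.\<close>
  let ?F = "{p. \<exists>x. x \<preceq> p \<and> (\<exists>y. y \<preceq> p \<and> p = pr x y \<and> x \<in> S \<and> \<not> pr x y \<in> X \<and>
    (\<forall>j. j \<prec> y \<longrightarrow> pr x j \<in> X))}"
  have F: "pr x y \<in> ?F \<longleftrightarrow> x \<in> S \<and> pr x y \<notin> X \<and> (\<forall>j. j \<prec> y \<longrightarrow> pr x j \<in> X)" for x y
    using fst_le_pr[of x y] snd_le_pr[of y x] by auto
  show ?thesis
    unfolding has_weight_def
  proof (intro bexI[of _ ?F] conjI allI impI)
    show "?F \<in> Sets M" by (rule R1_comprehension) (intro R1_intros assms X)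
    show "fun_onM M ?F S"
      unfolding fun_onM_def F
    proof (intro conjI ballI allI impI)
      show "\<exists>x y. x \<in> S \<and> p = pr x y" if "p \<in> ?F" for p using that by blast
      show "\<exists>y. x \<in> S \<and> pr x y \<notin> X \<and> (\<forall>j. j \<prec> y \<longrightarrow> pr x j \<in> X)" if x: "x \<in> S" for x
      proof -
        obtain b where "pr x b \<in> H" using fun_on_ex[OF h x] by blast
        then have b: "pr x b \<notin> X" using X1[of x b b] by auto
        have "S1 (\<lambda>e. \<not> pr x (e 0) \<notin> X)" by (simp, intro S1_R1 R1_intros X)
        then obtain y where "pr x y \<notin> X" "\<And>j. j \<prec> y \<Longrightarrow> \<not> pr x j \<notin> X"
          using b by (rule P1_least[of "\<lambda>y. pr x y \<notin> X" b]) (rule that)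
        then show ?thesis using x by blast
      qed
      show "y = z" if "(x \<in> S \<and> pr x y \<notin> X \<and> (\<forall>j. j \<prec> y \<longrightarrow> pr x j \<in> X)) \<and>
        (x \<in> S \<and> pr x z \<notin> X \<and> (\<forall>j. j \<prec> z \<longrightarrow> pr x j \<in> X))" for x y z
        using that N.linorder_cases[of y z] by blast
    qed
    fix x y u v assume "pr x y \<in> R \<and> pr x u \<in> ?F \<and> pr y v \<in> ?F"
    then have R: "pr x y \<in> R" and u: "\<And>j. j \<prec> u \<Longrightarrow> pr x j \<in> X" and v: "y \<in> S" "pr y v \<notin> X"
      unfolding F by blast+
    show "u \<prec> v"
    proof (rule ccontr)
      assume "\<not> u \<prec> v"
      from zero_or_suc[of v] show False
      proof
        assume "v = \<zero>"
        then show False using X2 v by blast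
      next
        assume "\<exists>j. v = j \<oplus> \<one>"
        then obtain j where j: "v = j \<oplus> \<one>" ..
        then have "j \<prec> u" using \<open>\<not> u \<prec> v\<close> by (simp add: less_suc) (metis N.linorder_cases)
        then show False using X3[OF R u] v j by blast
      qed
    qed
  qed
qed

section \<open>Separation\<close>

definition bound_weight :: bool where
  "bound_weight \<longleftrightarrow> (\<forall>S\<in>Sets M. \<forall>R\<in>Sets M. relation_onM M R S \<longrightarrow> has_bound S R \<longrightarrow> has_weight S R)"

definition separation :: bool where
  "separation \<longleftrightarrow> (\<forall>\<alpha> \<beta>. R1 (\<lambda>e. \<alpha> (e 1) (e 0)) \<longrightarrow> R1 (\<lambda>e. \<beta> (e 1) (e 0)) \<longrightarrow>
     (\<forall>x v w. \<not> (\<alpha> x v \<and> \<beta> x w)) \<longrightarrow>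
     (\<exists>D\<in>Sets M. \<forall>x w. (\<alpha> x w \<longrightarrow> x \<in> D) \<and> (\<beta> x w \<longrightarrow> x \<notin> D)))"

text \<open>
  Elements (0,x) and (1,x) are linked through (2,(x,w)) in increasing order if w witnesses alpha(x),
  and through (3,(x,w)) in decreasing order if w witnesses beta(x). By disjointness no chain has
  more than three elements, and the two weights of (0,x) and (1,x) decide the separating set.
\<close>

lemma bound_weight_imp_separation:
  assumes bound_weight shows separation
  unfolding separation_def
proof (intro allI impI)
  fix \<alpha> \<beta> :: "'a \<Rightarrow> 'a \<Rightarrow> bool"
  assume R: "R1 (\<lambda>e. \<alpha> (e 1) (e 0))" "R1 (\<lambda>e. \<beta> (e 1) (e 0))"
    and disj: "\<forall>x v w. \<not> (\<alpha> x v \<and> \<beta> x w)"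
  define two where "two = \<one> \<oplus> \<one>"
  define three where "three = two \<oplus> \<one>"
  have num [simp]: "two \<noteq> \<zero>" "\<zero> \<noteq> two" "two \<noteq> \<one>" "\<one> \<noteq> two" "three \<noteq> \<zero>" "\<zero> \<noteq> three"
    "three \<noteq> \<one>" "\<one> \<noteq> three" "three \<noteq> two" "two \<noteq> three"
    using suc_neq_0 suc_inj[of _ \<zero>] suc_inj[of _ \<one>]
    unfolding two_def three_def by (metis zero_add)+
  let ?A = "\<lambda>x. pr \<zero> x" and ?B = "\<lambda>x. pr \<one> x"
  let ?C = "\<lambda>x w. pr two (pr x w)" and ?E = "\<lambda>x w. pr three (pr x w)"
  let ?Q = "\<lambda>p x w. \<alpha> x w \<and> (p = pr (?A x) (?C x w) \<or> p = pr (?C x w) (?B x)) \<or>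
    \<beta> x w \<and> (p = pr (?B x) (?E x w) \<or> p = pr (?E x w) (?A x))"
  let ?R = "{p. \<exists>x. x \<preceq> p \<and> (\<exists>w. w \<preceq> p \<and> ?Q p x w)}"
  have Rset: "?R \<in> Sets M"
    by (rule R1_comprehension) (intro R1_intros R1_comp2[OF R(1)] R1_comp2[OF R(2)])
  \<comment> \<open>Both x and the witness w occur inside the coded pair p, so the quantifiers
    defining \<open>?R\<close> can be bounded and the relation is a set of the model.\<close>
  have le: "x \<preceq> p \<and> w \<preceq> p" if "?Q p x w" for p x w
    using that by (elim disjE conjE; simp) (meson fst_le_pr snd_le_pr N.order_trans)+
  then have Riff: "p \<in> ?R \<longleftrightarrow> (\<exists>x w. ?Q p x w)" for p by blast
  have uniq: False if "\<alpha> x w" "\<beta> x v" for x v w using disj that by blast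
  have UNIV: "UNIV \<in> Sets M"
    using R1_comprehension[OF R1_eq[OF F1_const F1_const], of \<zero> \<zero>] by simp
  have rel: "relation_onM M ?R UNIV"
    unfolding relation_onM_def by blast
  have "has_bound UNIV ?R"
    unfolding has_bound_def
  proof (intro bexI[of _ "{p. \<exists>x. x \<preceq> p \<and> p = pr x three}"] conjI allI impI)
    show "{p. \<exists>x. x \<preceq> p \<and> p = pr x three} \<in> Sets M" by (rule R1_comprehension) (intro R1_intros)
    show "fun_onM M {p. \<exists>x. x \<preceq> p \<and> p = pr x three} UNIV"
      unfolding fun_onM_def using fst_le_pr by auto
    fix s l a b
    assume *: "decreasing_seqM M s l ?R UNIV \<and> pr \<zero> a \<epsilon> s \<and> pr a b \<in> {p. \<exists>x. x \<preceq> p \<and> p = pr x three}"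
    then have b: "b = three" by auto
    note dec = conjunct1[OF *]
    show "l \<prec> b \<or> l = b"
    proof (rule ccontr)
      assume "\<not> (l \<prec> b \<or> l = b)"
      then have l: "three \<prec> l" unfolding b by (metis N.linorder_cases)
      have "\<one> \<prec> two" "two \<prec> three" unfolding two_def three_def by (simp_all add: less_suc)
      with l have l': "two \<prec> l" "\<one> \<prec> l" by (meson N.less_trans)+
      obtain x1 where x1: "pr (\<zero> \<oplus> \<one>) x1 \<epsilon> s" using dec_seq[OF dec, of \<one>] l' by auto
      obtain x2 where x2: "pr (\<one> \<oplus> \<one>) x2 \<epsilon> s" using dec_seq[OF dec, of two] l' two_def by auto
      obtain x3 where x3: "pr (two \<oplus> \<one>) x3 \<epsilon> s" using dec_seq[OF dec, of three] l three_def by auto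
      have "pr x1 a \<in> ?R" using dec_step[OF dec _ x1] * by blast
      moreover have "pr x2 x1 \<in> ?R" using dec_step[OF dec _ x2] x1 by simp
      \<comment> \<open>Connecting elements alternate with elements (0,x) and (1,x), so one of the
        inner entries x1, x2 is of the latter form. It is linked to a connecting element of each
        kind, giving x witnesses for both alpha and beta.\<close>
      moreover have "pr x3 x2 \<in> ?R" using dec_step[OF dec _ x3] x2 two_def by simp
      ultimately obtain y1 w1 y2 w2 y3 w3 where
        "?Q (pr x1 a) y1 w1" "?Q (pr x2 x1) y2 w2" "?Q (pr x3 x2) y3 w3"
        unfolding Riff by blast
      then show False using uniq by (elim disjE conjE; simp)
    qed
  qed
  then have "has_weight UNIV ?R"
    using assms UNIV Rset rel unfolding bound_weight_def by blast
  then obtain F where F: "F \<in> Sets M" and f: "fun_onM M F UNIV"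
    and w: "\<And>x y u v. pr x y \<in> ?R \<Longrightarrow> pr x u \<in> F \<Longrightarrow> pr y v \<in> F \<Longrightarrow> u \<prec> v"
    unfolding has_weight_def by blast
  let ?P = "\<lambda>x. \<exists>u v. pr (?A x) u \<in> F \<and> pr (?B x) v \<in> F \<and> u \<prec> v"
  have ex: "\<exists>u. pr x u \<in> F" for x using fun_on_ex[OF f UNIV_I] .
  have u: "u = v" if "pr x u \<in> F" "pr x v \<in> F" for x u v using fun_on_unique[OF f that] .
  \<comment> \<open>F is total and single-valued, so failure of the comparison is again witnessed by
    a pair of weights; this makes \<open>?P\<close> Delta-1.\<close>
  have neg: "\<not> ?P x \<longleftrightarrow> (\<exists>u v. pr (?A x) u \<in> F \<and> pr (?B x) v \<in> F \<and> \<not> u \<prec> v)" for x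
  proof -
    obtain a b where "pr (?A x) a \<in> F" "pr (?B x) b \<in> F" using ex by blast
    then show ?thesis using u[of "?A x" a] u[of "?B x" b] by blast
  qed
  have "R1 (\<lambda>e. ?P (e 0))"
    unfolding R1_def neg by (intro conjI S1_ex S1_R1 R1_intros F)
  then have "Collect ?P \<in> Sets M" by (rule R1_comprehension)
  moreover have "(\<alpha> x v \<longrightarrow> x \<in> Collect ?P) \<and> (\<beta> x v \<longrightarrow> x \<notin> Collect ?P)" for x v
  proof (intro conjI impI)
    obtain a b where ab: "pr (?A x) a \<in> F" "pr (?B x) b \<in> F" using ex by blast
    {
      assume "\<alpha> x v"
      then have R: "pr (?A x) (?C x v) \<in> ?R" "pr (?C x v) (?B x) \<in> ?R" unfolding Riff by blast+
      obtain c where "pr (?C x v) c \<in> F" using ex by blast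
      then have "a \<prec> b" using w[OF R(1) ab(1)] w[OF R(2) _ ab(2)] by (meson N.less_trans)
      then show "x \<in> Collect ?P" using ab by blast
    }
    {
      assume "\<beta> x v"
      then have R: "pr (?B x) (?E x v) \<in> ?R" "pr (?E x v) (?A x) \<in> ?R" unfolding Riff by blast+
      obtain c where "pr (?E x v) c \<in> F" using ex by blast
      then have "b \<prec> a" using w[OF R(1) ab(2)] w[OF R(2) _ ab(1)] by (meson N.less_trans)
      then have "\<not> a \<prec> b" by (meson N.less_asym)
      then show "x \<notin> Collect ?P" using ab neg by blast
    }
  qed
  ultimately show "\<exists>D\<in>Sets M. \<forall>x w. (\<alpha> x w \<longrightarrow> x \<in> D) \<and> (\<beta> x w \<longrightarrow> x \<notin> D)" by blast
qed

section \<open>From separation to paths through trees\<close>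

definition ext :: "('a \<Rightarrow> 'a \<Rightarrow> bool) \<Rightarrow> bool \<Rightarrow> 'a \<Rightarrow> 'a \<Rightarrow> 'a \<Rightarrow> bool" where
  "ext T y d l n \<longleftrightarrow> (\<exists>c. T c n \<and> (\<forall>i. i \<prec> l \<longrightarrow> (i \<epsilon> c \<longleftrightarrow> i \<epsilon> d)) \<and> (l \<epsilon> c \<longleftrightarrow> y))"

text \<open>Cutting c off at n leaves the node unchanged and replaces c by a least code, which
  \<open>code_bound n\<close> bounds.\<close>

lemma tree_trim:
  assumes "tree T" "T c n"
  shows "\<exists>c'. c' \<preceq> code_bound n \<and> T c' n \<and> (\<forall>i. i \<prec> n \<longrightarrow> (i \<epsilon> c' \<longleftrightarrow> i \<epsilon> c))"
proof -
  have R: "R1 (\<lambda>e. e 0 \<epsilon> c)" by (intro R1_fin_mem R1_intros)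
  have mem: "i \<epsilon> fcode n (\<lambda>i. i \<epsilon> c) \<longleftrightarrow> i \<prec> n \<and> i \<epsilon> c" for i
    using fcode_mem[of "\<lambda>i. i \<epsilon> c", OF R] .
  have "T (fcode n (\<lambda>i. i \<epsilon> c)) n"
    by (rule tree_down[OF assms]) (simp_all add: mem)
  then show ?thesis using fcode_le_code_bound[of "\<lambda>i. i \<epsilon> c", OF R] mem by blast
qed

text \<open>For l < n, \<open>ext\<close> says that the child with bit y of the node d cut at l has
  a descendant at level n. Trimming the descendant bounds the search, so the condition becomes
  Delta-1.\<close>

lemma ext_bounded:
  assumes "tree T" "l \<prec> n"
  shows "ext T y d l n \<longleftrightarrow>
    (\<exists>c. c \<preceq> code_bound n \<and> (T c n \<and> (\<forall>i. i \<prec> l \<longrightarrow> (i \<epsilon> c \<longleftrightarrow> i \<epsilon> d)) \<and> (l \<epsilon> c \<longleftrightarrow> y)))"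
proof
  assume "ext T y d l n"
  then obtain c where c: "T c n" "\<forall>i. i \<prec> l \<longrightarrow> (i \<epsilon> c \<longleftrightarrow> i \<epsilon> d)" "l \<epsilon> c \<longleftrightarrow> y"
    unfolding ext_def by blast
  obtain c' where c': "c' \<preceq> code_bound n" "T c' n" "\<And>i. i \<prec> n \<Longrightarrow> i \<epsilon> c' \<longleftrightarrow> i \<epsilon> c"
    using tree_trim[OF assms(1) c(1)] by blast
  have "i \<prec> n" if "i \<prec> l" for i using that assms(2) by (rule N.less_trans)
  then have "\<forall>i. i \<prec> l \<longrightarrow> (i \<epsilon> c' \<longleftrightarrow> i \<epsilon> d)" using c(2) c'(3) by simp
  moreover have "l \<epsilon> c' \<longleftrightarrow> y" using c(3) c'(3)[OF assms(2)] by simp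
  ultimately show "\<exists>c. c \<preceq> code_bound n \<and> (T c n \<and> (\<forall>i. i \<prec> l \<longrightarrow> (i \<epsilon> c \<longleftrightarrow> i \<epsilon> d)) \<and> (l \<epsilon> c \<longleftrightarrow> y))"
    using c' by blast
qed (auto simp: ext_def)

lemma ext_mono:
  assumes T: "tree T" and "ext T y d l n" "m \<preceq> n"
  shows "ext T y d l m"
proof -
  obtain c where c: "T c n" "\<forall>i. i \<prec> l \<longrightarrow> (i \<epsilon> c \<longleftrightarrow> i \<epsilon> d)" "l \<epsilon> c \<longleftrightarrow> y"
    using assms(2) unfolding ext_def by blast
  have "T c m" by (rule tree_down[OF T c(1) assms(3)]) simp
  then show ?thesis using c unfolding ext_def by blast
qed

lemma bex_pr:
  "(\<exists>x. x \<preceq> pr a b \<and> (\<exists>y. y \<preceq> pr a b \<and> pr a b = pr x y \<and> Q x y)) \<longleftrightarrow> Q a b"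
  using fst_le_pr[of a b] snd_le_pr[of b a] by auto

lemma separation_imp_wkl_sets:
  assumes separation shows wkl_sets
  unfolding wkl_sets_def
proof (intro allI impI)
  fix T assume T: "tree T"
  let ?E = "\<lambda>y d l n. \<exists>c. c \<preceq> code_bound n \<and> (T c n \<and> (\<forall>i. i \<prec> l \<longrightarrow> (i \<epsilon> c \<longleftrightarrow> i \<epsilon> d)) \<and> (l \<epsilon> c \<longleftrightarrow> y))"
  \<comment> \<open>Level n witnesses that exactly the child with bit y is still alive. Since death
    is permanent by \<open>ext_mono\<close>, the two bits cannot both have such witnesses, at equal
    or at different levels.\<close>
  define only where "only y x n \<longleftrightarrow> (\<exists>d. d \<preceq> x \<and> (\<exists>l. l \<preceq> x \<and> x = pr d l \<and> l \<prec> n \<and> ?E y d l n \<and> \<not> ?E (\<not> y) d l n))" for y x n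
  have const: "R1 (\<lambda>e. y)" for y
    using R1_eq[OF F1_const F1_const, of \<zero> "if y then \<zero> else \<one>"] by (cases y) simp_all
  have R: "R1 (\<lambda>e. only y (e 1) (e 0))" for y
    unfolding only_def by (intro R1_intros R1_fin_mem tree_R1[OF T] F1_code_bound const)
  have only: "only y (pr d l) n \<longleftrightarrow> l \<prec> n \<and> ext T y d l n \<and> \<not> ext T (\<not> y) d l n" for y d l n
    unfolding only_def bex_pr using ext_bounded[OF T, of l n _ d] by blast
  have "\<not> (only True x n \<and> only False x m)" for x n m
  proof
    assume *: "only True x n \<and> only False x m"
    then obtain d l where x: "x = pr d l" unfolding only_def by blast
    from * have "ext T True d l n" "\<not> ext T False d l n" "ext T False d l m" "\<not> ext T True d l m"
      unfolding x only by simp_all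
    then show False using ext_mono[OF T] le_total by blast
  qed
  then have "\<exists>D\<in>Sets M. \<forall>x n. (only True x n \<longrightarrow> x \<in> D) \<and> (only False x n \<longrightarrow> x \<notin> D)"
    by (intro assms[unfolded separation_def, THEN spec, THEN spec, THEN mp, THEN mp, THEN mp, OF R R] allI)
  then obtain D where D: "D \<in> Sets M"
    "\<And>x n. only True x n \<Longrightarrow> x \<in> D" "\<And>x n. only False x n \<Longrightarrow> x \<notin> D" by blast
  have D1: "pr d l \<in> D" if "l \<prec> n" "ext T True d l n" "\<not> ext T False d l n" for d l n
    by (rule D(2)[of _ n]) (use that in \<open>simp only: only\<close>, simp)
  have D0: "pr d l \<notin> D" if "l \<prec> n" "ext T False d l n" "\<not> ext T True d l n" for d l n
    by (rule D(3)[of _ n]) (use that in \<open>simp only: only\<close>, simp)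
  \<comment> \<open>Least codes of nodes: D is always asked about the same representative, so sets
    that agree below i receive the same answer.\<close>
  define tr where "tr d i = fcode i (\<lambda>j. j \<epsilon> d)" for d i
  have tr: "j \<epsilon> tr d i \<longleftrightarrow> j \<prec> i \<and> j \<epsilon> d" for j d i
    unfolding tr_def by (rule fcode_mem[of "\<lambda>j. j \<epsilon> d"]) (intro R1_fin_mem R1_intros)
  have tr_cong: "tr d i = tr c i" if "\<And>j. j \<prec> i \<Longrightarrow> j \<epsilon> d \<longleftrightarrow> j \<epsilon> c" for c d i
    unfolding tr_def using that by (rule fcode_cong)
  have F1_tr: "F1 (\<lambda>e. tr (f e) (g e))" if "F1 f" "F1 g" for f g
    by (rule F1_comp2[OF _ that]) (unfold tr_def, intro F1_fcode R1_intros R1_fin_mem)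
  \<comment> \<open>Bit i is the answer of D at the node formed by the bits before i. This is a
    course-of-values recursion, carried out through coded approximations.\<close>
  define follows where "follows d k \<longleftrightarrow> (\<forall>i. i \<prec> k \<longrightarrow> (i \<epsilon> d \<longleftrightarrow> pr (tr d i) i \<in> D))" for d k
  have R1_follows: "R1 (\<lambda>e. follows (f e) (g e))" if "F1 f" "F1 g" for f g
    by (rule R1_comp2[OF _ that]) (unfold follows_def, intro R1_intros R1_fin_mem F1_tr D(1))
  have follows_ex: "\<exists>d. follows d k" for k
  proof (rule S1_induct[where a = k])
    show "S1 (\<lambda>e. \<exists>d. follows d (e 0))" by (intro S1_ex S1_R1 R1_follows R1_intros)
    show "\<exists>d. follows d \<zero>" by (simp add: follows_def not_less_zero)
    fix k assume "\<exists>d. follows d k"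
    then obtain d where d: "follows d k" ..
    let ?P = "\<lambda>i. i \<prec> k \<and> i \<epsilon> d \<or> i = k \<and> pr (tr d k) k \<in> D"
    have "R1 (\<lambda>e. ?P (e 0))" by (intro R1_intros R1_fin_mem D(1))
    then have mem: "i \<epsilon> fcode (k \<oplus> \<one>) ?P \<longleftrightarrow> i \<prec> k \<oplus> \<one> \<and> ?P i" for i
      by (rule fcode_mem[of ?P])
    have same: "i \<epsilon> fcode (k \<oplus> \<one>) ?P \<longleftrightarrow> i \<epsilon> d" if "i \<prec> k" for i
      using that by (auto simp: mem less_suc)
    have "tr (fcode (k \<oplus> \<one>) ?P) i = tr d i" if "i \<preceq> k" for i
      by (rule tr_cong, rule same) (use that in \<open>meson N.less_le_trans\<close>)
    moreover have "k \<epsilon> fcode (k \<oplus> \<one>) ?P \<longleftrightarrow> pr (tr d k) k \<in> D"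
      by (auto simp: mem less_suc)
    ultimately have "follows (fcode (k \<oplus> \<one>) ?P) (k \<oplus> \<one>)"
      using d same unfolding follows_def less_suc leM_def by auto
    then show "\<exists>d. follows d (k \<oplus> \<one>)" by blast
  qed
  have follows_le: "follows d k" if "follows d l" "k \<preceq> l" for d k l
    using that unfolding follows_def by (meson N.less_le_trans)
  have follows_unique: "i \<epsilon> c \<longleftrightarrow> i \<epsilon> d" if c: "follows c k" and d: "follows d k" and "i \<prec> k" for c d k i
  proof -
    have "i \<prec> k \<longrightarrow> (i \<epsilon> c \<longleftrightarrow> i \<epsilon> d)"
    proof (rule S1_less_induct[where a = i])
      show "S1 (\<lambda>e. e 0 \<prec> k \<longrightarrow> (e 0 \<epsilon> c \<longleftrightarrow> e 0 \<epsilon> d))"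
        by (intro S1_R1 R1_intros R1_fin_mem)
      fix i assume IH: "\<And>j. j \<prec> i \<Longrightarrow> j \<prec> k \<longrightarrow> (j \<epsilon> c \<longleftrightarrow> j \<epsilon> d)"
      show "i \<prec> k \<longrightarrow> (i \<epsilon> c \<longleftrightarrow> i \<epsilon> d)"
      proof
        assume i: "i \<prec> k"
        have "tr c i = tr d i"
          by (rule tr_cong) (use IH i in \<open>meson N.less_trans\<close>)
        then show "i \<epsilon> c \<longleftrightarrow> i \<epsilon> d" using c d i unfolding follows_def by simp
      qed
    qed
    then show ?thesis using \<open>i \<prec> k\<close> by simp
  qed
  \<comment> \<open>Approximations of a given length exist and agree, so a missing element is
    likewise witnessed by an approximation and the set is Delta-1.\<close>
  let ?X = "{i. \<exists>d. follows d (i \<oplus> \<one>) \<and> i \<epsilon> d}"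
  have less_suc_self: "i \<prec> i \<oplus> \<one>" for i by (simp add: less_suc)
  have neg: "\<not> (\<exists>d. follows d (i \<oplus> \<one>) \<and> i \<epsilon> d) \<longleftrightarrow> (\<exists>d. follows d (i \<oplus> \<one>) \<and> \<not> i \<epsilon> d)" for i
    using follows_ex[of "i \<oplus> \<one>"] follows_unique[OF _ _ less_suc_self] by blast
  have X: "?X \<in> Sets M"
    by (rule R1_comprehension, unfold R1_def neg)
      (intro conjI S1_ex S1_R1 R1_intros R1_follows R1_fin_mem)
  have follows_X: "i \<epsilon> c \<longleftrightarrow> i \<in> ?X" if "follows c k" "i \<prec> k" for c k i
  proof -
    have c: "follows c (i \<oplus> \<one>)" using that(2) by (intro follows_le[OF that(1)]) (simp add: suc_le_iff)
    have "i \<epsilon> c" if "follows d (i \<oplus> \<one>)" "i \<epsilon> d" for d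
      using follows_unique[OF that(1) c less_suc_self] that(2) by simp
    then show ?thesis using c by auto
  qed
  \<comment> \<open>The node formed by the first k bits of c has descendants at every level n at or
    above k. With the search for d bounded by \<open>code_bound n\<close> this is Pi-1 in k, hence
    the use of \<open>P1_induct\<close>.\<close>
  have path: "k \<preceq> l \<longrightarrow> (\<forall>n. k \<preceq> n \<longrightarrow>
      (\<exists>d. d \<preceq> code_bound n \<and> (T d n \<and> (\<forall>i. i \<prec> k \<longrightarrow> (i \<epsilon> d \<longleftrightarrow> i \<epsilon> c)))))" (is "?path k")
    if c: "follows c l" for c k l
  proof (rule P1_induct[where P = ?path])
    have neg: "\<not> ?path k \<longleftrightarrow> k \<preceq> l \<and> (\<exists>n. k \<preceq> n \<and>
      \<not> (\<exists>d. d \<preceq> code_bound n \<and> (T d n \<and> (\<forall>i. i \<prec> k \<longrightarrow> (i \<epsilon> d \<longleftrightarrow> i \<epsilon> c)))))" for k by blast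
    show "S1 (\<lambda>e. \<not> ?path (e 0))"
      unfolding neg
      by (intro S1_conj S1_ex S1_R1[OF R1_le] S1_R1[OF R1_not] R1_intros R1_fin_mem tree_R1[OF T] F1_code_bound)
    show "?path \<zero>" using tree_ex[OF T] tree_trim[OF T] by (meson not_less_zero)
    fix k assume IH: "?path k"
    show "?path (k \<oplus> \<one>)"
    proof (intro impI allI)
      fix n assume "k \<oplus> \<one> \<preceq> l" and "k \<oplus> \<one> \<preceq> n"
      then have k: "k \<prec> l" "k \<prec> n" by (simp_all add: suc_le_iff)
      let ?t = "tr c k"
      have kc: "k \<epsilon> c \<longleftrightarrow> pr ?t k \<in> D" using c k(1) unfolding follows_def by blast
      obtain d where "T d n" "\<forall>i. i \<prec> k \<longrightarrow> (i \<epsilon> d \<longleftrightarrow> i \<epsilon> c)"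
        using IH k by (meson N.less_imp_le)
      then have "ext T (k \<epsilon> d) ?t k n" unfolding ext_def by (intro exI[of _ d]) (simp add: tr)
      \<comment> \<open>If d takes the other bit at k, the bit of c must also be alive at level n:
        otherwise D would have been forced to prescribe the bit of d.\<close>
      then have "ext T (k \<epsilon> c) ?t k n"
        using D1[OF k(2), of ?t] D0[OF k(2), of ?t] kc by (cases "k \<epsilon> d"; cases "k \<epsilon> c") auto
      then obtain d where d: "T d n" "\<forall>i. i \<prec> k \<longrightarrow> (i \<epsilon> d \<longleftrightarrow> i \<epsilon> c)" "k \<epsilon> d \<longleftrightarrow> k \<epsilon> c"
        unfolding ext_def by (auto simp: tr)
      obtain d' where d': "d' \<preceq> code_bound n" "T d' n" "\<And>i. i \<prec> n \<Longrightarrow> i \<epsilon> d' \<longleftrightarrow> i \<epsilon> d"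
        using tree_trim[OF T d(1)] by blast
      have "i \<epsilon> d' \<longleftrightarrow> i \<epsilon> c" if i: "i \<prec> k \<oplus> \<one>" for i
      proof -
        have "i \<prec> n" using i \<open>k \<oplus> \<one> \<preceq> n\<close> by (rule N.less_le_trans)
        then show ?thesis using d' d(2,3) i by (auto simp: less_suc)
      qed
      then show "\<exists>d. d \<preceq> code_bound n \<and> (T d n \<and> (\<forall>i. i \<prec> k \<oplus> \<one> \<longrightarrow> (i \<epsilon> d \<longleftrightarrow> i \<epsilon> c)))"
        using d' by blast
    qed
  qed
  have "T d l" if d: "\<forall>i. i \<prec> l \<longrightarrow> (i \<epsilon> d \<longleftrightarrow> i \<in> ?X)" for d l
  proof -
    obtain c where c: "follows c l" using follows_ex by blast
    then obtain b where b: "T b l" "\<forall>i. i \<prec> l \<longrightarrow> (i \<epsilon> b \<longleftrightarrow> i \<epsilon> c)"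
      using path[OF c, of l] by auto
    show ?thesis
    proof (rule tree_down[OF T b(1)])
      show "i \<epsilon> b \<longleftrightarrow> i \<epsilon> d" if "i \<prec> l" for i
        using b(2) d follows_X[OF c that] that by blast
    qed simp
  qed
  then show "\<exists>X\<in>Sets M. \<forall>d l. (\<forall>i. i \<prec> l \<longrightarrow> (i \<epsilon> d \<longleftrightarrow> i \<in> X)) \<longrightarrow> T d l"
    using X by blast
qed

lemma wkl_iff: "wkl \<longleftrightarrow> (\<forall>S\<in>Sets M. \<forall>R\<in>Sets M. relation_onM M R S \<longrightarrow> (has_bound S R \<longleftrightarrow> has_weight S R))"
proof
  assume wkl
  then show "\<forall>S\<in>Sets M. \<forall>R\<in>Sets M. relation_onM M R S \<longrightarrow> (has_bound S R \<longleftrightarrow> has_weight S R)"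
    using wkl_imp_wkl_sets bound_imp_weight weight_imp_bound by blast
next
  assume "\<forall>S\<in>Sets M. \<forall>R\<in>Sets M. relation_onM M R S \<longrightarrow> (has_bound S R \<longleftrightarrow> has_weight S R)"
  then have bound_weight unfolding bound_weight_def by blast
  then show wkl
    using bound_weight_imp_separation separation_imp_wkl_sets wkl_sets_imp_wkl by blast
qed

end

theorem theorem5p3:
  fixes M :: "'a l2_structure"
  assumes "l2_structure M" and "M \<Turnstile> RCA0"
  shows "M \<Turnstile> WKL0 \<longleftrightarrow> M \<Turnstile> {bound_iff_weight}"
proof -
  interpret rca0 M
    using assms by unfold_locales (simp_all add: l2_structure_def)
  obtain E :: "vname \<Rightarrow> 'a set" where E: "\<And>X. E X \<in> Sets M" by (rule some_env) (rule that)
  \<comment> \<open>Neither principle has parameters, so its truth does not depend on the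
    environment. The environment E shows that the universal closure is not vacuous.\<close>
  have closed: "M \<Turnstile> {\<phi>} \<longleftrightarrow> p" if "\<And>e E. sat M e E \<phi> \<longleftrightarrow> p" for \<phi> p
    using E that by (auto simp: models_def)
  have "M \<Turnstile> WKL0 \<longleftrightarrow> M \<Turnstile> {WKL}"
    using assms(2) by (auto simp: WKL0_def models_def)
  also have "\<dots> \<longleftrightarrow> wkl"
    by (rule closed) (simp only: sat_WKL wkl_def)
  also have "\<dots> \<longleftrightarrow> M \<Turnstile> {bound_iff_weight}"
    unfolding wkl_iff has_bound_def has_weight_def
    by (rule closed[symmetric]) (simp only: sat_bound_iff_weight)
  finally show ?thesis .
qed

end
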